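(* The family of coverability languages of RPNs is strictly included in the family of reachability languages of RPNs.
   Context: A Recursive Petri Net (RPN) is a tuple $\mathcal N=\langle P,T,W^+,W^-,\Omega\rangle$ where $P$ is a finite set of places, $T=T_{el}\uplus T_{ab}\uplus T_{\tau}$ is a finite set of transitions disjoint from $P$ (elementary, abstract and cut transitions), $W^-\in\mathbb N^{P\times T}$, $W^+\in\mathbb N^{P\times(T_{el}\uplus T_{ab})}$, and $\Omega:T_{ab}\to\mathbb N^P$. Write $W^{\pm}(t)\in\mathbb N^P$ for the column of $t$; markings are compared componentwise. A (concrete) state is either the empty tree $\emptyset$ or a finite rooted tree whose vertices (threads) are taken from a fixed countably infinite set $\mathcal V$, each vertex $v$ labelled by a marking $M_s(v)\in\mathbb N^P$ and each edge labelled by a vector in $\{W^+(t):t\in T_{ab}\}$. Firing rule: a thread $v$ of a state $s\neq\emptyset$ can fire $t$ if $W^-(t)\le M_s(v)$, giving $s\xrightarrow{(v,t)}s'$ where: if $t\in T_{el}$, the marking of $v$ becomes $M_s(v)-W^-(t)+W^+(t)$; if $t\in T_{ab}$, the marking of $v$ becomes $M_s(v)-W^-(t)$ and a new child $w$ of $v$ (a vertex never used before) is created with marking $\Omega(t)$ and edge $v\to w$ labelled $W^+(t)$; if $t\in T_\tau$, the subtree rooted at $v$ is deleted, and if $v$ is the root the result is $\emptyset$, otherwise the marking of the parent $u$ of $v$ is increased by the label of the edge $u\to v$. Quasi-order on states: $\emptyset\preceq s$ for every $s$; for $s\neq\emptyset$, $s\preceq s'$ iff there is an injective map $f$ from the vertices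 of $s$ to those of $s'$ with $M_s(v)\le M_{s'}(f(v))$ for all $v$ and, for every edge $v\to w$ of $s$ labelled $m$, an edge $f(v)\to f(w)$ of $s'$ labelled $m'\ge m$. A labelled RPN has additionally a labelling $\lambda:T\to\Sigma\cup\{\varepsilon\}$ ($\Sigma$ a finite alphabet), extended to sequences as a monoid morphism. For a labelled RPN $\mathcal N$, initial state $s_0$ and finite set of states $S_f$: the coverability language is $\mathcal L_C(\mathcal N,s_0,S_f)=\{\lambda(\sigma)\mid s_0\xrightarrow{\sigma}s,\ s_f\preceq s\text{ for some }s_f\in S_f\}$, and the reachability language is $\mathcal L_R(\mathcal N,s_0,S_f)=\{\lambda(\sigma)\mid s_0\xrightarrow{\sigma}s,\ s\text{ equals some }s_f\in S_f\text{ up to renaming of vertices}\}$ ($\sigma$ finite). The families of coverability (resp. reachability) languages of RPNs consist of all such languages. *)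

theory Defs
  imports Main
begin

text \<open>
  A vector in \<open>\<nat>\<^sup>P\<close> is a function that vanishes outside \<open>P\<close>, so that equality and the
  componentwise order of vectors are equality and the pointwise order of functions.
\<close>

type_synonym 'p marking = "'p \<Rightarrow> nat"

definition marking_on :: "'p set \<Rightarrow> 'p marking \<Rightarrow> bool" where
  "marking_on P m \<longleftrightarrow> (\<forall>p. p \<notin> P \<longrightarrow> m p = 0)"


section \<open>Recursive Petri nets\<close>

text \<open>
  Places and transitions live in different types, so they are disjoint by construction.
  Here \<open>pre t\<close> and \<open>post t\<close> are the columns \<open>W\<^sup>-(t)\<close> and \<open>W\<^sup>+(t)\<close>, and \<open>start t\<close> is \<open>\<Omega>(t)\<close>;
  \<open>post t\<close> is meaningless for cut transitions and \<open>start t\<close> for non-abstract ones.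
\<close>

record ('p, 't) rpn =
  places :: "'p set"
  elem_trans :: "'t set"
  abs_trans :: "'t set"
  cut_trans :: "'t set"
  pre :: "'t \<Rightarrow> 'p marking"
  post :: "'t \<Rightarrow> 'p marking"
  start :: "'t \<Rightarrow> 'p marking"

definition transitions :: "('p, 't, 'z) rpn_scheme \<Rightarrow> 't set" where
  "transitions N = elem_trans N \<union> abs_trans N \<union> cut_trans N"

definition is_rpn :: "('p, 't, 'z) rpn_scheme \<Rightarrow> bool" where
  "is_rpn N \<longleftrightarrow>
     finite (places N) \<and> finite (transitions N) \<and>
     elem_trans N \<inter> abs_trans N = {} \<and>
     elem_trans N \<inter> cut_trans N = {} \<and>
     abs_trans N \<inter> cut_trans N = {} \<and>
     (\<forall>t \<in> transitions N. marking_on (places N) (pre N t)) \<and>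
     (\<forall>t \<in> elem_trans N \<union> abs_trans N. marking_on (places N) (post N t)) \<and>
     (\<forall>t \<in> abs_trans N. marking_on (places N) (start N t))"


section \<open>States\<close>

text \<open>
  The functions \<open>mark\<close> and \<open>elabel\<close> only matter on \<open>verts\<close> and \<open>edges\<close>, respectively. The empty
  tree is any state without vertices.
\<close>

record ('v, 'p) state =
  verts :: "'v set"
  edges :: "('v \<times> 'v) set"
  mark :: "'v \<Rightarrow> 'p marking"
  elabel :: "'v \<times> 'v \<Rightarrow> 'p marking"

definition empty_state :: "('v, 'p) state" where
  "empty_state = \<lparr>verts = {}, edges = {}, mark = (\<lambda>_ _. 0), elabel = (\<lambda>_ _. 0)\<rparr>"

definition is_empty :: "('v, 'p) state \<Rightarrow> bool" where
  "is_empty s \<longleftrightarrow> verts s = {}"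

definition rooted_tree :: "'v set \<Rightarrow> ('v \<times> 'v) set \<Rightarrow> 'v \<Rightarrow> bool" where
  "rooted_tree V E r \<longleftrightarrow>
     r \<in> V \<and> E \<subseteq> V \<times> V \<and>
     (\<forall>u. (u, r) \<notin> E) \<and>
     (\<forall>v \<in> V - {r}. \<exists>!u. (u, v) \<in> E) \<and>
     (\<forall>v \<in> V. (r, v) \<in> E\<^sup>*)"

definition is_state :: "('p, 't, 'z) rpn_scheme \<Rightarrow> ('v, 'p) state \<Rightarrow> bool" where
  "is_state N s \<longleftrightarrow>
     finite (verts s) \<and>
     (if is_empty s then edges s = {} else (\<exists>r. rooted_tree (verts s) (edges s) r)) \<and>
     (\<forall>v \<in> verts s. marking_on (places N) (mark s v)) \<and>
     (\<forall>e \<in> edges s. elabel s e \<in> post N ` abs_trans N)"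

definition is_root :: "('v, 'p) state \<Rightarrow> 'v \<Rightarrow> bool" where
  "is_root s v \<longleftrightarrow> v \<in> verts s \<and> (\<forall>u. (u, v) \<notin> edges s)"

definition subtree :: "('v, 'p) state \<Rightarrow> 'v \<Rightarrow> 'v set" where
  "subtree s v = {w. (v, w) \<in> (edges s)\<^sup>*}"


section \<open>Firing rule\<close>

text \<open>
  The set \<open>U\<close> contains the vertices used so far; the vertex created by an abstract transition is
  chosen outside \<open>U\<close>.
\<close>

inductive fire ::
  "('p, 't, 'z) rpn_scheme \<Rightarrow> 'v set \<Rightarrow> ('v, 'p) state \<Rightarrow> 'v \<times> 't \<Rightarrow> ('v, 'p) state \<Rightarrow> bool"
  for N :: "('p, 't, 'z) rpn_scheme" and U :: "'v set" and s :: "('v, 'p) state" where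
  elementary:
    "\<lbrakk>v \<in> verts s; t \<in> elem_trans N; pre N t \<le> mark s v\<rbrakk> \<Longrightarrow>
     fire N U s (v, t)
       (s\<lparr>mark := (mark s)(v := (\<lambda>p. mark s v p - pre N t p + post N t p))\<rparr>)"
| abstract:
    "\<lbrakk>v \<in> verts s; t \<in> abs_trans N; pre N t \<le> mark s v; w \<notin> U\<rbrakk> \<Longrightarrow>
     fire N U s (v, t)
       \<lparr>verts = insert w (verts s),
        edges = insert (v, w) (edges s),
        mark = (mark s)(v := (\<lambda>p. mark s v p - pre N t p), w := start N t),
        elabel = (elabel s)((v, w) := post N t)\<rparr>"
| cut_root:
    "\<lbrakk>is_root s v; t \<in> cut_trans N; pre N t \<le> mark s v\<rbrakk> \<Longrightarrow>
     fire N U s (v, t) empty_state"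
| cut_child:
    "\<lbrakk>v \<in> verts s; (u, v) \<in> edges s; t \<in> cut_trans N; pre N t \<le> mark s v\<rbrakk> \<Longrightarrow>
     fire N U s (v, t)
       \<lparr>verts = verts s - subtree s v,
        edges = edges s \<inter> ((- subtree s v) \<times> (- subtree s v)),
        mark = (mark s)(u := (\<lambda>p. mark s u p + elabel s (u, v) p)),
        elabel = elabel s\<rparr>"

text \<open>
  \<open>run N s\<^sub>0 \<sigma> U s\<close>: the sequence \<open>\<sigma>\<close> leads from \<open>s\<^sub>0\<close> to \<open>s\<close>, and \<open>U\<close> is the set of all vertices
  occurring in some state along the way.
\<close>

inductive run ::
  "('p, 't, 'z) rpn_scheme \<Rightarrow> ('v, 'p) state \<Rightarrow> ('v \<times> 't) list \<Rightarrow> 'v set \<Rightarrow> ('v, 'p) state \<Rightarrow> bool"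
  for N :: "('p, 't, 'z) rpn_scheme" and s\<^sub>0 :: "('v, 'p) state" where
  run_Nil: "run N s\<^sub>0 [] (verts s\<^sub>0) s\<^sub>0"
| run_snoc: "\<lbrakk>run N s\<^sub>0 \<sigma> U s; fire N U s vt s'\<rbrakk> \<Longrightarrow> run N s\<^sub>0 (\<sigma> @ [vt]) (U \<union> verts s') s'"


section \<open>Comparing states\<close>

definition state_le :: "('v, 'p) state \<Rightarrow> ('v, 'p) state \<Rightarrow> bool"  (infix "\<preceq>" 50) where
  "s \<preceq> s' \<longleftrightarrow> is_empty s \<or>
     (\<exists>f. inj_on f (verts s) \<and> f ` verts s \<subseteq> verts s' \<and>
          (\<forall>v \<in> verts s. mark s v \<le> mark s' (f v)) \<and>
          (\<forall>(v, w) \<in> edges s. (f v, f w) \<in> edges s' \<and> elabel s (v, w) \<le> elabel s' (f v, f w)))"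

definition state_iso :: "('v, 'p) state \<Rightarrow> ('v, 'p) state \<Rightarrow> bool"  (infix "\<cong>" 50) where
  "s \<cong> s' \<longleftrightarrow>
     (\<exists>f. bij_betw f (verts s) (verts s') \<and>
          (\<forall>v \<in> verts s. mark s v = mark s' (f v)) \<and>
          (\<forall>v \<in> verts s. \<forall>w \<in> verts s. (v, w) \<in> edges s \<longleftrightarrow> (f v, f w) \<in> edges s') \<and>
          (\<forall>(v, w) \<in> edges s. elabel s (v, w) = elabel s' (f v, f w)))"


section \<open>Labelled recursive Petri nets and their languages\<close>

text \<open>The label \<open>None\<close> stands for the empty word.\<close>

record ('p, 't, 'a) labelled_rpn = "('p, 't) rpn" +
  alphabet :: "'a set"
  label :: "'t \<Rightarrow> 'a option"

definition is_labelled_rpn :: "('p, 't, 'a) labelled_rpn \<Rightarrow> bool" where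
  "is_labelled_rpn N \<longleftrightarrow>
     is_rpn N \<and> finite (alphabet N) \<and>
     (\<forall>t \<in> transitions N. set_option (label N t) \<subseteq> alphabet N)"

definition word_of :: "('p, 't, 'a) labelled_rpn \<Rightarrow> ('v \<times> 't) list \<Rightarrow> 'a list" where
  "word_of N \<sigma> = List.map_filter (\<lambda>(v, t). label N t) \<sigma>"

definition coverability_language ::
  "('p, 't, 'a) labelled_rpn \<Rightarrow> ('v, 'p) state \<Rightarrow> ('v, 'p) state set \<Rightarrow> 'a list set" where
  "coverability_language N s\<^sub>0 S\<^sub>f =
     {word_of N \<sigma> | \<sigma> U s. run N s\<^sub>0 \<sigma> U s \<and> (\<exists>s\<^sub>f \<in> S\<^sub>f. s\<^sub>f \<preceq> s)}"

definition reachability_language ::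
  "('p, 't, 'a) labelled_rpn \<Rightarrow> ('v, 'p) state \<Rightarrow> ('v, 'p) state set \<Rightarrow> 'a list set" where
  "reachability_language N s\<^sub>0 S\<^sub>f =
     {word_of N \<sigma> | \<sigma> U s. run N s\<^sub>0 \<sigma> U s \<and> (\<exists>s\<^sub>f \<in> S\<^sub>f. s \<cong> s\<^sub>f)}"

text \<open>
  Threads are natural numbers, a countably infinite set. Since nets are finite, taking names of
  places and transitions from \<open>nat\<close> is no restriction.
\<close>

definition coverability_languages :: "'a list set set" where
  "coverability_languages =
     {coverability_language N s\<^sub>0 S\<^sub>f |
        (N :: (nat, nat, 'a) labelled_rpn) (s\<^sub>0 :: (nat, nat) state) S\<^sub>f.
        is_labelled_rpn N \<and> is_state N s\<^sub>0 \<and> finite S\<^sub>f \<and> (\<forall>s \<in> S\<^sub>f. is_state N s)}"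

definition reachability_languages :: "'a list set set" where
  "reachability_languages =
     {reachability_language N s\<^sub>0 S\<^sub>f |
        (N :: (nat, nat, 'a) labelled_rpn) (s\<^sub>0 :: (nat, nat) state) S\<^sub>f.
        is_labelled_rpn N \<and> is_state N s\<^sub>0 \<and> finite S\<^sub>f \<and> (\<forall>s \<in> S\<^sub>f. is_state N s)}"

end

theory Submission
  imports Defs Complex_Main "HOL-Library.Multiset" "HOL-Library.Countable" "HOL-Library.Infinite_Set"
begin

text \<open>
  Call the set of words that drive a single thread to the empty tree an emptying language; it is a
  reachability language.

  Every coverability language is an emptying language. When a thread is created, the new net guesses
  its duty: to behave normally, to become the image of a vertex \<open>x\<close> of a final state, or to be
  an ancestor of the image of the root. A thread with a duty of the last two kinds cannot be cut
  normally, and silently cuts itself once its marking and the tokens sent back by its children show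
  that the duty is fulfilled.

  The language of all \<open>a\<^sup>n b\<^sup>n c\<^sup>n\<close> is the reachability language of a Petri net, but not an emptying
  language. Otherwise, running every thread to its end as soon as it is created permutes the
  letters of a word, hence does not change it here. Descend to the innermost thread whose word
  contains both \<open>a\<close> and \<open>c\<close>; all \<open>b\<close> are produced inside it. Its word factors, at one of its
  markings, into a part without \<open>c\<close> and a part without \<open>a\<close>. Infinitely many \<open>n\<close> give threads that
  are created by the same transition, so by Dickson's lemma the markings of two of them are
  comparable, and exchanging their first parts yields a word with more \<open>a\<close> than \<open>c\<close>.
\<close>

section \<open>Trees of multisets\<close>

text \<open>Emptying languages separate the two families because they have no zero test: every
  transition, cuts included, asks only for a lower bound on a marking, so surplus tokens never block
  a run. This monotonicity drives both the eager reordering, where the tokens of a child arrive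
  early, and the exchange at comparable markings. A reachability language may demand an exact final
  marking; three equal blocks exploit this by requiring both counters to end at zero. The obstacle
  to the inclusion is that coverage concerns the whole final tree, while a net that must empty
  itself inspects one thread at a time. A cut is the only channel upwards, and what it sends is
  fixed when the thread is created. Hence the duty is guessed at creation, and its fulfilment is
  reported by a token naming it. A thread that has reported can do nothing more, which is harmless:
  a frozen subtree just stays in the covered tree. The letters \<open>1\<close> identify
  \<open>n\<close> when a thread is moved into another context, since the context contains none of
  them.\<close>

text \<open>
  The label of an edge is stored at its lower end (\<open>elab\<close>); at the root it is meaningless.
  The empty tree is \<open>None\<close>.
\<close>

datatype 'p tree = Node (elab: "'p multiset") (tok: "'p multiset") (kids: "'p tree multiset")

text \<open>A transition is reduced to its data: transitions with equal columns and equal label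
  produce the same words, so names are dropped and a net becomes a set of rules.\<close>

datatype ('p, 'a) rule =
  is_El: El (rpre: "'p multiset") (rpost: "'p multiset") (rlab: "'a option")
| is_Ab: Ab (rpre: "'p multiset") (rpost: "'p multiset") (rstart: "'p multiset") (rlab: "'a option")
| is_Ct: Ct (rpre: "'p multiset") (rlab: "'a option")

primrec lab :: "'a option \<Rightarrow> 'a list" where
  "lab None = []"
| "lab (Some a) = [a]"

text \<open>Enabledness is the decomposition \<open>p + r\<close> of the marking, which avoids
  subtraction. The result \<open>None\<close> for a child is what its parent turns into returned
  tokens; all descendants of the cut thread disappear with it.\<close>

inductive step :: "('p, 'a) rule set \<Rightarrow> 'p tree \<Rightarrow> 'a option \<Rightarrow> 'p tree option \<Rightarrow> bool"
  for R where
  step_El: "El p q l \<in> R \<Longrightarrow> step R (Node e (p + r) cs) l (Some (Node e (r + q) cs))"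
| step_Ab: "Ab p q b l \<in> R \<Longrightarrow>
    step R (Node e (p + r) cs) l (Some (Node e r (add_mset (Node q b {#}) cs)))"
| step_Ct: "Ct p l \<in> R \<Longrightarrow> step R (Node e (p + r) cs) l None"
| step_kid: "step R c l (Some c') \<Longrightarrow>
    step R (Node e m (add_mset c cs)) l (Some (Node e m (add_mset c' cs)))"
| step_return: "step R c l None \<Longrightarrow>
    step R (Node e m (add_mset c cs)) l (Some (Node e (m + elab c) cs))"

text \<open>Runs are extended at the front: both the reordering into eager runs and the lifting to
  the guessing net work from the last step backwards.\<close>

inductive runs :: "('p, 'a) rule set \<Rightarrow> 'p tree option \<Rightarrow> 'a list \<Rightarrow> 'p tree option \<Rightarrow> bool"
  for R where
  runs_refl: "runs R X [] X"
| runs_step: "step R T l X \<Longrightarrow> runs R X w Y \<Longrightarrow> runs R (Some T) (lab l @ w) Y"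

definition emptying_language :: "('p, 'a) rule set \<Rightarrow> 'p multiset \<Rightarrow> 'a list set" where
  "emptying_language R m = {w. runs R (Some (Node {#} m {#})) w None}"

lemma runs_single: "step R T l X \<Longrightarrow> runs R (Some T) (lab l) X"
  using runs_step[OF _ runs_refl, of R T l X] by simp

lemma runs_trans: "runs R X v Y \<Longrightarrow> runs R Y w Z \<Longrightarrow> runs R X (v @ w) Z"
  by (induction rule: runs.induct) (auto intro: runs_step)

lemma runs_None: "runs R None w X \<longleftrightarrow> w = [] \<and> X = None"
  by (auto elim: runs.cases intro: runs_refl)

lemma step_elab: "step R T l (Some T') \<Longrightarrow> elab T' = elab T"
  by (erule step.cases) auto

lemma runs_elab:
  assumes "runs R (Some T) w (Some T')"
  shows "elab T' = elab T"
proof -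
  have "runs R X w Y \<Longrightarrow> X = Some T \<Longrightarrow> Y = Some T' \<Longrightarrow> elab T' = elab T" for X Y T
    by (induction arbitrary: T rule: runs.induct)
      (auto dest!: step_elab simp: runs_None split: option.splits,
        metis not_Some_eq option.distinct(1) runs_None step_elab)
  with assms show ?thesis by blast
qed

lemma runs_kid:
  assumes "runs R (Some c) w (Some c')"
  shows "runs R (Some (Node e m (add_mset c cs))) w (Some (Node e m (add_mset c' cs)))"
proof -
  have "runs R X w Y \<Longrightarrow> X = Some c \<Longrightarrow> Y = Some c' \<Longrightarrow> ?thesis" for X Y
  proof (induction arbitrary: c rule: runs.induct)
    case (runs_step T l X w Y)
    show ?case
    proof (cases X)
      case None
      with runs_step show ?thesis by (simp add: runs_None)
    next
      case (Some T')
      with runs_step show ?thesis by (auto intro!: runs.runs_step step_kid)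
    qed
  qed (auto intro: runs_refl)
  with assms show ?thesis by blast
qed

lemma runs_return:
  assumes "runs R (Some c) w None"
  shows "runs R (Some (Node e m (add_mset c cs))) w (Some (Node e (m + elab c) cs))"
proof -
  have "runs R X w Y \<Longrightarrow> X = Some c \<Longrightarrow> Y = None \<Longrightarrow> ?thesis" for X Y
  proof (induction arbitrary: c rule: runs.induct)
    case (runs_step T l X w Y)
    show ?case
    proof (cases X)
      case None
      with runs_step show ?thesis
        by (auto simp: runs_None intro!: runs_single step_return)
    next
      case (Some T')
      with runs_step have "elab T' = elab c" by (metis option.inject step_elab)
      with Some runs_step show ?thesis
        by (metis option.inject runs.runs_step step_kid)
    qed
  qed (auto intro: runs_refl)
  with assms show ?thesis by blast
qed

section \<open>Eager runs\<close>

text \<open>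
  The flag \<open>st\<close> tells whether a thread finishes with a cut, and hence returns tokens to its parent,
  or is abandoned.
\<close>

definition ends :: "('p, 'a) rule set \<Rightarrow> bool \<Rightarrow> 'p multiset \<Rightarrow> 'a option \<Rightarrow> bool" where
  "ends R st m l \<longleftrightarrow> (if st then \<exists>p r. m = p + r \<and> Ct p l \<in> R else l = None)"

definition returned :: "bool \<Rightarrow> 'p multiset \<Rightarrow> 'p multiset" where
  "returned st q = (if st then q else {#})"

text \<open>A call executes the child from creation to end as one unit, so a single marking
  describes the whole state. Abandoned children (\<open>st\<close> false) are included because their
  letters count although they return nothing: they are the threads deleted when an ancestor is
  cut.\<close>

inductive eager :: "('p, 'a) rule set \<Rightarrow> 'p multiset \<Rightarrow> 'a list \<Rightarrow> 'p multiset \<Rightarrow> bool"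
  for R where
  eager_Nil: "eager R m [] m"
| eager_El: "El p q l \<in> R \<Longrightarrow> eager R (r + q) w m' \<Longrightarrow> eager R (p + r) (lab l @ w) m'"
| eager_call: "Ab p q b l \<in> R \<Longrightarrow> eager R b w\<^sub>1 m\<^sub>1 \<Longrightarrow> ends R st m\<^sub>1 l\<^sub>1 \<Longrightarrow>
    eager R (r + returned st q) w m' \<Longrightarrow> eager R (p + r) (lab l @ (w\<^sub>1 @ lab l\<^sub>1) @ w) m'"

definition eager_language :: "('p, 'a) rule set \<Rightarrow> 'p multiset \<Rightarrow> 'a list set" where
  "eager_language R m = {w @ lab l | w l m'. eager R m w m' \<and> ends R True m' l}"

lemma eager_trans: "eager R m v m' \<Longrightarrow> eager R m' w m'' \<Longrightarrow> eager R m (v @ w) m''"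
proof (induction rule: eager.induct)
  case (eager_call p q b l w\<^sub>1 m\<^sub>1 st l\<^sub>1 r w m')
  then show ?case using eager.eager_call[of p q b l R w\<^sub>1 m\<^sub>1 st l\<^sub>1 r] by simp
next
  case (eager_El p q l r w m')
  then show ?case using eager.eager_El[of p q l R r] by simp
qed simp

text \<open>Rules require lower bounds only, so the surplus \<open>d\<close> is carried along
  unchanged. The exchange of parts of threads rests on this.\<close>

lemma eager_mono: "eager R m w m' \<Longrightarrow> eager R (m + d) w (m' + d)"
proof (induction rule: eager.induct)
  case (eager_call p q b l w\<^sub>1 m\<^sub>1 st l\<^sub>1 r w m')
  then show ?case using eager.eager_call[of p q b l R w\<^sub>1 m\<^sub>1 st l\<^sub>1 "r + d"] by (simp add: ac_simps)
next
  case (eager_El p q l r w m')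
  then show ?case using eager.eager_El[of p q l R "r + d"] by (simp add: ac_simps)
qed (rule eager_Nil)

lemma ends_mono: "ends R st m l \<Longrightarrow> ends R st (m + d) l"
  by (auto simp: ends_def split: if_splits) (metis add.assoc)

text \<open>An abandoned child simply stays in the tree, hence the unspecified final children
  \<open>cs'\<close>.\<close>

lemma eager_runs:
  "eager R m w m' \<Longrightarrow> \<exists>cs'. runs R (Some (Node e m cs)) w (Some (Node e m' cs'))"
proof (induction arbitrary: e cs rule: eager.induct)
  case (eager_Nil m)
  show ?case using runs_refl by blast
next
  case (eager_El p q l r w m')
  then show ?case by (meson runs_step step_El)
next
  case (eager_call p q b l w\<^sub>1 m\<^sub>1 st l\<^sub>1 r w m')
  obtain cs\<^sub>1 where c: "runs R (Some (Node q b {#})) w\<^sub>1 (Some (Node q m\<^sub>1 cs\<^sub>1))"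
    using eager_call.IH(1) by blast
  have "\<exists>cs'. runs R (Some (Node e r (add_mset (Node q b {#}) cs))) (w\<^sub>1 @ lab l\<^sub>1)
      (Some (Node e (r + returned st q) cs'))"
  proof (cases st)
    case True
    with eager_call.hyps(3) have "step R (Node q m\<^sub>1 cs\<^sub>1) l\<^sub>1 None"
      by (auto simp: ends_def intro: step_Ct)
    from runs_return[OF runs_trans[OF c runs_single[OF this]]]
    show ?thesis using True by (auto simp: returned_def)
  next
    case False
    with eager_call.hyps(3) show ?thesis
      using runs_kid[OF c] by (auto simp: ends_def returned_def)
  qed
  then obtain cs' where "runs R (Some (Node e (p + r) cs)) (lab l @ (w\<^sub>1 @ lab l\<^sub>1))
      (Some (Node e (r + returned st q) cs'))"
    using runs_step[OF step_Ab[OF eager_call.hyps(1)]] by blast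
  moreover obtain cs'' where "runs R (Some (Node e (r + returned st q) cs')) w (Some (Node e m' cs''))"
    using eager_call.IH(2) by blast
  ultimately show ?case using runs_trans by fastforce
qed

lemma eager_language_subset: "eager_language R m \<subseteq> emptying_language R m"
proof
  fix w assume "w \<in> eager_language R m"
  then obtain v l m' where v: "w = v @ lab l" "eager R m v m'" "ends R True m' l"
    by (auto simp: eager_language_def)
  obtain cs where "runs R (Some (Node {#} m {#})) v (Some (Node {#} m' cs))"
    using eager_runs[OF v(2)] by blast
  moreover have "step R (Node {#} m' cs) l None"
    using v(3) by (auto simp: ends_def intro: step_Ct)
  ultimately show "w \<in> emptying_language R m"
    unfolding emptying_language_def v(1) by (blast intro: runs_trans runs_single)
qed

text \<open>The invariant of the reordering. In \<open>settle R cs d z\<close> the children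
  \<open>cs\<close> are taken to their ends in advance, returning \<open>d\<close> and emitting
  \<open>z\<close>; in \<open>eager_tree\<close> the thread then continues with \<open>d\<close>
  already at hand. Letters form a multiset because their order is lost.\<close>

inductive settle :: "('p, 'a) rule set \<Rightarrow> 'p tree multiset \<Rightarrow> 'p multiset \<Rightarrow> 'a multiset \<Rightarrow> bool"
  and eager_tree :: "('p, 'a) rule set \<Rightarrow> bool \<Rightarrow> 'p tree \<Rightarrow> 'a multiset \<Rightarrow> bool"
  for R where
  settle_empty: "settle R {#} {#} {#}"
| settle_add: "settle R cs d z \<Longrightarrow> eager_tree R st c z' \<Longrightarrow>
    settle R (add_mset c cs) (d + returned st (elab c)) (z + z')"
| eager_treeI: "settle R cs d z \<Longrightarrow> eager R (m + d) w m' \<Longrightarrow> ends R st m' l \<Longrightarrow>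
    eager_tree R st (Node e m cs) (z + mset (w @ lab l))"

lemma settle_emptyD: "settle R {#} d z \<Longrightarrow> d = {#} \<and> z = {#}"
  by (auto elim: settle.cases)

text \<open>Inversion at a chosen child: a derivation of \<open>settle\<close> lists the children in
  some order, but the contributions of different children commute.\<close>

lemma settle_addD:
  assumes "settle R C d z"
  shows "C = add_mset c cs \<Longrightarrow> \<exists>st d\<^sub>1 z\<^sub>1 z\<^sub>2. settle R cs d\<^sub>1 z\<^sub>1 \<and> eager_tree R st c z\<^sub>2 \<and>
    d = d\<^sub>1 + returned st (elab c) \<and> z = z\<^sub>1 + z\<^sub>2"
  using assms
proof (induction arbitrary: c cs rule: settle_eager_tree.inducts(1)[where ?P2.0 = "\<lambda>_ _ _. True"])
  case (settle_add cs' d z st c' z')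
  show ?case
  proof (cases "c = c'")
    case True
    with settle_add have "cs' = cs" by simp
    with settle_add.hyps True show ?thesis by (intro exI[of _ st] exI[of _ d] exI[of _ z] exI[of _ z']) simp
  next
    case False
    then obtain cs'' where cs: "cs' = add_mset c cs''" "cs = add_mset c' cs''"
      using settle_add.prems unfolding add_eq_conv_ex by blast
    then obtain st' d\<^sub>1 z\<^sub>1 z\<^sub>2 where s: "settle R cs'' d\<^sub>1 z\<^sub>1" "eager_tree R st' c z\<^sub>2"
      "d = d\<^sub>1 + returned st' (elab c)" "z = z\<^sub>1 + z\<^sub>2"
      using settle_add.IH(1)[OF cs(1)] by blast
    have "settle R cs (d\<^sub>1 + returned st (elab c')) (z\<^sub>1 + z')"
      using settle_eager_tree.settle_add[OF s(1) settle_add.hyps(2)] cs by simp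
    moreover have "d + returned st (elab c') = d\<^sub>1 + returned st (elab c') + returned st' (elab c)"
      "z + z' = z\<^sub>1 + z' + z\<^sub>2"
      by (simp_all add: s(3,4) ac_simps)
    ultimately show ?thesis using s(2) by blast
  qed
qed simp_all

text \<open>An abandoned thread may be left at once together with its children. This settles the
  children that a cut deletes.\<close>

lemma eager_tree_False: "eager_tree R False T {#}"
proof (induction T)
  case (Node e m cs)
  have "settle R cs {#} {#}"
    using Node
  proof (induction cs)
    case empty
    show ?case by (rule settle_empty)
  next
    case (add c cs)
    then show ?case using settle_add[of R cs "{#}" "{#}" False c "{#}"] by (simp add: returned_def)
  qed
  from eager_treeI[OF this eager_Nil, of False _ None] show ?case
    by (simp add: ends_def)
qed

lemma settle_nothing: "settle R cs {#} {#}"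
proof (induction cs)
  case empty
  show ?case by (rule settle_empty)
next
  case (add c cs)
  then show ?case using settle_add[OF _ eager_tree_False, of R cs "{#}" "{#}" c] by (simp add: returned_def)
qed

text \<open>A step is prepended to an already reordered future. Creating a child turns the
  settlement of that child into an eager call; a return moves tokens from the marking
  \<open>m\<close> to the settled share \<open>d\<close>, which leaves \<open>m + d\<close>
  unchanged.\<close>

lemma eager_tree_step:
  assumes "step R T l X"
  shows "case X of None \<Rightarrow> eager_tree R True T (mset (lab l))
    | Some T' \<Rightarrow> (\<forall>st z. eager_tree R st T' z \<longrightarrow> eager_tree R st T (mset (lab l) + z))"
  using assms
proof induction
  case (step_El p q l e r cs)
  show ?case
  proof (clarsimp)
    fix st z assume "eager_tree R st (Node e (r + q) cs) z"
    then show "eager_tree R st (Node e (p + r) cs) (mset (lab l) + z)"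
    proof (cases rule: eager_tree.cases)
      case 1: (eager_treeI d z w m' l')
      from 1(3) have "eager R (r + d + q) w m'" by (simp add: ac_simps)
      from eager_El[OF step_El this] have "eager R (p + r + d) (lab l @ w) m'" by (simp add: ac_simps)
      from eager_treeI[OF 1(2) this 1(4)] show ?thesis by (simp add: 1 ac_simps)
    qed
  qed
next
  case (step_Ab p q b l e r cs)
  show ?case
  proof (clarsimp)
    fix st z assume "eager_tree R st (Node e r (add_mset (Node q b {#}) cs)) z"
    then show "eager_tree R st (Node e (p + r) cs) (mset (lab l) + z)"
    proof (cases rule: eager_tree.cases)
      case 1: (eager_treeI d z w m' l')
      obtain st' d\<^sub>1 z\<^sub>1 z\<^sub>2 where s: "settle R cs d\<^sub>1 z\<^sub>1" "eager_tree R st' (Node q b {#}) z\<^sub>2"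
        "d = d\<^sub>1 + returned st' q" "z = z\<^sub>1 + z\<^sub>2"
        using settle_addD[OF 1(2) refl] by auto
      \<comment> \<open>The new child has no children to settle, so its derivation is a plain eager
        run from \<open>b\<close>.\<close>
      obtain w\<^sub>1 m\<^sub>1 l\<^sub>1 where w: "eager R b w\<^sub>1 m\<^sub>1" "ends R st' m\<^sub>1 l\<^sub>1" "z\<^sub>2 = mset (w\<^sub>1 @ lab l\<^sub>1)"
        using s(2) by (cases rule: eager_tree.cases) (auto dest: settle_emptyD)
      have "eager R (r + d\<^sub>1 + returned st' q) w m'" using 1(3) s(3) by (simp add: ac_simps)
      from eager_call[OF step_Ab w(1,2) this]
      have "eager R (p + r + d\<^sub>1) (lab l @ (w\<^sub>1 @ lab l\<^sub>1) @ w) m'" by (simp add: ac_simps)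
      from eager_treeI[OF s(1) this 1(4)] show ?thesis by (simp add: 1 s w ac_simps)
    qed
  qed
next
  case (step_Ct p l e r cs)
  have "ends R True (p + r + {#}) l" using step_Ct by (auto simp: ends_def)
  from eager_treeI[OF settle_nothing eager_Nil this] show ?case by simp
next
  case (step_kid c l c' e m cs)
  show ?case
  proof (clarsimp)
    fix st z assume "eager_tree R st (Node e m (add_mset c' cs)) z"
    then show "eager_tree R st (Node e m (add_mset c cs)) (mset (lab l) + z)"
    proof (cases rule: eager_tree.cases)
      case 1: (eager_treeI d z w m' l')
      obtain st' d\<^sub>1 z\<^sub>1 z\<^sub>2 where s: "settle R cs d\<^sub>1 z\<^sub>1" "eager_tree R st' c' z\<^sub>2"
        "d = d\<^sub>1 + returned st' (elab c')" "z = z\<^sub>1 + z\<^sub>2"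
        using settle_addD[OF 1(2) refl] by auto
      have "eager_tree R st' c (mset (lab l) + z\<^sub>2)" using step_kid(2) s(2) by simp
      from settle_add[OF s(1) this]
      have "settle R (add_mset c cs) d (mset (lab l) + z)"
        using step_elab[OF step_kid(1)] s by (simp add: ac_simps)
      from eager_treeI[OF this 1(3,4)] show ?thesis by (simp add: 1 ac_simps)
    qed
  qed
next
  case (step_return c l e m cs)
  show ?case
  proof (clarsimp)
    fix st z assume "eager_tree R st (Node e (m + elab c) cs) z"
    then show "eager_tree R st (Node e m (add_mset c cs)) (mset (lab l) + z)"
    proof (cases rule: eager_tree.cases)
      case 1: (eager_treeI d z w m' l')
      have "settle R (add_mset c cs) (d + elab c) (z + mset (lab l))"
        using settle_add[OF 1(2), of True c "mset (lab l)"] step_return by (simp add: returned_def)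
      from eager_treeI[OF this _ 1(4)] 1(3) show ?thesis by (simp add: 1 ac_simps)
    qed
  qed
qed

lemma eager_tree_runs: "runs R X w Y \<Longrightarrow> X = Some T \<Longrightarrow> Y = None \<Longrightarrow> eager_tree R True T (mset w)"
proof (induction arbitrary: T rule: runs.induct)
  case (runs_step T' l X w Y)
  show ?case
  proof (cases X)
    case None
    with runs_step show ?thesis using eager_tree_step[OF runs_step(1)] by (auto simp: runs_None)
  next
    case (Some T'')
    with runs_step show ?thesis using eager_tree_step[OF runs_step(1)] by auto
  qed
qed simp

lemma emptying_language_permuted:
  assumes "w \<in> emptying_language R m"
  shows "\<exists>w' \<in> eager_language R m. mset w' = mset w"
proof -
  have "eager_tree R True (Node {#} m {#}) (mset w)"
    using assms eager_tree_runs[OF _ refl refl] by (auto simp: emptying_language_def)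
  then show ?thesis
    by (cases rule: eager_tree.cases) (fastforce simp: eager_language_def dest!: settle_emptyD)
qed

section \<open>Dickson's lemma\<close>

text \<open>A nonincreasing sequence of naturals is constant from its minimum on, so either kind of
  monotone subsequence supplies a nondecreasing one.\<close>

lemma nat_seq_mono_subseq:
  fixes h :: "nat \<Rightarrow> nat"
  shows "\<exists>g :: nat \<Rightarrow> nat. strict_mono g \<and> mono (h \<circ> g)"
proof -
  obtain g where g: "strict_mono g" "monoseq (\<lambda>n. h (g n))"
    using seq_monosub by blast
  show ?thesis
  proof (cases "incseq (\<lambda>n. h (g n))")
    case True
    with g show ?thesis by (intro exI[of _ g]) (auto simp: comp_def)
  next
    case False
    then have decorated: "decseq (\<lambda>n. h (g n))" using g(2) by (simp add: monoseq_iff)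
    obtain k where k: "\<And>n. h (g k) \<le> h (g n)"
      using ex_has_least_nat[of "\<lambda>_. True" 0 "\<lambda>n. h (g n)"] by auto
    have "h (g (i + k)) = h (g k)" for i
      using k decorated by (simp add: decseq_def order_antisym)
    moreover have "strict_mono (\<lambda>i. g (i + k))"
      using g(1) by (simp add: strict_mono_def)
    ultimately show ?thesis by (intro exI[of _ "\<lambda>i. g (i + k)"]) (auto simp: mono_def)
  qed
qed

lemma multiset_seq_mono_subseq:
  assumes "finite S"
  shows "\<exists>g :: nat \<Rightarrow> nat. strict_mono g \<and> (\<forall>p \<in> S. mono (\<lambda>i. count (f (g i)) p))"
  using assms
proof induction
  case empty
  show ?case by (intro exI[of _ id]) (auto simp: strict_mono_def)
next
  case (insert p S)
  then obtain g :: "nat \<Rightarrow> nat" where g: "strict_mono g" "\<forall>p \<in> S. mono (\<lambda>i. count (f (g i)) p)" by blast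
  obtain g' :: "nat \<Rightarrow> nat" where g': "strict_mono g'" "mono (\<lambda>i. count (f (g (g' i))) p)"
    using nat_seq_mono_subseq[of "\<lambda>i. count (f (g i)) p"] by (auto simp: comp_def)
  have "mono (\<lambda>i. count (f (g (g' i))) p')" if "p' \<in> S" for p'
    using that g(2) strict_mono_mono[OF g'(1)] by (auto simp: mono_def)
  with g g' show ?case
    by (intro exI[of _ "g \<circ> g'"]) (auto simp: strict_mono_def)
qed

text \<open>Subsequences are refined place by place, which needs a common finite set
  \<open>S\<close> of places.\<close>

lemma dickson_infinite:
  fixes I :: "nat set"
  assumes "infinite I" "finite S" "\<And>i. i \<in> I \<Longrightarrow> set_mset (f i) \<subseteq> S"
  shows "\<exists>i \<in> I. \<exists>j \<in> I. i < j \<and> f i \<subseteq># f j"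
proof -
  define e where "e = Infinite_Set.enumerate I"
  have e: "strict_mono e" "\<And>i. e i \<in> I"
    using assms(1) by (auto simp: e_def strict_mono_enumerate enumerate_in_set)
  obtain g :: "nat \<Rightarrow> nat" where g: "strict_mono g" "\<forall>p \<in> S. mono (\<lambda>i. count (f (e (g i))) p)"
    using multiset_seq_mono_subseq[OF assms(2), of "\<lambda>i. f (e i)"] by auto
  have "f (e (g 0)) \<subseteq># f (e (g 1))"
  proof (rule mset_subset_eqI)
    fix p
    show "count (f (e (g 0))) p \<le> count (f (e (g 1))) p"
    proof (cases "p \<in> S")
      case True
      with g(2) show ?thesis by (simp add: mono_def)
    next
      case False
      with assms(3)[OF e(2)] have "p \<notin># f (e (g 0))" by blast
      then show ?thesis by (simp add: not_in_iff)
    qed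
  qed
  moreover have "e (g 0) < e (g 1)" using e(1) g(1) by (simp add: strict_mono_def)
  ultimately show ?thesis using e(2) by blast
qed

section \<open>Three equal blocks are not an emptying language\<close>

definition abc :: "nat \<Rightarrow> nat list" where
  "abc n = replicate n 0 @ replicate n 1 @ replicate n 2"

lemma sorted_abc: "sorted (abc n)"
  by (auto simp: abc_def sorted_append)

lemma count_abc: "k < 3 \<Longrightarrow> count_list (abc n) k = n"
  by (auto simp: abc_def count_list_eq_length_filter filter_replicate)

lemma sorted_nat_eq_if_mset_eq:
  "sorted v \<Longrightarrow> sorted w \<Longrightarrow> mset v = mset w \<Longrightarrow> v = (w :: nat list)"
  by (metis properties_for_sort)

text \<open>
  \<open>ctx R m\<^sub>0 u b st l v\<close>: the eager words \<open>u \<dots> v\<close> have a hole for a thread with initial marking \<open>b\<close>.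
  The label \<open>l\<close> of the transition that creates the thread belongs to the hole.
\<close>

inductive ctx :: "('p, 'a) rule set \<Rightarrow> 'p multiset \<Rightarrow> 'a list \<Rightarrow> 'p multiset \<Rightarrow> bool \<Rightarrow>
    'a option \<Rightarrow> 'a list \<Rightarrow> bool"
  for R m\<^sub>0 where
  ctx_root: "ctx R m\<^sub>0 [] m\<^sub>0 True None []"
| ctx_call: "ctx R m\<^sub>0 u b st l v \<Longrightarrow> eager R b w\<^sub>1 (p + r) \<Longrightarrow> Ab p q b' l' \<in> R \<Longrightarrow>
    eager R (r + returned st' q) w\<^sub>2 m' \<Longrightarrow> ends R st m' l\<^sub>1 \<Longrightarrow>
    ctx R m\<^sub>0 (u @ lab l @ w\<^sub>1) b' st' l' (w\<^sub>2 @ lab l\<^sub>1 @ v)"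

text \<open>The filled inner hole is a complete eager call, hence part of a run that fills the next
  outer hole; the induction moves outwards.\<close>

lemma ctx_plug:
  "ctx R m\<^sub>0 u b st l v \<Longrightarrow> eager R b w m \<Longrightarrow> ends R st m l\<^sub>1 \<Longrightarrow>
    u @ lab l @ w @ lab l\<^sub>1 @ v \<in> eager_language R m\<^sub>0"
proof (induction arbitrary: w m l\<^sub>1 rule: ctx.induct)
  case ctx_root
  then show ?case by (auto simp: eager_language_def)
next
  case (ctx_call u b st l v w\<^sub>1 p r q b' l' st' w\<^sub>2 m' l\<^sub>2)
  have "eager R b (w\<^sub>1 @ lab l' @ (w @ lab l\<^sub>1) @ w\<^sub>2) m'"
    using eager_trans[OF ctx_call(2) eager_call[OF ctx_call(3,7,8,4)]] .
  from ctx_call(6)[OF this ctx_call(5)] show ?case by simp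
qed

text \<open>A hole other than the root is created by a rule of \<open>R\<close> and carries a flag,
  which leaves finitely many types \<open>(b, st, l)\<close> for the pigeonhole argument.\<close>

lemma ctx_finite:
  assumes "finite R"
  shows "\<exists>B. finite B \<and> (\<forall>u b st l v. ctx R m\<^sub>0 u b st l v \<longrightarrow> (b, st, l) \<in> B)"
proof -
  \<comment> \<open>Rules that create no thread receive the type of the root hole as a
    default.\<close>
  define ty where "ty = (\<lambda>(x :: ('a, 'b) rule, st :: bool).
    case x of Ab p q b l \<Rightarrow> (b, st, l) | _ \<Rightarrow> (m\<^sub>0, True, None))"
  have "(b, st, l) \<in> insert (m\<^sub>0, True, None) (ty ` (R \<times> UNIV))" if "ctx R m\<^sub>0 u b st l v" for u b st l v
    using that
  proof cases
    case (ctx_call u' b' st' l' v' w\<^sub>1 p r q w\<^sub>2 m' l\<^sub>1)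
    then have "(b, st, l) = ty (Ab p q b l, st)" "(Ab p q b l, st) \<in> R \<times> UNIV" by (simp_all add: ty_def)
    then show ?thesis by blast
  qed simp
  moreover have "finite (insert (m\<^sub>0, True, None) (ty ` (R \<times> UNIV)))" using assms by simp
  ultimately show ?thesis by blast
qed

primrec rule_places :: "('p, 'a) rule \<Rightarrow> 'p set" where
  "rule_places (El p q l) = set_mset p \<union> set_mset q"
| "rule_places (Ab p q b l) = set_mset p \<union> set_mset q \<union> set_mset b"
| "rule_places (Ct p l) = set_mset p"

lemma finite_rule_places: "finite (rule_places x)"
  by (cases x) auto

text \<open>No place outside the initial marking and the rules ever gets a token, which gives the
  finite bound for Dickson's lemma.\<close>

lemma eager_places:
  "eager R m w m' \<Longrightarrow> set_mset m' \<subseteq> set_mset m \<union> (\<Union>x \<in> R. rule_places x)"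
  by (induction rule: eager.induct) (force simp: returned_def split: if_splits)+

lemma ctx_places:
  "ctx R m\<^sub>0 u b st l v \<Longrightarrow> set_mset b \<subseteq> set_mset m\<^sub>0 \<union> (\<Union>x \<in> R. rule_places x)"
  by (induction rule: ctx.induct) force+

text \<open>\<open>x\<close> is the type of the thread and \<open>m\<close> its marking between the
  two parts, so parts of threads of equal type can be recombined. The creating label belongs to
  \<open>z\<^sub>1\<close>, the ending label to \<open>z\<^sub>2\<close>. A \<open>0\<close> in
  \<open>z\<^sub>1\<close> and a \<open>2\<close> in \<open>z\<^sub>2\<close> leave no
  \<open>1\<close> for the context of a sorted word.\<close>

definition splits ::
  "(('p, nat) rule set) \<Rightarrow> 'p multiset \<Rightarrow> nat list \<Rightarrow> nat list \<Rightarrow> 'p multiset \<times> bool \<times> nat option \<Rightarrow>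
    nat list \<Rightarrow> 'p multiset \<Rightarrow> nat list \<Rightarrow> nat list \<Rightarrow> bool" where
  "splits R m\<^sub>0 w u x z\<^sub>1 m z\<^sub>2 v \<longleftrightarrow> (case x of (b, st, l) \<Rightarrow>
     ctx R m\<^sub>0 u b st l v \<and>
     (\<exists>z m' l\<^sub>1. eager R b z m \<and> z\<^sub>1 = lab l @ z \<and>
       (\<exists>z'. eager R m z' m' \<and> ends R st m' l\<^sub>1 \<and> z\<^sub>2 = z' @ lab l\<^sub>1)) \<and>
     w = u @ z\<^sub>1 @ z\<^sub>2 @ v \<and> 2 \<notin> set z\<^sub>1 \<and> 0 \<notin> set z\<^sub>2 \<and> 0 \<in> set z\<^sub>1 \<and> 2 \<in> set z\<^sub>2)"

text \<open>Induction on the part \<open>y\<close> that the current thread still has to run. What it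
  has done is kept as \<open>z\<^sub>1\<close>, free of \<open>2\<close>, and
  \<open>z\<^sub>2\<close>, free of \<open>0\<close>: while no \<open>2\<close> has occurred
  everything goes into \<open>z\<^sub>1\<close>, and after the first \<open>2\<close> sortedness
  excludes \<open>0\<close>. A call containing both letters makes the induction descend into the
  child, with the current thread as part of its context.\<close>

lemma splits_exists:
  assumes "eager R m y m'" "ctx R m\<^sub>0 u b st l v" "ends R st m' l\<^sub>1"
    "eager R b z\<^sub>1 k" "eager R k z\<^sub>2 m" "2 \<notin> set (lab l @ z\<^sub>1)" "0 \<notin> set z\<^sub>2"
    "sorted (u @ lab l @ z\<^sub>1 @ z\<^sub>2 @ y @ lab l\<^sub>1 @ v)"
    "{0, 2} \<subseteq> set (lab l @ z\<^sub>1 @ z\<^sub>2 @ y @ lab l\<^sub>1)"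
  shows "\<exists>u' x z\<^sub>1' k' z\<^sub>2' v'. splits R m\<^sub>0 (u @ lab l @ z\<^sub>1 @ z\<^sub>2 @ y @ lab l\<^sub>1 @ v) u' x z\<^sub>1' k' z\<^sub>2' v'"
  using assms
proof (induction arbitrary: u b st l v l\<^sub>1 z\<^sub>1 k z\<^sub>2 rule: eager.induct)
  case (eager_Nil m)
  \<comment> \<open>The ending label comes last in a thread that contains \<open>2\<close>, so a
    \<open>0\<close> there would break sortedness.\<close>
  have l1: "0 \<notin> set (lab l\<^sub>1)"
  proof
    assume "0 \<in> set (lab l\<^sub>1)"
    then have "l\<^sub>1 = Some 0" by (cases l\<^sub>1) auto
    with eager_Nil.prems(7,8) show False by (auto simp: sorted_append)
  qed
  have "splits R m\<^sub>0 (u @ lab l @ z\<^sub>1 @ z\<^sub>2 @ [] @ lab l\<^sub>1 @ v) u (b, st, l) (lab l @ z\<^sub>1) k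
    (z\<^sub>2 @ lab l\<^sub>1) v"
    using eager_Nil.prems l1 unfolding splits_def by auto
  then show ?case by blast
next
  case (eager_El p q l' r w m')
  have e: "eager R (p + r) (lab l') (r + q)"
    using eager.eager_El[OF eager_El(1) eager.eager_Nil] by simp
  show ?case
  proof (cases "2 \<in> set (lab l @ z\<^sub>1 @ z\<^sub>2 @ lab l')")
    case True
    then have "0 \<notin> set (lab l')"
      using eager_El.prems(7) by (cases l') (auto simp: sorted_append)
    then show ?thesis
      using eager_El.IH[OF eager_El.prems(1,2,3) eager_trans[OF eager_El.prems(4) e]] eager_El.prems
      by simp
  next
    case False
    have "eager R b (z\<^sub>1 @ z\<^sub>2 @ lab l') (r + q)"
      using eager_El.prems(3,4) e by (simp add: eager_trans)
    from eager_El.IH[OF eager_El.prems(1,2) this eager_Nil] show ?thesis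
      using False eager_El.prems by simp
  qed
next
  case (eager_call p q b' l' w\<^sub>1 m\<^sub>1 st' l\<^sub>2 r w m')
  have e: "eager R (p + r) (lab l' @ w\<^sub>1 @ lab l\<^sub>2) (r + returned st' q)"
    using eager.eager_call[OF eager_call(1,2,3) eager.eager_Nil] by simp
  show ?case
  proof (cases "{0, 2} \<subseteq> set (lab l' @ w\<^sub>1 @ lab l\<^sub>2)")
    case True
    have c: "ctx R m\<^sub>0 (u @ lab l @ z\<^sub>1 @ z\<^sub>2) b' st' l' (w @ lab l\<^sub>1 @ v)"
      using ctx_call[OF eager_call.prems(1) eager_trans[OF eager_call.prems(3,4)]
        eager_call(1) eager_call(4) eager_call.prems(2)] by simp
    \<comment> \<open>A creating label \<open>2\<close> would precede the \<open>0\<close> of the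
      child.\<close>
    have "2 \<notin> set (lab l' @ [])"
    proof
      assume "2 \<in> set (lab l' @ [])"
      then have "l' = Some 2" by (cases l') auto
      with eager_call.prems(7) have "\<forall>y \<in> set (w\<^sub>1 @ lab l\<^sub>2). 2 \<le> y"
        by (auto simp: sorted_append)
      moreover have "0 \<in> set (w\<^sub>1 @ lab l\<^sub>2)" using True \<open>l' = Some 2\<close> by simp
      ultimately show False by fastforce
    qed
    from eager_call.IH(1)[OF c eager_call(3) eager_Nil eager_Nil this] show ?thesis
      using eager_call.prems(7) True by simp
  next
    case no: False
    show ?thesis
    proof (cases "2 \<in> set (lab l @ z\<^sub>1 @ z\<^sub>2 @ lab l' @ w\<^sub>1 @ lab l\<^sub>2)")
      case True
      have "0 \<notin> set (lab l' @ w\<^sub>1 @ lab l\<^sub>2)"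
      proof
        assume z: "0 \<in> set (lab l' @ w\<^sub>1 @ lab l\<^sub>2)"
        with no True have "2 \<in> set (lab l @ z\<^sub>1 @ z\<^sub>2)" by auto
        moreover have "sorted ((lab l @ z\<^sub>1 @ z\<^sub>2) @ (lab l' @ w\<^sub>1 @ lab l\<^sub>2))"
          using eager_call.prems(7) by (auto simp: sorted_append)
        ultimately show False using z unfolding sorted_append[of "lab l @ z\<^sub>1 @ z\<^sub>2"] by fastforce
      qed
      then show ?thesis
        using eager_call.IH(2)[OF eager_call.prems(1,2,3) eager_trans[OF eager_call.prems(4) e]]
          eager_call.prems
        by simp
    next
      case False
      have "eager R b (z\<^sub>1 @ z\<^sub>2 @ lab l' @ w\<^sub>1 @ lab l\<^sub>2) (r + returned st' q)"
        using eager_trans[OF eager_call.prems(3) eager_trans[OF eager_call.prems(4) e]] by simp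
      from eager_call.IH(2)[OF eager_call.prems(1,2) this eager_Nil] show ?thesis
        using False eager_call.prems by simp
    qed
  qed
qed

lemma splitsD:
  assumes "splits R m\<^sub>0 w u x z\<^sub>1 m z\<^sub>2 v"
  shows "u @ z\<^sub>1 @ z\<^sub>2 @ v = w" "2 \<notin> set z\<^sub>1" "0 \<notin> set z\<^sub>2" "0 \<in> set z\<^sub>1" "2 \<in> set z\<^sub>2"
  using assms by (cases x; auto simp: splits_def)+

lemma splits_abc:
  assumes "abc n \<in> eager_language R m\<^sub>0" "0 < n"
  shows "\<exists>u x z\<^sub>1 m z\<^sub>2 v. splits R m\<^sub>0 (abc n) u x z\<^sub>1 m z\<^sub>2 v"
proof -
  obtain w l m' where w: "abc n = w @ lab l" "eager R m\<^sub>0 w m'" "ends R True m' l"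
    using assms(1) by (auto simp: eager_language_def)
  have "{0, 2} \<subseteq> set (abc n)" using assms(2) by (auto simp: abc_def)
  then show ?thesis
    using splits_exists[OF w(2) ctx_root w(3) eager_Nil eager_Nil] sorted_abc[of n] w(1) by simp
qed

text \<open>Context, first part and second part come from three words. The first part ends in
  \<open>m'\<close>, which exceeds \<open>m''\<close> by some \<open>d\<close>; by monotonicity the
  second part and the ending still work with this surplus.\<close>

lemma splits_swap:
  assumes "splits R m\<^sub>0 w u x z\<^sub>1 m z\<^sub>2 v" "splits R m\<^sub>0 w' u' x z\<^sub>1' m' z\<^sub>2' v'"
    "splits R m\<^sub>0 w'' u'' x z\<^sub>1'' m'' z\<^sub>2'' v''" "m'' \<subseteq># m'"
  shows "u @ z\<^sub>1' @ z\<^sub>2'' @ v \<in> eager_language R m\<^sub>0"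
proof -
  obtain b st l where x: "x = (b, st, l)" by (cases x)
  obtain z where z: "eager R b z m'" "z\<^sub>1' = lab l @ z"
    using assms(2) by (auto simp: splits_def x)
  obtain z' m\<^sub>1 l\<^sub>1 where z': "eager R m'' z' m\<^sub>1" "ends R st m\<^sub>1 l\<^sub>1" "z\<^sub>2'' = z' @ lab l\<^sub>1"
    using assms(3) by (auto simp: splits_def x)
  obtain d where d: "m' = m'' + d" using assms(4) by (metis subset_mset.add_diff_inverse)
  have "eager R b (z @ z') (m\<^sub>1 + d)"
    using eager_trans[OF z(1)] eager_mono[OF z'(1), of d] d by simp
  from ctx_plug[OF _ this ends_mono[OF z'(2)]] assms(1) show ?thesis
    by (auto simp: splits_def x z z')
qed

theorem emptying_language_not_abc:
  assumes "finite R"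
  shows "emptying_language R m\<^sub>0 \<noteq> range abc"
proof
  assume E: "emptying_language R m\<^sub>0 = range abc"
  have sub: "eager_language R m\<^sub>0 \<subseteq> range abc" using eager_language_subset E by blast
  have "abc n \<in> eager_language R m\<^sub>0" for n
  proof -
    obtain w where w: "w \<in> eager_language R m\<^sub>0" "mset w = mset (abc n)"
      using emptying_language_permuted[of "abc n" R m\<^sub>0] E by auto
    then have "w = abc n"
      using sub sorted_nat_eq_if_mset_eq sorted_abc by blast
    with w show ?thesis by simp
  qed
  then have ex: "\<exists>u x z\<^sub>1 m z\<^sub>2 v. splits R m\<^sub>0 (abc n) u x z\<^sub>1 m z\<^sub>2 v" if "0 < n" for n
    using splits_abc that by blast
  have "\<forall>n. \<exists>y. 0 < n \<longrightarrow> (case y of (u, x, z\<^sub>1, m, z\<^sub>2, v) \<Rightarrow> splits R m\<^sub>0 (abc n) u x z\<^sub>1 m z\<^sub>2 v)"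
  proof
    fix n
    show "\<exists>y. 0 < n \<longrightarrow> (case y of (u, x, z\<^sub>1, m, z\<^sub>2, v) \<Rightarrow> splits R m\<^sub>0 (abc n) u x z\<^sub>1 m z\<^sub>2 v)"
    proof (cases "0 < n")
      case True
      from ex[OF this] obtain u x z\<^sub>1 m z\<^sub>2 v where "splits R m\<^sub>0 (abc n) u x z\<^sub>1 m z\<^sub>2 v" by blast
      then show ?thesis by (intro exI[of _ "(u, x, z\<^sub>1, m, z\<^sub>2, v)"]) simp
    qed simp
  qed
  from choice[OF this] obtain y where y:
    "\<And>n. 0 < n \<Longrightarrow> (case y n of (u, x, z\<^sub>1, m, z\<^sub>2, v) \<Rightarrow> splits R m\<^sub>0 (abc n) u x z\<^sub>1 m z\<^sub>2 v)"
    by blast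
  define u x z\<^sub>1 k z\<^sub>2 v where "u n = fst (y n)" and "x n = fst (snd (y n))"
    and "z\<^sub>1 n = fst (snd (snd (y n)))" and "k n = fst (snd (snd (snd (y n))))"
    and "z\<^sub>2 n = fst (snd (snd (snd (snd (y n)))))" and "v n = snd (snd (snd (snd (snd (y n)))))" for n
  have sp: "splits R m\<^sub>0 (abc n) (u n) (x n) (z\<^sub>1 n) (k n) (z\<^sub>2 n) (v n)" if "0 < n" for n
    using y[OF that] by (simp add: u_def x_def z\<^sub>1_def k_def z\<^sub>2_def v_def case_prod_beta)
  obtain B where B: "finite B" "\<forall>u b st l v. ctx R m\<^sub>0 u b st l v \<longrightarrow> (b, st, l) \<in> B"
    using ctx_finite[OF assms, of m\<^sub>0] by (elim exE conjE)
  have "x n \<in> B" if "0 < n" for n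
  proof -
    obtain b st l where x: "x n = (b, st, l)" by (cases "x n")
    with sp[OF that] have "ctx R m\<^sub>0 (u n) b st l (v n)" by (simp add: splits_def)
    from B(2)[rule_format, OF this] x show ?thesis by simp
  qed
  then have "finite (x ` {0<..})" using B(1) by (auto intro: finite_subset)
  then obtain n\<^sub>0 where "n\<^sub>0 \<in> {0<..}" "infinite {n \<in> {0<..}. x n = x n\<^sub>0}"
    using pigeonhole_infinite[of "{0<..}" x] infinite_Ioi by blast
  then have n0: "0 < n\<^sub>0" and inf: "infinite {n \<in> {0<..}. x n = x n\<^sub>0}" by auto
  let ?S = "set_mset m\<^sub>0 \<union> (\<Union>y \<in> R. rule_places y)"
  have fin: "finite ?S"
    using assms finite_rule_places by auto
  have "set_mset (k n) \<subseteq> ?S" if "n \<in> {n \<in> {0<..}. x n = x n\<^sub>0}" for n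
  proof -
    obtain b st l where x: "x n = (b, st, l)" by (cases "x n")
    have "splits R m\<^sub>0 (abc n) (u n) (b, st, l) (z\<^sub>1 n) (k n) (z\<^sub>2 n) (v n)"
      using that sp[of n] x by simp
    then obtain z where "ctx R m\<^sub>0 (u n) b st l (v n)" "eager R b z (k n)"
      by (auto simp: splits_def)
    from ctx_places[OF this(1)] eager_places[OF this(2)] show ?thesis by blast
  qed
  from dickson_infinite[OF inf fin, of k, OF this] obtain i j where ij: "0 < i" "0 < j" "i < j"
    "x i = x n\<^sub>0" "x j = x n\<^sub>0" "k i \<subseteq># k j" by auto
  have c: "count_list (z\<^sub>1 n @ z\<^sub>2 n) 1 = n" "1 \<notin> set (u n)" "1 \<notin> set (v n)" if "0 < n" for n
  proof -
    have s: "u n @ z\<^sub>1 n @ z\<^sub>2 n @ v n = abc n" "0 \<in> set (z\<^sub>1 n)" "2 \<in> set (z\<^sub>2 n)"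
      using splitsD[OF sp[OF that]] by auto
    have "sorted (u n @ z\<^sub>1 n @ z\<^sub>2 n @ v n)" using sorted_abc s(1) by simp
    then have "\<forall>y \<in> set (u n). y \<le> 0" "\<forall>y \<in> set (v n). 2 \<le> y"
      using s(2,3) unfolding sorted_append set_append by blast+
    then show u': "1 \<notin> set (u n)" "1 \<notin> set (v n)" by force+
    have "count_list (u n @ z\<^sub>1 n @ z\<^sub>2 n @ v n) 1 = n" using s(1) count_abc by simp
    with u' show "count_list (z\<^sub>1 n @ z\<^sub>2 n) 1 = n" by simp
  qed
  \<comment> \<open>In the fixed context of \<open>n\<^sub>0\<close> the thread for \<open>n\<close>
    still yields a word of the language, and its letters \<open>1\<close> identify the word as
    \<open>abc n\<close>. From here on all words share one context.\<close>
  have *: "u n\<^sub>0 @ z\<^sub>1 n @ z\<^sub>2 n @ v n\<^sub>0 = abc n" if "0 < n" "x n = x n\<^sub>0" for n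
  proof -
    have sn: "splits R m\<^sub>0 (abc n) (u n) (x n\<^sub>0) (z\<^sub>1 n) (k n) (z\<^sub>2 n) (v n)"
      using sp[OF that(1)] that(2) by simp
    have "u n\<^sub>0 @ z\<^sub>1 n @ z\<^sub>2 n @ v n\<^sub>0 \<in> range abc"
      using splits_swap[OF sp[OF n0] sn sn] sub by blast
    then obtain n' where n': "u n\<^sub>0 @ z\<^sub>1 n @ z\<^sub>2 n @ v n\<^sub>0 = abc n'" by blast
    have "count_list (u n\<^sub>0 @ z\<^sub>1 n @ z\<^sub>2 n @ v n\<^sub>0) 1 = n"
      using c(1)[OF that(1)] c(2,3)[OF n0] by simp
    then have "n' = n" using count_abc[of 1 n'] n' by simp
    with n' show ?thesis by simp
  qed
  have si: "splits R m\<^sub>0 (abc i) (u i) (x n\<^sub>0) (z\<^sub>1 i) (k i) (z\<^sub>2 i) (v i)"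
    and sj: "splits R m\<^sub>0 (abc j) (u j) (x n\<^sub>0) (z\<^sub>1 j) (k j) (z\<^sub>2 j) (v j)"
    using sp[OF ij(1)] sp[OF ij(2)] ij by simp_all
  obtain n' where n': "u n\<^sub>0 @ z\<^sub>1 j @ z\<^sub>2 i @ v n\<^sub>0 = abc n'"
    using splits_swap[OF sp[OF n0] sj si ij(6)] sub by blast
  have z: "2 \<notin> set (z\<^sub>1 i)" "0 \<notin> set (z\<^sub>2 i)" "2 \<notin> set (z\<^sub>1 j)" "0 \<notin> set (z\<^sub>2 j)"
    using splitsD[OF si] splitsD[OF sj] by auto
  \<comment> \<open>In a common context the number of \<open>0\<close> depends on the first part
    only and the number of \<open>2\<close> on the second only, so \<open>n'\<close> would equal
    both \<open>j\<close> and \<open>i\<close>.\<close>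
  have "count_list (abc n') 0 = count_list (abc j) 0"
    unfolding n'[symmetric] *[OF ij(2,5), symmetric] using z by simp
  moreover have "count_list (abc n') 2 = count_list (abc i) 2"
    unfolding n'[symmetric] *[OF ij(1,4), symmetric] using z by simp
  ultimately show False using ij(3) by (simp add: count_abc)
qed

section \<open>Covering languages are emptying languages\<close>

text \<open>The multiset \<open>Z\<close> of pairs is an injective matching of children, and
  \<open>rest\<close> holds the unmatched ones. Only edges inside the pattern are compared, so the
  labels \<open>e\<close> and \<open>e'\<close> above the roots are unrelated.\<close>

inductive root_cover :: "'p tree \<Rightarrow> 'p tree \<Rightarrow> bool" where
  root_coverI: "(\<And>c d. (c, d) \<in># Z \<Longrightarrow> root_cover c d \<and> elab c \<subseteq># elab d) \<Longrightarrow> m \<subseteq># m' \<Longrightarrow>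
    root_cover (Node e m (image_mset fst Z)) (Node e' m' (image_mset snd Z + rest))"

inductive cover :: "'p tree \<Rightarrow> 'p tree \<Rightarrow> bool" for x where
  cover_root: "root_cover x T \<Longrightarrow> cover x T"
| cover_kid: "cover x c \<Longrightarrow> c \<in># cs \<Longrightarrow> cover x (Node e m cs)"

primrec subtrees :: "'p tree \<Rightarrow> 'p tree set" where
  "subtrees (Node e m cs) = insert (Node e m cs) (\<Union> (set_mset (image_mset subtrees cs)))"

lemma finite_subtrees: "finite (subtrees T)"
  by (induction T) auto

lemma subtrees_refl: "T \<in> subtrees T"
  by (cases T) simp

lemma subtrees_kid: "x \<in> subtrees T \<Longrightarrow> c \<in># kids x \<Longrightarrow> c \<in> subtrees T"
  by (induction T) (auto, use subtrees_refl in blast)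

text \<open>\<open>flag\<close> says whether the empty tree is a final state, the only one below
  \<open>None\<close>. That it also lies below every other tree has to be provided by
  \<open>F\<close>.\<close>

definition accepting :: "bool \<Rightarrow> 'p tree set \<Rightarrow> 'p tree option \<Rightarrow> bool" where
  "accepting flag F X \<longleftrightarrow> (case X of None \<Rightarrow> flag | Some T \<Rightarrow> \<exists>x \<in> F. cover x T)"

definition covering_language ::
  "('p, 'a) rule set \<Rightarrow> 'p tree \<Rightarrow> bool \<Rightarrow> 'p tree set \<Rightarrow> 'a list set" where
  "covering_language R T flag F = {w. \<exists>X. runs R (Some T) w X \<and> accepting flag F X}"

text \<open>
  Besides the given places, the guessing net has a place \<open>Mode d\<close> for the duty \<open>d\<close> of a thread, a
  place \<open>Tok d\<close> for a fulfilled duty of a child, and a place \<open>Pend y\<close> for a subtree \<open>y\<close> of the initial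
  state that is still to be built. The duty \<open>Boot\<close> is that of the root before it has loaded the
  marking of the root of the initial state.
\<close>

datatype 'p duty = Ordinary | Path | Boot | Cov "'p tree"

datatype 'p place = Pl 'p | Mode "'p duty" | Tok "'p duty" | Pend "'p tree"

text \<open>Coordinates for markings of the guessing net: by \<open>pm_cases\<close> and
  \<open>pm_inject\<close> every marking has exactly one such form, so applying a rule reduces to
  four separate multiset equations.\<close>

definition pm :: "'p multiset \<Rightarrow> 'p duty multiset \<Rightarrow> 'p duty multiset \<Rightarrow> 'p tree multiset \<Rightarrow> 'p place multiset"
  where "pm m os ts ys =
    image_mset Pl m + image_mset Mode os + image_mset Tok ts + image_mset Pend ys"

lemma pm_add [simp]: "pm m os ts ys + pm m' os' ts' ys' = pm (m + m') (os + os') (ts + ts') (ys + ys')"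
  by (simp add: pm_def ac_simps)

lemma pm_cases: obtains m os ts ys where "M = pm m os ts ys"
proof -
  have "\<exists>m os ts ys. M = pm m os ts ys"
  proof (induction M)
    case empty
    show ?case by (intro exI[of _ "{#}"]) (simp add: pm_def)
  next
    case (add x M)
    then obtain m os ts ys where "M = pm m os ts ys" by blast
    then have "add_mset x M = (case x of
        Pl a \<Rightarrow> pm (add_mset a m) os ts ys | Mode b \<Rightarrow> pm m (add_mset b os) ts ys
      | Tok b \<Rightarrow> pm m os (add_mset b ts) ys | Pend y \<Rightarrow> pm m os ts (add_mset y ys))"
      by (cases x) (simp_all add: pm_def)
    then show ?case by (cases x) auto
  qed
  with that show ?thesis by blast
qed

lemma pm_inject [simp]:
  "pm m os ts ys = pm m' os' ts' ys' \<longleftrightarrow> m = m' \<and> os = os' \<and> ts = ts' \<and> ys = ys'"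
proof
  assume eq: "pm m os ts ys = pm m' os' ts' ys'"
  define f where "f = (\<lambda>x :: 'a place. case x of Pl a \<Rightarrow> {#a#} | _ \<Rightarrow> {#})"
  define g where "g = (\<lambda>x :: 'a place. case x of Mode a \<Rightarrow> {#a#} | _ \<Rightarrow> {#})"
  define h where "h = (\<lambda>x :: 'a place. case x of Tok a \<Rightarrow> {#a#} | _ \<Rightarrow> {#})"
  define k where "k = (\<lambda>x :: 'a place. case x of Pend a \<Rightarrow> {#a#} | _ \<Rightarrow> {#})"
  have "sum_mset (image_mset f (pm m os ts ys)) = m" for m :: "'a multiset" and os ts ys
    by (simp add: pm_def f_def multiset.map_comp comp_def sum_mset.neutral)
  moreover have "sum_mset (image_mset g (pm m os ts ys)) = os" for m :: "'a multiset" and os ts ys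
    by (simp add: pm_def g_def multiset.map_comp comp_def sum_mset.neutral)
  moreover have "sum_mset (image_mset h (pm m os ts ys)) = ts" for m :: "'a multiset" and os ts ys
    by (simp add: pm_def h_def multiset.map_comp comp_def sum_mset.neutral)
  moreover have "sum_mset (image_mset k (pm m os ts ys)) = ys" for m :: "'a multiset" and os ts ys
    by (simp add: pm_def k_def multiset.map_comp comp_def sum_mset.neutral)
  ultimately show "m = m' \<and> os = os' \<and> ts = ts' \<and> ys = ys'" using eq by metis
qed simp

text \<open>A thread with a duty returns a token naming it in place of its edge label: it counts as
  frozen and not as cut, so the simulated parent must not receive the label.\<close>

definition ret :: "'p duty \<Rightarrow> 'p multiset \<Rightarrow> 'p place multiset" where
  "ret b e = (if b = Ordinary then pm e {#} {#} {#} else pm {#} {#} {#b#} {#})"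

section \<open>The guessing net for a finite set of patterns\<close>

locale covering =
  fixes R :: "('p, 'a) rule set" and T\<^sub>0 :: "'p tree" and flag :: bool and F :: "'p tree set"
begin

definition X :: "'p tree set" where
  "X = \<Union> (subtrees ` F)"

text \<open>The label above a thread never changes, so its condition can be tested once, when the
  duty is guessed. \<open>Boot\<close> is never allowed for a child.\<close>

definition allowed :: "'p duty \<Rightarrow> 'p multiset \<Rightarrow> bool" where
  "allowed b e \<longleftrightarrow> b = Ordinary \<or> b = Path \<or> (\<exists>x \<in> X. b = Cov x \<and> elab x \<subseteq># e)"

text \<open>Duties of the root for which emptying the tree means acceptance. An ordinary root is
  really cut; this reaches the empty tree and therefore needs \<open>flag\<close>.\<close>

definition root_obs :: "'p duty set" where
  "root_obs = insert Path (Cov ` F \<union> (if flag then {Ordinary} else {}))"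

text \<open>Elementary and abstract rules work under every duty, since a pattern has to be met only
  at the end; the original cuts are reserved for ordinary threads. An emptying language starts from
  a thread without children, so the initial tree is unfolded silently: \<open>G_boot\<close> loads
  the root and \<open>G_build\<close> creates each child announced by a token
  \<open>Pend\<close>.\<close>

inductive_set G :: "('p place, 'a) rule set" where
  G_El: "El p q l \<in> R \<Longrightarrow> El (pm p {#} {#} {#}) (pm q {#} {#} {#}) l \<in> G"
| G_Ab: "Ab p q s l \<in> R \<Longrightarrow> allowed b q \<Longrightarrow> Ab (pm p {#} {#} {#}) (ret b q) (pm s {#b#} {#} {#}) l \<in> G"
| G_Ct: "Ct p l \<in> R \<Longrightarrow> Ct (pm p {#Ordinary#} {#} {#}) l \<in> G"
| G_Cov: "Node e m cs \<in> X \<Longrightarrow>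
    Ct (pm m {#Cov (Node e m cs)#} (image_mset Cov cs) {#}) None \<in> G"
| G_Path: "b = Path \<or> b \<in> Cov ` F \<Longrightarrow> Ct (pm {#} {#Path#} {#b#} {#}) None \<in> G"
| G_boot: "b \<in> root_obs \<Longrightarrow>
    El (pm {#} {#Boot#} {#} {#}) (pm (tok T\<^sub>0) {#b#} {#} (kids T\<^sub>0)) None \<in> G"
| G_build: "y \<in> subtrees T\<^sub>0 \<Longrightarrow> allowed b (elab y) \<Longrightarrow>
    Ab (pm {#} {#} {#} {#y#}) (ret b (elab y)) (pm (tok y) {#b#} {#} (kids y)) None \<in> G"

section \<open>Soundness: an emptying run of the guessing net simulates an accepting run\<close>

definition holds :: "'p duty \<Rightarrow> 'p tree \<Rightarrow> bool" where
  "holds b c \<longleftrightarrow> (b = Path \<and> (\<exists>x \<in> F. cover x c)) \<or> (\<exists>x. b = Cov x \<and> root_cover x c)"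

text \<open>
  In the simulated tree, the children in \<open>Y\<close> are frozen: they have fulfilled their duties and exist
  in the guessing net only as tokens. The children in \<open>ys\<close> have not been built yet.
\<close>

inductive sim :: "'p duty \<Rightarrow> 'p place tree \<Rightarrow> 'p tree \<Rightarrow> bool" where
  simI: "(\<And>D T. (D, T) \<in># Z \<Longrightarrow> \<exists>b. allowed b (elab T) \<and> elab D = ret b (elab T) \<and> sim b D T) \<Longrightarrow>
    (\<And>b c. (b, c) \<in># Y \<Longrightarrow> allowed b (elab c) \<and> holds b c) \<Longrightarrow>
    sim b (Node e' (pm m {#b#} (image_mset fst Y) ys) (image_mset fst Z))
      (Node e m (image_mset snd Z + image_mset snd Y + ys))"

text \<open>Rules with empty precondition can fire before \<open>G_boot\<close>, so the root may
  already have tokens and children when the initial tree is loaded. The tree simulated after the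
  boot is therefore this union.\<close>

definition merge :: "'p tree \<Rightarrow> 'p tree" where
  "merge T = Node (elab T) (tok T + tok T\<^sub>0) (kids T + kids T\<^sub>0)"

lemma image_fst_add:
  assumes "image_mset fst Z = add_mset c cs"
  obtains d Z' where "Z = add_mset (c, d) Z'" "cs = image_mset fst Z'"
  using msed_map_invR[OF assms] by (metis prod.collapse)

lemma image_snd_add:
  assumes "image_mset snd Z = add_mset d cs"
  obtains c Z' where "Z = add_mset (c, d) Z'" "cs = image_mset snd Z'"
  using msed_map_invR[OF assms] by (metis prod.collapse)

lemma sim_step:
  assumes "step G D l D'" "sim b D T"
  shows "case D' of None \<Rightarrow> b = Ordinary \<and> step R T l None \<or> l = None \<and> holds b T
    | Some D\<^sub>1 \<Rightarrow> (\<exists>T\<^sub>1. (step R T l (Some T\<^sub>1) \<or> l = None \<and> T\<^sub>1 = T) \<and> sim b D\<^sub>1 T\<^sub>1) \<or>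
        b = Boot \<and> l = None \<and> (\<exists>b\<^sub>1 \<in> root_obs. sim b\<^sub>1 D\<^sub>1 (merge T))"
  using assms
proof (induction arbitrary: b T)
  case (step_El p q l e r cs)
  obtain Z Y ys m e\<^sub>0 where
    *: "p + r = pm m {#b#} (image_mset fst Y) ys" "cs = image_mset fst Z"
    "T = Node e\<^sub>0 m (image_mset snd Z + image_mset snd Y + ys)"
    and Z: "\<And>D T. (D, T) \<in># Z \<Longrightarrow> \<exists>b. allowed b (elab T) \<and> elab D = ret b (elab T) \<and> sim b D T"
    and Y: "\<And>b c. (b, c) \<in># Y \<Longrightarrow> allowed b (elab c) \<and> holds b c"
    using step_El(2) by cases blast
  obtain rm ro rt ry where r: "r = pm rm ro rt ry" by (rule pm_cases)
  from step_El(1) show ?case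
  proof cases
    case (G_El p' q')
    have "sim b (Node e (pm (rm + q') {#b#} (image_mset fst Y) ys) (image_mset fst Z))
      (Node e\<^sub>0 (rm + q') (image_mset snd Z + image_mset snd Y + ys))"
      by (intro simI Z Y)
    moreover have "step R T l (Some (Node e\<^sub>0 (rm + q') (image_mset snd Z + image_mset snd Y + ys)))"
      using step.step_El[OF G_El(3)] * r G_El by auto
    ultimately show ?thesis using * r G_El by auto
  next
    case (G_boot b\<^sub>1)
    have "sim b\<^sub>1 (Node e (pm (m + tok T\<^sub>0) {#b\<^sub>1#} (image_mset fst Y) (ys + kids T\<^sub>0)) (image_mset fst Z))
      (Node e\<^sub>0 (m + tok T\<^sub>0) (image_mset snd Z + image_mset snd Y + (ys + kids T\<^sub>0)))"
      by (intro simI Z Y)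
    then show ?thesis using * r G_boot by (auto simp: merge_def ac_simps)
  qed
next
  case (step_Ab p q s l e r cs)
  obtain Z Y ys m e\<^sub>0 where
    *: "p + r = pm m {#b#} (image_mset fst Y) ys" "cs = image_mset fst Z"
    "T = Node e\<^sub>0 m (image_mset snd Z + image_mset snd Y + ys)"
    and Z: "\<And>D T. (D, T) \<in># Z \<Longrightarrow> \<exists>b. allowed b (elab T) \<and> elab D = ret b (elab T) \<and> sim b D T"
    and Y: "\<And>b c. (b, c) \<in># Y \<Longrightarrow> allowed b (elab c) \<and> holds b c"
    using step_Ab(2) by cases blast
  obtain rm ro rt ry where r: "r = pm rm ro rt ry" by (rule pm_cases)
  from step_Ab(1) show ?case
  proof cases
    case (G_Ab p' q' s' b')
    let ?Z = "add_mset (Node q s {#}, Node q' s' {#}) Z"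
    have "sim b' (Node q s {#}) (Node q' s' {#})"
      using simI[of "{#}" "{#}" b' q s' "{#}" q'] G_Ab by simp
    then have "sim b (Node e (pm rm {#b#} (image_mset fst Y) ys) (image_mset fst ?Z))
      (Node e\<^sub>0 rm (image_mset snd ?Z + image_mset snd Y + ys))"
      using Z Y G_Ab by (intro simI) auto
    moreover have "step R T l (Some (Node e\<^sub>0 rm (image_mset snd ?Z + image_mset snd Y + ys)))"
      using step.step_Ab[OF G_Ab(4)] * r G_Ab by auto
    ultimately show ?thesis using * r G_Ab by auto
  next
    case (G_build y b')
    let ?Z = "add_mset (Node q s {#}, y) Z"
    have "sim b' (Node q s {#}) y"
      using simI[of "{#}" "{#}" b' q "tok y" "kids y" "elab y"] G_build by simp
    then have "sim b (Node e (pm rm {#b#} (image_mset fst Y) ry) (image_mset fst ?Z))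
      (Node e\<^sub>0 rm (image_mset snd ?Z + image_mset snd Y + ry))"
      using Z Y G_build by (intro simI) auto
    moreover have "ys = add_mset y ry" using * r G_build by auto
    ultimately show ?thesis using * r G_build by auto
  qed
next
  case (step_Ct p l e r cs)
  obtain Z Y ys m e\<^sub>0 where
    *: "p + r = pm m {#b#} (image_mset fst Y) ys" "cs = image_mset fst Z"
    "T = Node e\<^sub>0 m (image_mset snd Z + image_mset snd Y + ys)"
    and Y: "\<And>b c. (b, c) \<in># Y \<Longrightarrow> allowed b (elab c) \<and> holds b c"
    using step_Ct(2) by cases blast
  obtain rm ro rt ry where r: "r = pm rm ro rt ry" by (rule pm_cases)
  from step_Ct(1) show ?case
  proof cases
    case (G_Ct p')
    then show ?thesis using step.step_Ct[OF G_Ct(2)] * r by auto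
  next
    case (G_Cov e' m' cs')
    have b: "b = Cov (Node e' m' cs')" "m = m' + rm" "image_mset fst Y = image_mset Cov cs' + rt"
      using * r G_Cov by auto
    \<comment> \<open>The consumed tokens single out frozen children that match \<open>cs'\<close>;
      all other children, frozen or not, become the rest of the cover.\<close>
    obtain Y\<^sub>1 Y\<^sub>2 where Y12: "Y = Y\<^sub>1 + Y\<^sub>2" "image_mset fst Y\<^sub>1 = image_mset Cov cs'"
      using image_mset_eq_plusD[OF b(3)] by metis
    \<comment> \<open>Reads the pattern off the duty; all duties in \<open>Y\<^sub>1\<close> have
      the form \<open>Cov\<close>, so no other case arises.\<close>
    define Z' where "Z' = image_mset (\<lambda>(b, c). (case b of Cov x \<Rightarrow> x, c)) Y\<^sub>1"
    have "image_mset (\<lambda>b. case b of Cov x \<Rightarrow> x) (image_mset fst Y\<^sub>1) = cs'"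
      unfolding Y12(2) by (simp add: multiset.map_comp comp_def)
    then have Z': "image_mset fst Z' = cs'" "image_mset snd Z' = image_mset snd Y\<^sub>1"
      by (simp_all add: Z'_def multiset.map_comp comp_def case_prod_beta)
    have "root_cover c d \<and> elab c \<subseteq># elab d" if cd: "(c, d) \<in># Z'" for c d
    proof -
      obtain b' where b': "(b', d) \<in># Y\<^sub>1" "c = (case b' of Cov x \<Rightarrow> x)"
        using cd by (auto simp: Z'_def)
      have "b' \<in># image_mset fst Y\<^sub>1" using b'(1) by force
      then have "b' = Cov c" using b'(2) unfolding Y12(2) by auto
      then show ?thesis using Y[of b' d] b'(1) Y12(1) by (auto simp: allowed_def holds_def)
    qed
    then have "root_cover (Node e' m' (image_mset fst Z'))
        (Node e\<^sub>0 m (image_mset snd Z' + (image_mset snd Z + image_mset snd Y\<^sub>2 + ys)))"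
      using b(2) by (intro root_coverI) auto
    then have "root_cover (Node e' m' cs') T"
      using * Z' Y12(1) by (simp add: ac_simps)
    then show ?thesis using b(1) G_Cov by (simp add: holds_def)
  next
    case (G_Path b')
    have b: "b = Path" "image_mset fst Y = add_mset b' rt"
      using * r G_Path by auto
    obtain c Y' where Y': "Y = add_mset (b', c) Y'"
      using image_fst_add[OF b(2)] by blast
    then have "holds b' c" using Y by auto
    moreover have "cover x T" if "cover x c" for x
      using * Y' cover_kid[OF that] by auto
    ultimately show ?thesis using b G_Path by (auto simp: holds_def intro: cover_root)
  qed
next
  case (step_kid c l c' e m' cs)
  obtain Z Y ys m e\<^sub>0 where
    *: "m' = pm m {#b#} (image_mset fst Y) ys" "image_mset fst Z = add_mset c cs"
    "T = Node e\<^sub>0 m (image_mset snd Z + image_mset snd Y + ys)"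
    and Z: "\<And>D T. (D, T) \<in># Z \<Longrightarrow> \<exists>b. allowed b (elab T) \<and> elab D = ret b (elab T) \<and> sim b D T"
    and Y: "\<And>b c. (b, c) \<in># Y \<Longrightarrow> allowed b (elab c) \<and> holds b c"
    using step_kid(3) by cases metis
  obtain t Z' where Z': "Z = add_mset (c, t) Z'" "cs = image_mset fst Z'"
    using image_fst_add[OF *(2)] by blast
  obtain b' where b': "allowed b' (elab t)" "elab c = ret b' (elab t)" "sim b' c t"
    using Z[of c t] Z' by auto
  then obtain t' where t': "step R t l (Some t') \<or> l = None \<and> t' = t" "sim b' c' t'"
    using step_kid.IH[OF b'(3)] by (auto simp: allowed_def)
  have e: "elab t' = elab t" "elab c' = elab c"
    using t' step_elab step_kid(1) by blast+
  have "sim b (Node e m' (image_mset fst (add_mset (c', t') Z')))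
    (Node e\<^sub>0 m (image_mset snd (add_mset (c', t') Z') + image_mset snd Y + ys))"
    unfolding *(1) using Z Z'(1) Y b' t' e by (intro simI) auto
  moreover have "step R T l (Some (Node e\<^sub>0 m (image_mset snd (add_mset (c', t') Z') + image_mset snd Y + ys))) \<or>
     l = None \<and> Node e\<^sub>0 m (image_mset snd (add_mset (c', t') Z') + image_mset snd Y + ys) = T"
    using t'(1) *(3) Z'(1) by (auto intro: step.step_kid)
  ultimately show ?case using Z'(2) by auto
next
  case (step_return c l e m' cs)
  obtain Z Y ys m e\<^sub>0 where
    *: "m' = pm m {#b#} (image_mset fst Y) ys" "image_mset fst Z = add_mset c cs"
    "T = Node e\<^sub>0 m (image_mset snd Z + image_mset snd Y + ys)"
    and Z: "\<And>D T. (D, T) \<in># Z \<Longrightarrow> \<exists>b. allowed b (elab T) \<and> elab D = ret b (elab T) \<and> sim b D T"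
    and Y: "\<And>b c. (b, c) \<in># Y \<Longrightarrow> allowed b (elab c) \<and> holds b c"
    using step_return(3) by cases metis
  obtain t Z' where Z': "Z = add_mset (c, t) Z'" "cs = image_mset fst Z'"
    using image_fst_add[OF *(2)] by blast
  obtain b' where b': "allowed b' (elab t)" "elab c = ret b' (elab t)" "sim b' c t"
    using Z[of c t] Z' by auto
  from step_return.IH[OF b'(3)] consider "b' = Ordinary" "step R t l None" | "l = None" "holds b' t"
    by auto
  then show ?case
  proof cases
    case 1
    have "sim b (Node e (pm (m + elab t) {#b#} (image_mset fst Y) ys) (image_mset fst Z'))
      (Node e\<^sub>0 (m + elab t) (image_mset snd Z' + image_mset snd Y + ys))"
      using Z Z'(1) Y by (intro simI) auto
    moreover have "step R T l (Some (Node e\<^sub>0 (m + elab t) (image_mset snd Z' + image_mset snd Y + ys)))"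
      using *(3) Z'(1) 1(2) by (auto intro: step.step_return)
    ultimately show ?thesis using *(1) b'(2) 1(1) Z'(2) by (auto simp: ret_def)
  next
    case 2
    then have "b' \<noteq> Ordinary" by (auto simp: holds_def)
    have "sim b (Node e (pm m {#b#} (image_mset fst (add_mset (b', t) Y)) ys) (image_mset fst Z'))
      (Node e\<^sub>0 m (image_mset snd Z' + image_mset snd (add_mset (b', t) Y) + ys))"
      using Z Z'(1) Y 2 b' by (intro simI) auto
    then show ?thesis using * b'(2) \<open>b' \<noteq> Ordinary\<close> 2 Z' by (auto simp: ret_def)
  qed
qed

text \<open>Tokens and children added at the root do not disturb a step, so what happens before the
  boot can be replayed with the initial tree already present.\<close>

lemma merge_step: "step R T l (Some T') \<Longrightarrow> step R (merge T) l (Some (merge T'))"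
proof (erule step.cases; clarsimp simp: merge_def)
  fix p q and l :: "'a option" and e r :: "'p multiset" and cs assume "El p q l \<in> R"
  from step_El[OF this, of e "r + tok T\<^sub>0" "cs + kids T\<^sub>0"]
  show "step R (Node e (p + r + tok T\<^sub>0) (cs + kids T\<^sub>0)) l
    (Some (Node e (r + q + tok T\<^sub>0) (cs + kids T\<^sub>0)))" by (simp add: ac_simps)
next
  fix p q b and l :: "'a option" and e r :: "'p multiset" and cs assume "Ab p q b l \<in> R"
  from step_Ab[OF this, of e "r + tok T\<^sub>0" "cs + kids T\<^sub>0"]
  show "step R (Node e (p + r + tok T\<^sub>0) (cs + kids T\<^sub>0)) l
    (Some (Node e (r + tok T\<^sub>0) (add_mset (Node q b {#}) (cs + kids T\<^sub>0))))" by (simp add: ac_simps)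
next
  fix c and l :: "'a option" and c' and e m :: "'p multiset" and cs assume "step R c l (Some c')"
  from step_kid[OF this]
  show "step R (Node e (m + tok T\<^sub>0) (add_mset c (cs + kids T\<^sub>0))) l
    (Some (Node e (m + tok T\<^sub>0) (add_mset c' (cs + kids T\<^sub>0))))" .
next
  fix c and l :: "'a option" and e m :: "'p multiset" and cs assume "step R c l None"
  from step_return[OF this, of e "m + tok T\<^sub>0" "cs + kids T\<^sub>0"]
  show "step R (Node e (m + tok T\<^sub>0) (add_mset c (cs + kids T\<^sub>0))) l
    (Some (Node e (m + elab c + tok T\<^sub>0) (cs + kids T\<^sub>0)))" by (simp add: ac_simps)
qed

lemma sim_runs_root:
  assumes "runs G D w D'"
  shows "D = Some D\<^sub>1 \<Longrightarrow> D' = None \<Longrightarrow> sim b D\<^sub>1 T \<Longrightarrow> b \<in> root_obs \<Longrightarrow> w \<in> covering_language R T flag F"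
  using assms
proof (induction arbitrary: D\<^sub>1 T rule: runs.induct)
  case (runs_step D l D'' w D')
  have D: "sim b D T" "b \<noteq> Boot" using runs_step by (auto simp: root_obs_def split: if_splits)
  show ?case
  proof (cases D'')
    case None
    then have w: "w = []" using runs_step by (simp add: runs_None)
    from sim_step[OF runs_step(1) D(1)] None
    consider "b = Ordinary" "step R T l None" | "l = None" "holds b T" by auto
    then show ?thesis
    proof cases
      case 1
      then show ?thesis using w runs_single[of R T l None] runs_step.prems(4)
        by (auto simp: covering_language_def accepting_def root_obs_def split: if_splits intro!: exI[of _ None])
    next
      case 2
      then have "\<exists>x \<in> F. cover x T"
        using runs_step.prems(4) by (auto simp: root_obs_def holds_def split: if_splits dest: cover_root)
      then show ?thesis using w 2(1) runs_refl[of R "Some T"]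
        by (auto simp: covering_language_def accepting_def intro!: exI[of _ "Some T"])
    qed
  next
    case (Some D\<^sub>2)
    then obtain T\<^sub>1 where "step R T l (Some T\<^sub>1) \<or> l = None \<and> T\<^sub>1 = T" and T1: "sim b D\<^sub>2 T\<^sub>1"
      using sim_step[OF runs_step(1) D(1)] D(2) by auto
    moreover from runs_step.IH[OF Some runs_step.prems(2) T1 runs_step.prems(4)]
    have "w \<in> covering_language R T\<^sub>1 flag F" .
    ultimately show ?thesis
      unfolding covering_language_def using runs.runs_step by fastforce
  qed
qed simp

lemma sim_runs_boot:
  assumes "runs G D w D'"
  shows "D = Some D\<^sub>1 \<Longrightarrow> D' = None \<Longrightarrow> sim Boot D\<^sub>1 T \<Longrightarrow> w \<in> covering_language R (merge T) flag F"
  using assms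
proof (induction arbitrary: D\<^sub>1 T rule: runs.induct)
  case (runs_step D l D'' w D')
  have D: "sim Boot D T" using runs_step by simp
  show ?case
  proof (cases D'')
    case None
    with sim_step[OF runs_step(1) D] show ?thesis by (auto simp: holds_def)
  next
    case (Some D\<^sub>2)
    from sim_step[OF runs_step(1) D] Some
    consider T\<^sub>1 where "step R T l (Some T\<^sub>1) \<or> l = None \<and> T\<^sub>1 = T" "sim Boot D\<^sub>2 T\<^sub>1"
      | b\<^sub>1 where "b\<^sub>1 \<in> root_obs" "l = None" "sim b\<^sub>1 D\<^sub>2 (merge T)" by auto
    then show ?thesis
    proof cases
      case 1
      have "w \<in> covering_language R (merge T\<^sub>1) flag F"
        using runs_step.IH[OF Some runs_step.prems(2) 1(2)] .
      then show ?thesis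
        using 1(1) merge_step unfolding covering_language_def by (fastforce intro: runs.runs_step)
    next
      case 2
      then show ?thesis using sim_runs_root[OF runs_step(2) Some runs_step.prems(2)] by simp
    qed
  qed
qed simp

lemma emptying_subset: "emptying_language G {#Mode Boot#} \<subseteq> covering_language R T\<^sub>0 flag F"
proof
  fix w assume "w \<in> emptying_language G {#Mode Boot#}"
  then have r: "runs G (Some (Node {#} (pm {#} {#Boot#} {#} {#}) {#})) w None"
    by (simp add: emptying_language_def pm_def)
  \<comment> \<open>The simulated tree starts with nothing but the root label, so that merging it
    yields exactly \<open>T\<^sub>0\<close>.\<close>
  have "sim Boot (Node {#} (pm {#} {#Boot#} {#} {#}) {#}) (Node (elab T\<^sub>0) {#} {#})"
    using simI[of "{#}" "{#}" Boot "{#}" "{#}" "{#}"] by simp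
  from sim_runs_boot[OF r refl refl this] show "w \<in> covering_language R T\<^sub>0 flag F"
    by (simp add: merge_def)
qed


section \<open>Completeness: an accepting run is lifted to the guessing net\<close>

text \<open>
  Duties depend on the final embedding, so runs are lifted to the guessing net backwards.
\<close>

inductive decorated :: "'p duty \<Rightarrow> 'p place tree \<Rightarrow> 'p tree \<Rightarrow> bool" where
  decI: "(\<And>D T. (D, T) \<in># Z \<Longrightarrow> \<exists>b. allowed b (elab T) \<and> elab D = ret b (elab T) \<and> decorated b D T) \<Longrightarrow>
    decorated b (Node e' (pm m {#b#} {#} {#}) (image_mset fst Z)) (Node e m (image_mset snd Z))"

lemma allowed_Ord: "allowed Ordinary e" and allowed_Path: "allowed Path e"
  by (simp_all add: allowed_def)

text \<open>Ordinary duties are allowed everywhere, so any duty and label of the root extend to a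
  decoration.\<close>

lemma decorated_exists: "\<exists>D. decorated b D T \<and> elab D = e'"
proof (induction T arbitrary: b e')
  case (Node e m cs)
  then have "\<forall>c. \<exists>D. c \<in># cs \<longrightarrow> decorated Ordinary D c \<and> elab D = ret Ordinary (elab c)" by blast
  then obtain f where f: "\<And>c. c \<in># cs \<Longrightarrow> decorated Ordinary (f c) c \<and> elab (f c) = ret Ordinary (elab c)"
    by metis
  define Z where "Z = image_mset (\<lambda>c. (f c, c)) cs"
  have "decorated b (Node e' (pm m {#b#} {#} {#}) (image_mset fst Z)) (Node e m (image_mset snd Z))"
    by (rule decI) (use f allowed_Ord in \<open>auto simp: Z_def\<close>)
  then show ?case by (auto simp: Z_def multiset.map_comp comp_def)
qed

text \<open>The duties of the later tree are copied to the earlier one. A child that has been cut in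
  between gets the ordinary duty; for a child that is new, its duty in the later tree selects the
  instance of \<open>G_Ab\<close> to fire.\<close>

lemma decorated_step:
  assumes "step R T l T'"
  shows "case T' of None \<Rightarrow> (\<forall>e'. \<exists>D. decorated Ordinary D T \<and> elab D = e' \<and> step G D l None)
    | Some T\<^sub>1 \<Rightarrow> (\<forall>b D\<^sub>1. decorated b D\<^sub>1 T\<^sub>1 \<longrightarrow> (\<exists>D. decorated b D T \<and> step G D l (Some D\<^sub>1)))"
  using assms
proof induction
  case (step_El p q l e r cs)
  show ?case
  proof (clarsimp)
    fix b D\<^sub>1 assume "decorated b D\<^sub>1 (Node e (r + q) cs)"
    then show "\<exists>D. decorated b D (Node e (p + r) cs) \<and> step G D l (Some D\<^sub>1)"
    proof cases
      case (decI Z e')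
      have "decorated b (Node e' (pm (p + r) {#b#} {#} {#}) (image_mset fst Z)) (Node e (p + r) cs)"
        unfolding decI(2) by (rule decorated.decI) (use decI(3) in blast)
      moreover have "step G (Node e' (pm (p + r) {#b#} {#} {#}) (image_mset fst Z)) l (Some D\<^sub>1)"
        using step.step_El[OF G_El[OF step_El], of e' "pm r {#b#} {#} {#}"] decI(1) by simp
      ultimately show ?thesis by blast
    qed
  qed
next
  case (step_Ab p q s l e r cs)
  show ?case
  proof (clarsimp)
    fix b D\<^sub>1 assume "decorated b D\<^sub>1 (Node e r (add_mset (Node q s {#}) cs))"
    then show "\<exists>D. decorated b D (Node e (p + r) cs) \<and> step G D l (Some D\<^sub>1)"
    proof cases
      case (decI Z e')
      obtain c Z' where Z': "Z = add_mset (c, Node q s {#}) Z'" "cs = image_mset snd Z'"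
        using image_snd_add[OF decI(2)[symmetric]] by blast
      obtain b' where b': "allowed b' q" "elab c = ret b' q" "decorated b' c (Node q s {#})"
        using decI(3)[of c "Node q s {#}"] Z'(1) by auto
      \<comment> \<open>A decorated leaf is determined by its duty and labels, so it is exactly what
        \<open>G_Ab\<close> creates.\<close>
      from b'(3,2) have c: "c = Node (ret b' q) (pm s {#b'#} {#} {#}) {#}"
        by cases auto
      have "decorated b (Node e' (pm (p + r) {#b#} {#} {#}) (image_mset fst Z')) (Node e (p + r) cs)"
        unfolding Z'(2) by (rule decorated.decI) (use decI(3) Z'(1) in auto)
      moreover have "step G (Node e' (pm (p + r) {#b#} {#} {#}) (image_mset fst Z')) l (Some D\<^sub>1)"
        using step.step_Ab[OF G_Ab[OF step_Ab b'(1)], of e' "pm r {#b#} {#} {#}"] decI(1) Z' c by simp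
      ultimately show ?thesis by blast
    qed
  qed
next
  case (step_Ct p l e r cs)
  show ?case
  proof (clarsimp)
    fix e' :: "'p place multiset"
    obtain D where D: "decorated Ordinary D (Node e (p + r) cs)" "elab D = e'"
      using decorated_exists by blast
    from D(1) have "step G D l None"
    proof cases
      case (decI Z e'')
      then show ?thesis
        using step.step_Ct[OF G_Ct[OF step_Ct], of e'' "pm r {#} {#} {#}"] by simp
    qed
    with D show "\<exists>D. decorated Ordinary D (Node e (p + r) cs) \<and> elab D = e' \<and> step G D l None" by blast
  qed
next
  case (step_kid c l c' e m cs)
  show ?case
  proof (clarsimp)
    fix b D\<^sub>1 assume "decorated b D\<^sub>1 (Node e m (add_mset c' cs))"
    then show "\<exists>D. decorated b D (Node e m (add_mset c cs)) \<and> step G D l (Some D\<^sub>1)"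
    proof cases
      case (decI Z e')
      obtain d' Z' where Z': "Z = add_mset (d', c') Z'" "cs = image_mset snd Z'"
        using image_snd_add[OF decI(2)[symmetric]] by blast
      obtain b' where b': "allowed b' (elab c')" "elab d' = ret b' (elab c')" "decorated b' d' c'"
        using decI(3)[of d' c'] Z'(1) by auto
      obtain d where d: "decorated b' d c" "step G d l (Some d')"
        using step_kid.IH b'(3) by auto
      have e: "elab c' = elab c" "elab d' = elab d"
        using step_elab[OF step_kid(1)] step_elab[OF d(2)] by simp_all
      have "decorated b (Node e' (pm m {#b#} {#} {#}) (image_mset fst (add_mset (d, c) Z')))
        (Node e m (image_mset snd (add_mset (d, c) Z')))"
        by (rule decorated.decI) (use decI(3) Z'(1) b' d e in auto)
      moreover have "step G (Node e' (pm m {#b#} {#} {#}) (image_mset fst (add_mset (d, c) Z'))) l (Some D\<^sub>1)"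
        using step.step_kid[OF d(2)] decI(1) Z' by simp
      ultimately show ?thesis using Z'(2) by auto
    qed
  qed
next
  case (step_return c l e m cs)
  show ?case
  proof (clarsimp)
    fix b D\<^sub>1 assume "decorated b D\<^sub>1 (Node e (m + elab c) cs)"
    then show "\<exists>D. decorated b D (Node e m (add_mset c cs)) \<and> step G D l (Some D\<^sub>1)"
    proof cases
      case (decI Z e')
      obtain d where d: "decorated Ordinary d c" "elab d = ret Ordinary (elab c)" "step G d l None"
        using step_return.IH by auto
      have "decorated b (Node e' (pm m {#b#} {#} {#}) (image_mset fst (add_mset (d, c) Z)))
        (Node e m (image_mset snd (add_mset (d, c) Z)))"
        by (rule decorated.decI) (use decI(3) d allowed_Ord in auto)
      moreover have "step G (Node e' (pm m {#b#} {#} {#}) (image_mset fst (add_mset (d, c) Z))) l (Some D\<^sub>1)"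
        using step.step_return[OF d(3), of e' "pm m {#b#} {#} {#}" "image_mset fst Z"] decI(1) d(2)
        by (simp add: ret_def)
      ultimately show ?thesis using decI(2) by auto
    qed
  qed
qed

lemma runs_return_all:
  assumes "\<And>d. d \<in># A \<Longrightarrow> runs G (Some d) [] None"
  shows "runs G (Some (Node e m (A + C))) [] (Some (Node e (m + sum_mset (image_mset elab A)) C))"
  using assms
proof (induction A arbitrary: m)
  case empty
  show ?case using runs_refl by simp
next
  case (add d A)
  have "runs G (Some (Node e m (add_mset d (A + C)))) [] (Some (Node e (m + elab d) (A + C)))"
    using add.prems by (intro runs_return) simp
  from runs_trans[OF this add.IH[of "m + elab d"]] add.prems show ?case by (simp add: ac_simps)
qed

lemma X_kid: "Node e m cs \<in> X \<Longrightarrow> c \<in># cs \<Longrightarrow> c \<in> X"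
  unfolding X_def using subtrees_kid by fastforce

text \<open>The tree collapses bottom-up: matched children fulfil their duties and return their
  tokens, after which the root holds all that \<open>G_Cov\<close> consumes. Unmatched children stay
  ordinary and vanish with this cut.\<close>

lemma decorated_root_cover:
  "root_cover x T \<Longrightarrow> x \<in> X \<Longrightarrow> \<exists>D. decorated (Cov x) D T \<and> elab D = e' \<and> runs G (Some D) [] None"
proof (induction arbitrary: e' rule: root_cover.induct)
  case (root_coverI Z m m' e e\<^sub>1 rest)
  let ?x = "Node e m (image_mset fst Z)"
  have "\<exists>D. decorated (Cov c) D d \<and> elab D = ret (Cov c) (elab d) \<and> runs G (Some D) [] None"
    if "(c, d) \<in># Z" for c d
  proof -
    have "c \<in># image_mset fst Z" using that by force
    then have "c \<in> X" using X_kid root_coverI.prems by blast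
    with root_coverI.IH[OF that] show ?thesis by blast
  qed
  then have "\<forall>z. \<exists>D. z \<in># Z \<longrightarrow> decorated (Cov (fst z)) D (snd z) \<and> elab D = ret (Cov (fst z)) (elab (snd z)) \<and>
      runs G (Some D) [] None" by auto
  then obtain f where f: "\<And>z. z \<in># Z \<Longrightarrow> decorated (Cov (fst z)) (f z) (snd z) \<and>
      elab (f z) = ret (Cov (fst z)) (elab (snd z)) \<and> runs G (Some (f z)) [] None" by metis
  have "\<forall>c. \<exists>D. decorated Ordinary D c \<and> elab D = ret Ordinary (elab c)" using decorated_exists by blast
  then obtain g where g: "\<And>c. decorated Ordinary (g c) c \<and> elab (g c) = ret Ordinary (elab c)" by metis
  define W where "W = image_mset (\<lambda>z. (f z, snd z)) Z + image_mset (\<lambda>c. (g c, c)) rest"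
  have W: "image_mset fst W = image_mset f Z + image_mset g rest"
    "image_mset snd W = image_mset snd Z + rest"
    by (simp_all add: W_def multiset.map_comp comp_def)
  let ?D = "Node e' (pm m' {#Cov ?x#} {#} {#}) (image_mset fst W)"
  have al: "allowed (Cov (fst z)) (elab (snd z))" if "z \<in># Z" for z
  proof -
    have "fst z \<in> X" using that root_coverI.prems X_kid[of e m "image_mset fst Z"] by auto
    moreover have "elab (fst z) \<subseteq># elab (snd z)" using root_coverI.IH[of "fst z" "snd z"] that by simp
    ultimately show ?thesis by (simp add: allowed_def)
  qed
  have "decorated (Cov ?x) ?D (Node e\<^sub>1 m' (image_mset snd W))"
    by (rule decI) (use f g al allowed_Ord in \<open>fastforce simp: W_def\<close>)
  moreover have "runs G (Some ?D) [] None"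
  proof -
    have "image_mset elab (image_mset f Z) = image_mset (\<lambda>c. pm {#} {#} {#Cov c#} {#}) (image_mset fst Z)"
      unfolding multiset.map_comp using f by (intro image_mset_cong) (simp add: ret_def)
    moreover have "sum_mset (image_mset (\<lambda>c. pm {#} {#} {#Cov c#} {#}) A) = pm {#} {#} (image_mset Cov A) {#}"
      for A by (induction A) (simp_all add: pm_def)
    ultimately have s: "sum_mset (image_mset elab (image_mset f Z)) = pm {#} {#} (image_mset Cov (image_mset fst Z)) {#}"
      by simp
    have "runs G (Some ?D) [] (Some (Node e' (pm m' {#Cov ?x#} {#} {#} +
        sum_mset (image_mset elab (image_mset f Z))) (image_mset g rest)))"
      unfolding W(1) by (rule runs_return_all) (use f in auto)
    \<comment> \<open>The surplus \<open>m' - m\<close> of the covering marking is the remainder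
      left over by \<open>G_Cov\<close>.\<close>
    moreover have "step G (Node e' (pm m' {#Cov ?x#} {#} {#} +
        sum_mset (image_mset elab (image_mset f Z))) (image_mset g rest)) None None"
      using step_Ct[OF G_Cov[OF root_coverI.prems], of e' "pm (m' - m) {#} {#} {#}"] root_coverI(2) s by simp
    ultimately show ?thesis using runs_trans runs_single by fastforce
  qed
  ultimately show ?case using W by (intro exI[of _ ?D]) simp
qed

text \<open>Threads strictly above the image of the root of \<open>x\<close> get the duty
  \<open>Path\<close>, and each passes the report on by its own cut. As \<open>elab x\<close> is
  empty, \<open>Cov x\<close> is allowed below every edge.\<close>

lemma decorated_cover:
  assumes "cover x T" "x \<in> F" "elab x = {#}"
  shows "\<exists>b \<in> {Path, Cov x}. \<forall>e'. \<exists>D. decorated b D T \<and> elab D = e' \<and> runs G (Some D) [] None"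
  using assms(1)
proof induction
  case (cover_root T)
  have "x \<in> X" using assms(2) subtrees_refl by (auto simp: X_def)
  with decorated_root_cover[OF cover_root] show ?case by blast
next
  case (cover_kid c cs e m)
  then obtain b where b: "b \<in> {Path, Cov x}"
    "\<And>e'. \<exists>D. decorated b D c \<and> elab D = e' \<and> runs G (Some D) [] None" by blast
  obtain d where d: "decorated b d c" "elab d = ret b (elab c)" "runs G (Some d) [] None" using b(2) by blast
  obtain cs' where cs': "cs = add_mset c cs'" using cover_kid(2) by (metis multi_member_split)
  have "x \<in> X" using assms(2) subtrees_refl by (auto simp: X_def)
  then have al: "allowed b (elab c)" using b(1) assms(3) by (auto simp: allowed_def)
  have "\<forall>c. \<exists>D. decorated Ordinary D c \<and> elab D = ret Ordinary (elab c)" using decorated_exists by blast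
  then obtain g where g: "\<And>c. decorated Ordinary (g c) c \<and> elab (g c) = ret Ordinary (elab c)" by metis
  define W where "W = add_mset (d, c) (image_mset (\<lambda>c. (g c, c)) cs')"
  have W: "image_mset fst W = add_mset d (image_mset g cs')" "image_mset snd W = cs"
    by (simp_all add: W_def multiset.map_comp comp_def cs')
  have "\<exists>D. decorated Path D (Node e m cs) \<and> elab D = e' \<and> runs G (Some D) [] None" for e'
  proof -
    let ?D = "Node e' (pm m {#Path#} {#} {#}) (image_mset fst W)"
    have "decorated Path ?D (Node e m (image_mset snd W))"
      by (rule decI) (use d g al allowed_Ord in \<open>fastforce simp: W_def\<close>)
    moreover have "runs G (Some ?D) [] (Some (Node e' (pm m {#Path#} {#b#} {#}) (image_mset g cs')))"
      using runs_return[OF d(3), of e' "pm m {#Path#} {#} {#}" "image_mset g cs'"] d(2) W b(1)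
      by (auto simp: ret_def)
    moreover have "step G (Node e' (pm m {#Path#} {#b#} {#}) (image_mset g cs')) None None"
      using step_Ct[OF G_Path[of b], of e' "pm m {#} {#} {#}"] b(1) assms(2) by auto
    ultimately have "decorated Path ?D (Node e m cs) \<and> elab ?D = e' \<and> runs G (Some ?D) [] None"
      using W runs_trans runs_single by fastforce
    then show ?thesis by blast
  qed
  then show ?case by blast
qed

text \<open>Silent unfolding by recursion on the decoration: each child is created with its
  decorated duty and completed before the next one is created.\<close>

lemma decorated_build:
  "decorated b D y \<Longrightarrow> y \<in> subtrees T\<^sub>0 \<Longrightarrow>
    runs G (Some (Node (elab D) (pm (tok y) {#b#} {#} (kids y)) {#})) [] (Some D)"
proof (induction rule: decorated.induct)
  case (decI Z b e' m e)
  \<comment> \<open>\<open>C\<close> collects the children that are already complete;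
    \<open>Z\<close> holds those still pending.\<close>
  have "runs G (Some (Node e' (pm m {#b#} {#} (image_mset snd Z)) C)) []
      (Some (Node e' (pm m {#b#} {#} {#}) (C + image_mset fst Z)))"
    if "\<And>D T. (D, T) \<in># Z \<Longrightarrow> T \<in> subtrees T\<^sub>0 \<and> (\<exists>b. allowed b (elab T) \<and> elab D = ret b (elab T) \<and>
      runs G (Some (Node (elab D) (pm (tok T) {#b#} {#} (kids T)) {#})) [] (Some D))" for C
    using that
  proof (induction Z arbitrary: C)
    case empty
    show ?case by (simp add: runs_refl)
  next
    case (add z Z)
    obtain D T where z: "z = (D, T)" by fastforce
    obtain b' where b': "T \<in> subtrees T\<^sub>0" "allowed b' (elab T)" "elab D = ret b' (elab T)"
      "runs G (Some (Node (elab D) (pm (tok T) {#b'#} {#} (kids T)) {#})) [] (Some D)"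
      using add.prems[of D T] z by auto
    let ?m = "pm m {#b#} {#} (image_mset snd Z)"
    have "step G (Node e' (pm m {#b#} {#} (image_mset snd (add_mset z Z))) C) None
      (Some (Node e' ?m (add_mset (Node (elab D) (pm (tok T) {#b'#} {#} (kids T)) {#}) C)))"
      using step_Ab[OF G_build[OF b'(1,2)], of e' ?m C] z b'(3) by simp
    from runs_step[OF this runs_kid[OF b'(4)]]
    have "runs G (Some (Node e' (pm m {#b#} {#} (image_mset snd (add_mset z Z))) C)) []
      (Some (Node e' ?m (add_mset D C)))" by simp
    moreover have "runs G (Some (Node e' ?m (add_mset D C))) []
      (Some (Node e' (pm m {#b#} {#} {#}) (add_mset D C + image_mset fst Z)))"
      by (rule add.IH) (use add.prems in auto)
    ultimately show ?case using runs_trans z by fastforce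
  qed
  from this[of "{#}"] show ?case
    using decI subtrees_kid by fastforce
qed

text \<open>The decoration is chosen at the end of the run, from the cover or from the ordinary cut
  of the root, and pulled back step by step.\<close>

lemma decorated_runs:
  assumes "runs R Y w Y'"
  shows "Y = Some T \<Longrightarrow> accepting flag F Y' \<Longrightarrow> \<forall>x \<in> F. elab x = {#} \<Longrightarrow>
    \<exists>b \<in> root_obs. \<exists>D. decorated b D T \<and> elab D = {#} \<and> runs G (Some D) w None"
  using assms
proof (induction arbitrary: T rule: runs.induct)
  case (runs_refl Y)
  then obtain x where x: "x \<in> F" "cover x T" "elab x = {#}" by (auto simp: accepting_def)
  from decorated_cover[OF x(2,1,3)] obtain b D where "b \<in> {Path, Cov x}" "decorated b D T" "elab D = {#}" "runs G (Some D) [] None" by blast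
  moreover from this x(1) have "b \<in> root_obs" by (auto simp: root_obs_def)
  ultimately show ?case by blast
next
  case (runs_step T' l Y w Y')
  have T: "step R T l Y" using runs_step by simp
  show ?case
  proof (cases Y)
    case None
    then have "w = []" "Y' = None" using runs_step(2) by (simp_all add: runs_None)
    then have flag using runs_step.prems by (simp add: accepting_def)
    then have "Ordinary \<in> root_obs" unfolding root_obs_def by simp
    moreover obtain D where "decorated Ordinary D T" "elab D = {#}" "step G D l None"
      using decorated_step[OF T] None by auto
    ultimately show ?thesis using runs_single \<open>w = []\<close> by fastforce
  next
    case (Some T\<^sub>1)
    then obtain b D\<^sub>1 where "b \<in> root_obs" "decorated b D\<^sub>1 T\<^sub>1" "elab D\<^sub>1 = {#}" "runs G (Some D\<^sub>1) w None"
      using runs_step.IH runs_step.prems by blast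
    moreover from this obtain D where "decorated b D T" "step G D l (Some D\<^sub>1)"
      using decorated_step[OF T] Some by auto
    ultimately show ?thesis
      using runs.runs_step[of G D l "Some D\<^sub>1" w None] step_elab[of G D l D\<^sub>1] by auto
  qed
qed

lemma covering_subset:
  assumes "\<forall>x \<in> F. elab x = {#}"
  shows "covering_language R T\<^sub>0 flag F \<subseteq> emptying_language G {#Mode Boot#}"
proof
  fix w assume "w \<in> covering_language R T\<^sub>0 flag F"
  then obtain Y where "runs R (Some T\<^sub>0) w Y" "accepting flag F Y" by (auto simp: covering_language_def)
  from decorated_runs[OF this(1) refl this(2) assms] obtain b D
    where b: "b \<in> root_obs" "decorated b D T\<^sub>0" "elab D = {#}" "runs G (Some D) w None" by blast
  have "step G (Node {#} (pm {#} {#Boot#} {#} {#}) {#}) None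
    (Some (Node {#} (pm (tok T\<^sub>0) {#b#} {#} (kids T\<^sub>0)) {#}))"
    using step_El[OF G_boot[OF b(1)], of "{#}" "pm {#} {#} {#} {#}" "{#}"] by simp
  moreover have "runs G (Some (Node {#} (pm (tok T\<^sub>0) {#b#} {#} (kids T\<^sub>0)) {#})) [] (Some D)"
    using decorated_build[OF b(2) subtrees_refl] b(3) by simp
  from runs_trans[OF this b(4)]
  have "runs G (Some (Node {#} (pm (tok T\<^sub>0) {#b#} {#} (kids T\<^sub>0)) {#})) w None" by simp
  ultimately have "runs G (Some (Node {#} (pm {#} {#Boot#} {#} {#}) {#})) w None"
    using runs_step[of G _ None] by fastforce
  then show "w \<in> emptying_language G {#Mode Boot#}"
    by (simp add: emptying_language_def pm_def)
qed

text \<open>\<open>allowed\<close> confines guesses to subtrees of the finitely many patterns, so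
  only finitely many places indexed by trees occur.\<close>

lemma finite_G:
  assumes "finite R" "finite F"
  shows "finite G"
proof -
  have X: "finite X" using assms(2) finite_subtrees by (auto simp: X_def)
  let ?O = "insert Ordinary (insert Path (Cov ` X))"
  let ?f = "\<lambda>(x, b). case x of El p q l \<Rightarrow> El (pm p {#} {#} {#}) (pm q {#} {#} {#}) l
    | Ab p q s l \<Rightarrow> Ab (pm p {#} {#} {#}) (ret b q) (pm s {#b#} {#} {#}) l
    | Ct p l \<Rightarrow> Ct (pm p {#Ordinary#} {#} {#}) l"
  let ?g = "\<lambda>(y, b). Ab (pm {#} {#} {#} {#y#}) (ret b (elab y)) (pm (tok y) {#b#} {#} (kids y)) None"
  let ?h = "\<lambda>x. Ct (pm (tok x) {#Cov x#} (image_mset Cov (kids x)) {#}) None"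
  have O: "allowed b e \<Longrightarrow> b \<in> ?O" for b e by (auto simp: allowed_def)
  have "G \<subseteq> ?f ` (R \<times> ?O) \<union>
    ?h ` X \<union>
    (\<lambda>b. Ct (pm {#} {#Path#} {#b#} {#}) None) ` insert Path (Cov ` F) \<union>
    (\<lambda>b. El (pm {#} {#Boot#} {#} {#}) (pm (tok T\<^sub>0) {#b#} {#} (kids T\<^sub>0)) None) ` root_obs \<union>
    ?g ` (subtrees T\<^sub>0 \<times> ?O)" (is "_ \<subseteq> ?S")
  proof
    fix x assume "x \<in> G"
    then show "x \<in> ?S"
    proof cases
      case (G_El p q l)
      then have "x = ?f (El p q l, Ordinary)" "(El p q l, Ordinary) \<in> R \<times> ?O" by simp_all
      then show ?thesis by blast
    next
      case (G_Ab p q s l b)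
      then have "x = ?f (Ab p q s l, b)" "(Ab p q s l, b) \<in> R \<times> ?O" using O by simp_all
      then show ?thesis by blast
    next
      case (G_Ct p l)
      then have "x = ?f (Ct p l, Ordinary)" "(Ct p l, Ordinary) \<in> R \<times> ?O" by simp_all
      then show ?thesis by blast
    next
      case (G_Cov e m cs)
      then have "x = ?h (Node e m cs)" by simp
      with G_Cov(2) show ?thesis by blast
    next
      case (G_Path b)
      then show ?thesis by blast
    next
      case (G_boot b)
      then show ?thesis by blast
    next
      case (G_build y b)
      then have "x = ?g (y, b)" "(y, b) \<in> subtrees T\<^sub>0 \<times> ?O" using O by simp_all
      then show ?thesis by blast
    qed
  qed
  moreover have "finite ?S"
    using assms X finite_subtrees by (auto simp: root_obs_def)
  ultimately show ?thesis by (rule finite_subset)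
qed

end

theorem covering_language_is_emptying_language:
  fixes R :: "('p, 'a) rule set"
  assumes "finite R" "finite F" "\<forall>x \<in> F. elab x = {#}"
  shows "\<exists>(G :: ('p place, 'a) rule set) m. finite G \<and> covering_language R T flag F = emptying_language G m"
proof -
  have "covering_language R T flag F = emptying_language (covering.G R T flag F) {#Mode Boot#}"
    by (intro equalityI covering.emptying_subset covering.covering_subset[OF assms(3)])
  with covering.finite_G[OF assms(1,2)] show ?thesis by (intro exI conjI)
qed

section \<open>States as trees\<close>

abbreviation children :: "('v, 'p) state \<Rightarrow> 'v \<Rightarrow> 'v set" where
  "children s v \<equiv> {w. (v, w) \<in> edges s}"

text \<open>\<open>g\<close> selects a tree for each child, and its multiset image forgets the
  vertices. Finiteness is demanded because \<open>mset_set\<close> of an infinite set is empty. The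
  label above \<open>v\<close> itself is left free.\<close>

inductive rep :: "('v, 'p) state \<Rightarrow> 'v \<Rightarrow> 'p tree \<Rightarrow> bool" for s where
  repI: "count m = mark s v \<Longrightarrow> finite (children s v) \<Longrightarrow>
    (\<And>w. w \<in> children s v \<Longrightarrow> rep s w (g w) \<and> count (elab (g w)) = elabel s (v, w)) \<Longrightarrow>
    rep s v (Node e m (image_mset g (mset_set (children s v))))"

section \<open>Rooted trees given by their edge relation\<close>

lemma rooted_tree_unique:
  assumes "rooted_tree V E r" "(u, v) \<in> E" "(u', v) \<in> E"
  shows "u = u'"
proof -
  have "v \<noteq> r" "v \<in> V" using assms by (auto simp: rooted_tree_def)
  then show ?thesis using assms unfolding rooted_tree_def by blast
qed

text \<open>The root lies on no cycle. A cycle through \<open>z\<close> enters it from its unique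
  parent \<open>y\<close> and hence passes through \<open>y\<close>, so acyclicity spreads along
  paths from the root.\<close>

lemma rooted_tree_acyclic:
  assumes "rooted_tree V E r"
  shows "acyclic E"
proof (rule acyclicI, rule allI)
  fix x
  have *: "(z, z) \<notin> E\<^sup>+" if "(r, z) \<in> E\<^sup>*" for z
    using that
  proof induction
    case base
    show ?case using assms by (auto simp: rooted_tree_def dest: tranclD2)
  next
    case (step y z)
    show ?case
    proof
      assume "(z, z) \<in> E\<^sup>+"
      then obtain p where "(z, p) \<in> E\<^sup>*" "(p, z) \<in> E" by (meson tranclD2)
      then have "(z, y) \<in> E\<^sup>*" using rooted_tree_unique[OF assms] step(2) by metis
      with step show False by (meson rtrancl_into_trancl2)
    qed
  qed
  show "(x, x) \<notin> E\<^sup>+"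
  proof
    assume a: "(x, x) \<in> E\<^sup>+"
    then obtain y where "(x, y) \<in> E" by (meson tranclD)
    then have "(r, x) \<in> E\<^sup>*" using assms by (auto simp: rooted_tree_def)
    with * a show False by blast
  qed
qed

lemma rooted_tree_no_back:
  assumes "rooted_tree V E r" "(x, y) \<in> E" "(y, z) \<in> E\<^sup>*"
  shows "(z, x) \<notin> E\<^sup>*"
proof
  assume "(z, x) \<in> E\<^sup>*"
  with assms(2,3) have "(x, x) \<in> E\<^sup>+" by (meson rtrancl_into_trancl2 rtrancl_trans)
  with rooted_tree_acyclic[OF assms(1)] show False by (auto simp: acyclic_def)
qed

text \<open>The converse of the edge relation is single-valued, so of two paths up from
  \<open>v\<close> one continues the other.\<close>

lemma rooted_tree_comparable:
  assumes "rooted_tree V E r" "(x, v) \<in> E\<^sup>*" "(y, v) \<in> E\<^sup>*"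
  shows "(x, y) \<in> E\<^sup>* \<or> (y, x) \<in> E\<^sup>*"
proof -
  have "single_valued (E\<inverse>)" using rooted_tree_unique[OF assms(1)] by (auto simp: single_valued_def)
  from single_valued_confluent[OF this, of v x y] assms(2,3)
  show ?thesis by (auto simp: rtrancl_converse)
qed

lemma rooted_tree_siblings:
  assumes "rooted_tree V E r" "(x, y) \<in> E" "(x, y') \<in> E" "(y, v) \<in> E\<^sup>*" "(y', v) \<in> E\<^sup>*"
  shows "y = y'"
proof -
  have *: "y = y'" if "(x, y) \<in> E" "(x, y') \<in> E" "(y, y') \<in> E\<^sup>*" for y y'
  proof (rule ccontr)
    assume "y \<noteq> y'"
    with that(3) obtain z where "(y, z) \<in> E\<^sup>*" "(z, y') \<in> E" by (metis rtranclE)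
    then have "(y, x) \<in> E\<^sup>*" using rooted_tree_unique[OF assms(1) that(2)] by metis
    with rooted_tree_no_back[OF assms(1) that(1)] show False by blast
  qed
  from rooted_tree_comparable[OF assms(1,4,5)] show ?thesis using * assms(2,3) by metis
qed

lemma rooted_tree_verts:
  assumes "rooted_tree V E r" "x \<in> V" "(x, y) \<in> E\<^sup>*"
  shows "y \<in> V"
  using assms(3,1,2) by induction (auto simp: rooted_tree_def)

section \<open>Representations under local changes of a state\<close>

lemma rep_frame:
  assumes "rep s x T"
    "\<And>y. (x, y) \<in> (edges s)\<^sup>* \<Longrightarrow> mark s' y = mark s y \<and> children s' y = children s y \<and>
      (\<forall>z \<in> children s y. elabel s' (y, z) = elabel s (y, z))"
  shows "rep s' x T"
  using assms
proof induction
  case (repI m v g e)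
  have v: "mark s' v = mark s v" "children s' v = children s v" "\<forall>z \<in> children s v. elabel s' (v, z) = elabel s (v, z)"
    using repI.prems[of v] by auto
  have "rep s' v (Node e m (image_mset g (mset_set (children s' v))))"
  proof (rule rep.repI)
    fix w assume "w \<in> children s' v"
    then have w: "w \<in> children s v" using v(2) by blast
    have "rep s' w (g w)"
    proof (rule conjunct1[OF repI.IH[OF w], THEN conjunct2, rule_format])
      fix y assume "(w, y) \<in> (edges s)\<^sup>*"
      with w have "(v, y) \<in> (edges s)\<^sup>*" by (auto intro: converse_rtrancl_into_rtrancl)
      then show "mark s' y = mark s y \<and> children s' y = children s y \<and>
        (\<forall>z \<in> children s y. elabel s' (y, z) = elabel s (y, z))" by (rule repI.prems)
    qed
    with repI.IH[OF w] v w show "rep s' w (g w) \<and> count (elab (g w)) = elabel s' (v, w)" by simp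
  qed (use v repI in auto)
  then show ?case unfolding v(2) .
qed

text \<open>The change is confined to the subtree of \<open>a\<close>. Quantifying over
  \<open>verts s\<close> exempts a newly created vertex, which is not below \<open>a\<close> in
  \<open>s\<close>.\<close>

definition local_change :: "('v, 'p) state \<Rightarrow> ('v, 'p) state \<Rightarrow> 'v \<Rightarrow> bool" where
  "local_change s s' a \<longleftrightarrow> (\<forall>y \<in> verts s. (a, y) \<notin> (edges s)\<^sup>* \<longrightarrow>
     mark s' y = mark s y \<and> children s' y = children s y \<and> (\<forall>z \<in> children s y. elabel s' (y, z) = elabel s (y, z)))"

text \<open>One level of the way from the changed vertex \<open>a\<close> up to the root: the child
  \<open>x\<^sub>1\<close> on this path gets a new tree, while its siblings keep theirs because
  sibling subtrees are disjoint.\<close>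

lemma rep_lift:
  assumes rt: "rooted_tree (verts s) (edges s) r" and x: "x \<in> verts s" "(x, x\<^sub>1) \<in> edges s"
    and a: "(x\<^sub>1, a) \<in> (edges s)\<^sup>*" and loc: "local_change s s' a"
    and m: "count m = mark s x" and fin: "finite (children s x)"
    and g: "\<And>w. w \<in> children s x \<Longrightarrow> rep s w (g w) \<and> count (elab (g w)) = elabel s (x, w)"
    and c: "rep s' x\<^sub>1 c" "elab c = elab (g x\<^sub>1)"
  shows "rep s' x (Node e m (add_mset c (image_mset g (mset_set (children s x - {x\<^sub>1})))))"
proof -
  have "(a, x) \<notin> (edges s)\<^sup>*" using rooted_tree_no_back[OF rt x(2) a] .
  then have x': "mark s' x = mark s x" "children s' x = children s x" "\<forall>z \<in> children s x. elabel s' (x, z) = elabel s (x, z)"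
    using loc x(1) unfolding local_change_def by blast+
  have sib: "rep s' w (g w)" if w: "w \<in> children s x" "w \<noteq> x\<^sub>1" for w
  proof (rule rep_frame)
    show "rep s w (g w)" using g w by blast
    fix y assume y: "(w, y) \<in> (edges s)\<^sup>*"
    have "(a, y) \<notin> (edges s)\<^sup>*"
    proof
      assume "(a, y) \<in> (edges s)\<^sup>*"
      with a have "(x\<^sub>1, y) \<in> (edges s)\<^sup>*" by simp
      with rooted_tree_siblings[OF rt x(2) _ this y] w show False by simp
    qed
    moreover have "w \<in> verts s" using rt w(1) by (auto simp: rooted_tree_def)
    then have "y \<in> verts s" using rooted_tree_verts[OF rt _ y] by blast
    ultimately show "mark s' y = mark s y \<and> children s' y = children s y \<and>
      (\<forall>z \<in> children s y. elabel s' (y, z) = elabel s (y, z))"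
      using loc unfolding local_change_def by blast
  qed
  let ?g = "g(x\<^sub>1 := c)"
  have "rep s' x (Node e m (image_mset ?g (mset_set (children s' x))))"
  proof (rule repI)
    fix w assume "w \<in> children s' x"
    then have w: "w \<in> children s x" using x'(2) by blast
    then show "rep s' w (?g w) \<and> count (elab (?g w)) = elabel s' (x, w)"
      using sib[OF w] g[OF w] c x'(3) by auto
  qed (use m fin x' in auto)
  moreover have "image_mset ?g (mset_set (children s' x)) =
      add_mset c (image_mset g (mset_set (children s x - {x\<^sub>1})))"
  proof -
    have "mset_set (children s x) = add_mset x\<^sub>1 (mset_set (children s x - {x\<^sub>1}))"
      using fin x(2) by (simp add: mset_set.remove)
    moreover have "image_mset ?g (mset_set (children s x - {x\<^sub>1})) = image_mset g (mset_set (children s x - {x\<^sub>1}))"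
      using fin by (intro image_mset_cong) auto
    ultimately show ?thesis unfolding x'(2) by simp
  qed
  ultimately show ?thesis by simp
qed

lemma rep_below:
  assumes "rep s v (Node e m cs)"
  obtains g where "count m = mark s v" "finite (children s v)" "cs = image_mset g (mset_set (children s v))"
    "\<And>w. w \<in> children s v \<Longrightarrow> rep s w (g w) \<and> count (elab (g w)) = elabel s (v, w)"
  using assms by cases blast

lemma rep_mark:
  assumes rt: "rooted_tree (verts s) (edges s) r"
    and "rep s v (Node e m cs)" "count m' = k" "s' = s\<lparr>mark := (mark s)(v := k)\<rparr>"
  shows "rep s' v (Node e m' cs)"
proof -
  obtain g where g: "count m = mark s v" "finite (children s v)" "cs = image_mset g (mset_set (children s v))"
    "\<And>w. w \<in> children s v \<Longrightarrow> rep s w (g w) \<and> count (elab (g w)) = elabel s (v, w)"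
    using rep_below[OF assms(2)] by blast
  have "rep s' v (Node e m' (image_mset g (mset_set (children s' v))))"
  proof (rule repI)
    fix w assume "w \<in> children s' v"
    then have w: "w \<in> children s v" using assms(4) by simp
    have "rep s' w (g w)"
    proof (rule rep_frame)
      show "rep s w (g w)" using g(4) w by blast
      fix y assume "(w, y) \<in> (edges s)\<^sup>*"
      then have "y \<noteq> v" using rooted_tree_no_back[OF rt, of v w y] w by auto
      then show "mark s' y = mark s y \<and> children s' y = children s y \<and>
        (\<forall>z \<in> children s y. elabel s' (y, z) = elabel s (y, z))" using assms(4) by simp
    qed
    then show "rep s' w (g w) \<and> count (elab (g w)) = elabel s' (v, w)" using g(4)[OF w] assms(4) by simp
  qed (use g assms in auto)
  then show ?thesis using g(3) assms(4) by simp
qed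

lemma rep_new:
  assumes rt: "rooted_tree (verts s) (edges s) r" and v: "v \<in> verts s"
    and "rep s v (Node e m cs)" "count m' = k" "count q = k\<^sub>1" "count b = k\<^sub>2" "w \<notin> verts s"
    and s': "s' = \<lparr>verts = insert w (verts s), edges = insert (v, w) (edges s),
        mark = (mark s)(v := k, w := k\<^sub>2), elabel = (elabel s)((v, w) := k\<^sub>1)\<rparr>"
  shows "rep s' v (Node e m' (add_mset (Node q b {#}) cs))"
proof -
  obtain g where g: "count m = mark s v" "finite (children s v)" "cs = image_mset g (mset_set (children s v))"
    "\<And>w. w \<in> children s v \<Longrightarrow> rep s w (g w) \<and> count (elab (g w)) = elabel s (v, w)"
    using rep_below[OF assms(3)] by blast
  have E: "edges s \<subseteq> verts s \<times> verts s" using rt by (simp add: rooted_tree_def)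
  have w: "children s' w = {}" "w \<noteq> v" "w \<notin> children s v" "children s' v = insert w (children s v)"
    using E assms(7) v s' by auto
  let ?g = "g(w := Node q b {#})"
  \<comment> \<open>The new vertex is a leaf, so \<open>undefined\<close> is applied to no
    child.\<close>
  have "rep s' w (Node q b (image_mset (\<lambda>_. undefined) (mset_set (children s' w))))"
    by (rule repI) (use w s' assms(6) in auto)
  then have rw: "rep s' w (Node q b {#})" unfolding w(1) by simp
  have "rep s' v (Node e m' (image_mset ?g (mset_set (children s' v))))"
  proof (rule repI)
    fix x assume x: "x \<in> children s' v"
    show "rep s' x (?g x) \<and> count (elab (?g x)) = elabel s' (v, x)"
    proof (cases "x = w")
      case True
      then show ?thesis using rw s' assms(5) by simp
    next
      case False
      then have x: "x \<in> children s v" using x w(4) by blast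
      have "rep s' x (g x)"
      proof (rule rep_frame)
        show "rep s x (g x)" using g(4) x by blast
        fix y assume y: "(x, y) \<in> (edges s)\<^sup>*"
        then have "y \<noteq> v" using rooted_tree_no_back[OF rt, of v x y] x by auto
        moreover have "y \<in> verts s" using rooted_tree_verts[OF rt _ y] E x by auto
        moreover then have "y \<noteq> w" using assms(7) by blast
        ultimately show "mark s' y = mark s y \<and> children s' y = children s y \<and>
          (\<forall>z \<in> children s y. elabel s' (y, z) = elabel s (y, z))" using s' by auto
      qed
      then show ?thesis using False g(4)[OF x] s' by simp
    qed
  qed (use g w s' assms in auto)
  moreover have "image_mset ?g (mset_set (children s' v)) = add_mset (Node q b {#}) cs"
    unfolding w(4) g(3) using w(3) g(2) by (auto intro!: image_mset_cong)
  ultimately show ?thesis by simp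
qed

definition prune :: "('v, 'p) state \<Rightarrow> 'v \<Rightarrow> 'v \<Rightarrow> ('v, 'p) state" where
  "prune s u v = \<lparr>verts = verts s - subtree s v,
        edges = edges s \<inter> ((- subtree s v) \<times> (- subtree s v)),
        mark = (mark s)(u := (\<lambda>p. mark s u p + elabel s (u, v) p)),
        elabel = elabel s\<rparr>"

text \<open>By uniqueness of parents, \<open>(u, v)\<close> is the only edge that enters the deleted
  subtree from outside.\<close>

lemma children_prune:
  assumes rt: "rooted_tree (verts s) (edges s) r" and uv: "(u, v) \<in> edges s" and "(v, y) \<notin> (edges s)\<^sup>*"
  shows "children (prune s u v) y = children s y - (if y = u then {v} else {})"
proof -
  have *: "(v, z) \<in> (edges s)\<^sup>* \<longleftrightarrow> z = v" if "(y, z) \<in> edges s" for z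
  proof
    assume "(v, z) \<in> (edges s)\<^sup>*"
    show "z = v"
    proof (rule ccontr)
      assume "z \<noteq> v"
      with \<open>(v, z) \<in> (edges s)\<^sup>*\<close> obtain y' where y': "(v, y') \<in> (edges s)\<^sup>*" "(y', z) \<in> edges s"
        by (metis rtranclE)
      with rooted_tree_unique[OF rt that y'(2)] assms(3) show False by blast
    qed
  qed auto
  have "children (prune s u v) y = {z \<in> children s y. (v, z) \<notin> (edges s)\<^sup>*}"
    using assms(3) by (simp add: prune_def subtree_def)
  also have "\<dots> = children s y - {v}" using * by blast
  also have "\<dots> = children s y - (if y = u then {v} else {})"
    using rooted_tree_unique[OF rt _ uv] by auto
  finally show ?thesis .
qed

lemma rep_prune:
  assumes rt: "rooted_tree (verts s) (edges s) r" and uv: "(u, v) \<in> edges s"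
    and m: "count m = mark s u" and fin: "finite (children s u)"
    and g: "\<And>w. w \<in> children s u \<Longrightarrow> rep s w (g w) \<and> count (elab (g w)) = elabel s (u, w)"
  shows "rep (prune s u v) u (Node e (m + elab (g v)) (image_mset g (mset_set (children s u - {v}))))"
proof -
  let ?s = "prune s u v"
  have u: "(v, u) \<notin> (edges s)\<^sup>*" using rooted_tree_no_back[OF rt uv] by blast
  have chu: "children ?s u = children s u - {v}" using children_prune[OF rt uv u] by simp
  have "rep ?s u (Node e (m + elab (g v)) (image_mset g (mset_set (children ?s u))))"
  proof (rule repI)
    fix w assume "w \<in> children ?s u"
    then have w: "w \<in> children s u" "w \<noteq> v" using chu by auto
    have "rep ?s w (g w)"
    proof (rule rep_frame)
      show "rep s w (g w)" using g w by blast
      fix y assume y: "(w, y) \<in> (edges s)\<^sup>*"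
      have "y \<noteq> u" using rooted_tree_no_back[OF rt, of u w y] w y by auto
      moreover have "(v, y) \<notin> (edges s)\<^sup>*" using rooted_tree_siblings[OF rt uv _ _ y] w by blast
      ultimately show "mark ?s y = mark s y \<and> children ?s y = children s y \<and>
        (\<forall>z \<in> children s y. elabel ?s (y, z) = elabel s (y, z))"
        using children_prune[OF rt uv, of y] by (simp add: prune_def)
    qed
    then show "rep ?s w (g w) \<and> count (elab (g w)) = elabel ?s (u, w)"
      using g[OF w(1)] by (simp add: prune_def)
  next
    show "count (m + elab (g v)) = mark ?s u"
      using m g[of v] uv by (auto simp: prune_def)
    show "finite (children ?s u)" using chu fin by simp
  qed
  then show ?thesis unfolding chu .
qed

lemma local_change_prune:
  assumes rt: "rooted_tree (verts s) (edges s) r" and uv: "(u, v) \<in> edges s"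
  shows "local_change s (prune s u v) u"
  unfolding local_change_def
proof (intro ballI impI)
  fix y assume y: "(u, y) \<notin> (edges s)\<^sup>*"
  then have "y \<noteq> u" "(v, y) \<notin> (edges s)\<^sup>*" using uv by (auto intro: converse_rtrancl_into_rtrancl)
  then show "mark (prune s u v) y = mark s y \<and> children (prune s u v) y = children s y \<and>
    (\<forall>z \<in> children s y. elabel (prune s u v) (y, z) = elabel s (y, z))"
    using children_prune[OF rt uv, of y] by (simp add: prune_def)
qed

text \<open>Ancestors of a surviving vertex survive, so its path from the root stays intact.\<close>

lemma rooted_tree_prune:
  assumes rt: "rooted_tree (verts s) (edges s) r" and uv: "(u, v) \<in> edges s"
  shows "rooted_tree (verts (prune s u v)) (edges (prune s u v)) r"
proof -
  let ?E = "edges s" and ?S = "subtree s v"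
  have r: "r \<notin> ?S"
  proof
    assume "r \<in> ?S"
    then have "(v, r) \<in> ?E\<^sup>*" by (simp add: subtree_def)
    then have "v = r" using rt by (metis rooted_tree_def rtranclE)
    with uv rt show False by (auto simp: rooted_tree_def)
  qed
  have up: "y \<notin> ?S" if "(y, z) \<in> ?E" "z \<notin> ?S" for y z
    using that by (auto simp: subtree_def intro: rtrancl_into_rtrancl)
  have reach: "y \<notin> ?S \<Longrightarrow> (r, y) \<in> (?E \<inter> ((- ?S) \<times> (- ?S)))\<^sup>*" if "(r, y) \<in> ?E\<^sup>*" for y
    using that
  proof induction
    case (step y z)
    then have "y \<notin> ?S" using up by blast
    from step.IH[OF this] have "(r, y) \<in> (?E \<inter> ((- ?S) \<times> (- ?S)))\<^sup>*" .
    moreover have "(y, z) \<in> ?E \<inter> ((- ?S) \<times> (- ?S))" using step(2) step.prems \<open>y \<notin> ?S\<close> by simp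
    ultimately show ?case by (rule rtrancl_into_rtrancl)
  qed simp
  show ?thesis
    unfolding rooted_tree_def
  proof (intro conjI allI ballI)
    show "r \<in> verts (prune s u v)" using rt r by (simp add: prune_def rooted_tree_def)
    show "edges (prune s u v) \<subseteq> verts (prune s u v) \<times> verts (prune s u v)"
      using rt by (auto simp: prune_def rooted_tree_def)
    show "(w, r) \<notin> edges (prune s u v)" for w
      using rt by (simp add: prune_def rooted_tree_def)
  next
    fix w assume w: "w \<in> verts (prune s u v) - {r}"
    then have "w \<in> verts s - {r}" by (simp add: prune_def)
    then obtain y where y: "(y, w) \<in> ?E" using rt unfolding rooted_tree_def by blast
    show "\<exists>!y. (y, w) \<in> edges (prune s u v)"
    proof
      show "(y, w) \<in> edges (prune s u v)" using y up[OF y] w by (simp add: prune_def)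
      show "y' = y" if "(y', w) \<in> edges (prune s u v)" for y'
        using rooted_tree_unique[OF rt _ y, of y'] that by (simp add: prune_def)
    qed
  next
    fix w assume "w \<in> verts (prune s u v)"
    then show "(r, w) \<in> (edges (prune s u v))\<^sup>*"
      using reach[of w] rt by (simp add: prune_def rooted_tree_def)
  qed
qed

lemma rooted_tree_new:
  assumes rt: "rooted_tree V E r" and "v \<in> V" "w \<notin> V"
  shows "rooted_tree (insert w V) (insert (v, w) E) r"
  unfolding rooted_tree_def
proof (intro conjI allI ballI)
  show "r \<in> insert w V" "insert (v, w) E \<subseteq> insert w V \<times> insert w V" "(u, r) \<notin> insert (v, w) E" for u
    using assms by (auto simp: rooted_tree_def)
  fix x
  have *: "(r, x) \<in> (insert (v, w) E)\<^sup>*" if "x \<in> V" for x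
    using rt that by (auto simp: rooted_tree_def intro: rtrancl_mono[THEN subsetD, rotated])
  show "(r, x) \<in> (insert (v, w) E)\<^sup>*" if "x \<in> insert w V"
  proof (cases "x = w")
    case True
    with *[OF assms(2)] show ?thesis by (auto intro: rtrancl_into_rtrancl)
  qed (use that * in auto)
  show "\<exists>!u. (u, x) \<in> insert (v, w) E" if "x \<in> insert w V - {r}"
  proof (cases "x = w")
    case True
    then show ?thesis using rt assms(3) by (auto simp: rooted_tree_def)
  next
    case False
    with that have "x \<in> V - {r}" by auto
    then have "\<exists>!u. (u, x) \<in> E" using rt by (simp add: rooted_tree_def)
    with False show ?thesis by simp
  qed
qed

lemma rep_exists:
  assumes rt: "rooted_tree (verts s) (edges s) r" and fin: "finite (verts s)"
    and m: "\<And>v. v \<in> verts s \<Longrightarrow> \<exists>m. count m = mark s v"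
    and e: "\<And>x. x \<in> edges s \<Longrightarrow> \<exists>m. count m = elabel s x"
  shows "v \<in> verts s \<Longrightarrow> \<exists>T. rep s v T \<and> elab T = e"
proof -
  have E: "edges s \<subseteq> verts s \<times> verts s" using rt by (simp add: rooted_tree_def)
  then have finE: "finite (edges s)" using fin by (meson finite_SigmaI finite_subset)
  have "wf ((edges s)\<inverse>)"
    using finite_acyclic_wf_converse[OF finE rooted_tree_acyclic[OF rt]] .
  then show "v \<in> verts s \<Longrightarrow> \<exists>T. rep s v T \<and> elab T = e"
  proof (induction v arbitrary: e)
    case (less v)
    have "\<exists>T. rep s w T \<and> count (elab T) = elabel s (v, w)" if "w \<in> children s v" for w
    proof -
      obtain m where "count m = elabel s (v, w)" using e \<open>w \<in> children s v\<close> by blast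
      moreover have "w \<in> verts s" using that E by auto
      ultimately show ?thesis using less.IH[of w m] that by auto
    qed
    then obtain g where g: "\<And>w. w \<in> children s v \<Longrightarrow> rep s w (g w) \<and> count (elab (g w)) = elabel s (v, w)"
      by metis
    obtain k where "count k = mark s v" using m less.prems by blast
    moreover have "finite (children s v)" using E fin by (auto intro: finite_subset[of _ "verts s"])
    ultimately have "rep s v (Node e k (image_mset g (mset_set (children s v))))" using g by (intro repI)
    then show ?case by (metis tree.sel(1))
  qed
qed

section \<open>Nets as sets of rules, firing as a step of trees\<close>

definition rule_of :: "('p, 't, 'a) labelled_rpn \<Rightarrow> 't \<Rightarrow> ('p, 'a) rule" where
  "rule_of N t =
     (if t \<in> elem_trans N then El (Abs_multiset (pre N t)) (Abs_multiset (post N t)) (label N t)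
      else if t \<in> abs_trans N
      then Ab (Abs_multiset (pre N t)) (Abs_multiset (post N t)) (Abs_multiset (start N t)) (label N t)
      else Ct (Abs_multiset (pre N t)) (label N t))"

definition rules_of :: "('p, 't, 'a) labelled_rpn \<Rightarrow> ('p, 'a) rule set" where
  "rules_of N = rule_of N ` transitions N"

definition represents :: "('v, 'p) state \<Rightarrow> 'p tree option \<Rightarrow> bool" where
  "represents s X \<longleftrightarrow> finite (verts s) \<and> (case X of None \<Rightarrow> verts s = {} \<and> edges s = {}
     | Some T \<Rightarrow> \<exists>r. rooted_tree (verts s) (edges s) r \<and> rep s r T)"

lemma count_Abs_marking_on:
  assumes "finite P" "marking_on P f"
  shows "count (Abs_multiset f) = f"
proof (rule count_Abs_multiset)
  have "x \<in> P" if "0 < f x" for x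
    using that assms(2) by (cases "x \<in> P") (auto simp: marking_on_def)
  then show "finite {x. 0 < f x}" using assms(1) by (auto intro: finite_subset[of _ P])
qed

locale net =
  fixes N :: "('p, 't, 'a) labelled_rpn"
  assumes N: "is_labelled_rpn N"
begin

abbreviation "R \<equiv> rules_of N"

lemma finite_R: "finite R"
  using N by (simp add: rules_of_def is_labelled_rpn_def is_rpn_def)

lemma finite_places: "finite (places N)"
  using N by (simp add: is_labelled_rpn_def is_rpn_def)

lemma count_pre: "t \<in> transitions N \<Longrightarrow> count (Abs_multiset (pre N t)) = pre N t"
  and count_post: "t \<in> elem_trans N \<union> abs_trans N \<Longrightarrow> count (Abs_multiset (post N t)) = post N t"
  and count_start: "t \<in> abs_trans N \<Longrightarrow> count (Abs_multiset (start N t)) = start N t"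
  using N count_Abs_marking_on[OF finite_places] by (auto simp: is_labelled_rpn_def is_rpn_def)

lemma rule_of_in: "t \<in> transitions N \<Longrightarrow> rule_of N t \<in> R"
  by (simp add: rules_of_def)

lemma rule_of_El:
  assumes "t \<in> elem_trans N"
  shows "El (Abs_multiset (pre N t)) (Abs_multiset (post N t)) (label N t) \<in> R"
  using rule_of_in[of t] assms by (simp add: rule_of_def transitions_def)

lemma rule_of_Ab:
  assumes "t \<in> abs_trans N"
  shows "Ab (Abs_multiset (pre N t)) (Abs_multiset (post N t)) (Abs_multiset (start N t)) (label N t) \<in> R"
proof -
  have "t \<notin> elem_trans N" using N assms unfolding is_labelled_rpn_def is_rpn_def by blast
  with rule_of_in[of t] assms show ?thesis by (simp add: rule_of_def transitions_def)
qed

lemma rule_of_Ct: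
  assumes "t \<in> cut_trans N"
  shows "Ct (Abs_multiset (pre N t)) (label N t) \<in> R"
proof -
  have "t \<notin> elem_trans N" "t \<notin> abs_trans N"
    using N assms unfolding is_labelled_rpn_def is_rpn_def by blast+
  with rule_of_in[of t] assms show ?thesis by (simp add: rule_of_def transitions_def)
qed

lemma El_ruleD:
  assumes "El p q l \<in> R"
  obtains t where "t \<in> elem_trans N" "count p = pre N t" "count q = post N t" "label N t = l"
proof -
  obtain t where t: "t \<in> transitions N" "rule_of N t = El p q l" using assms by (auto simp: rules_of_def)
  then have "t \<in> elem_trans N" by (auto simp: rule_of_def split: if_splits)
  with t count_pre[of t] count_post[of t] show ?thesis by (intro that[of t]) (auto simp: rule_of_def)
qed

lemma Ab_ruleD:
  assumes "Ab p q b l \<in> R"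
  obtains t where "t \<in> abs_trans N" "count p = pre N t" "count q = post N t" "count b = start N t"
    "label N t = l"
proof -
  obtain t where t: "t \<in> transitions N" "rule_of N t = Ab p q b l" using assms by (auto simp: rules_of_def)
  then have "t \<in> abs_trans N" "t \<notin> elem_trans N" by (auto simp: rule_of_def split: if_splits)
  with t count_pre[of t] count_post[of t] count_start[of t] show ?thesis
    by (intro that[of t]) (auto simp: rule_of_def)
qed

lemma Ct_ruleD:
  assumes "Ct p l \<in> R"
  obtains t where "t \<in> cut_trans N" "count p = pre N t" "label N t = l"
proof -
  obtain t where t: "t \<in> transitions N" "rule_of N t = Ct p l" using assms by (auto simp: rules_of_def)
  then have "t \<in> cut_trans N" "t \<notin> elem_trans N" "t \<notin> abs_trans N"
    by (auto simp: rule_of_def transitions_def split: if_splits)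
  with t count_pre[of t] show ?thesis by (intro that[of t]) (auto simp: rule_of_def)
qed

lemma pre_split:
  assumes "t \<in> transitions N" "pre N t \<le> count m"
  shows "m = Abs_multiset (pre N t) + (m - Abs_multiset (pre N t))"
    "count (m - Abs_multiset (pre N t)) = (\<lambda>p. count m p - pre N t p)"
  using assms by (auto simp: count_pre le_fun_def fun_eq_iff multiset_eq_iff)

lemma local_change_mark: "local_change s (s\<lparr>mark := (mark s)(v := k)\<rparr>) v"
  by (auto simp: local_change_def)

lemma local_change_new:
  assumes "rooted_tree (verts s) (edges s) r" "w \<notin> verts s"
  shows "local_change s \<lparr>verts = insert w (verts s), edges = insert (v, w) (edges s),
        mark = (mark s)(v := k, w := k\<^sub>2), elabel = (elabel s)((v, w) := k\<^sub>1)\<rparr> v"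
  using assms by (auto simp: local_change_def)

text \<open>A firing acts at one vertex \<open>a\<close>: the firing vertex itself, or its parent
  when a child is cut. Only the cut of the root needs a case of its own.\<close>

lemma fire_local:
  assumes f: "fire N U s (v, t) s'" and rt: "rooted_tree (verts s) (edges s) r"
    and U: "verts s \<subseteq> U" and fin: "finite (verts s)"
  shows "is_root s v \<and> t \<in> cut_trans N \<and> pre N t \<le> mark s v \<and> s' = empty_state \<or>
    (\<exists>a. a \<in> verts s \<and> local_change s s' a \<and> rooted_tree (verts s') (edges s') r \<and> finite (verts s') \<and>
      (\<forall>T. rep s a T \<longrightarrow> (\<exists>T'. step R T (label N t) (Some T') \<and> rep s' a T')))"
  using f
proof cases
  case elementary
  have "\<exists>T'. step R T (label N t) (Some T') \<and> rep s' v T'" if "rep s v T" for T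
  proof -
    obtain e m cs where T: "T = Node e m cs" by (cases T)
    have m: "count m = mark s v" using that unfolding T by cases
    have t: "t \<in> transitions N" using elementary by (simp add: transitions_def)
    let ?p = "Abs_multiset (pre N t)" and ?q = "Abs_multiset (post N t)"
    have "step R (Node e (?p + (m - ?p)) cs) (label N t) (Some (Node e ((m - ?p) + ?q) cs))"
      using rule_of_El elementary by (blast intro: step_El)
    moreover have "rep s' v (Node e ((m - ?p) + ?q) cs)"
      by (rule rep_mark[OF rt that[unfolded T] _ elementary(1)])
        (use elementary pre_split(2)[OF t, of m] count_post[of t] m in \<open>auto simp: fun_eq_iff\<close>)
    ultimately show ?thesis using pre_split(1)[OF t, of m] elementary m T by auto
  qed
  then show ?thesis
    using elementary rt fin local_change_mark[of s v] by (intro disjI2 exI[of _ v]) auto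
next
  case (abstract w)
  have w: "w \<notin> verts s" using abstract U by blast
  have "\<exists>T'. step R T (label N t) (Some T') \<and> rep s' v T'" if "rep s v T" for T
  proof -
    obtain e m cs where T: "T = Node e m cs" by (cases T)
    have m: "count m = mark s v" using that unfolding T by cases
    have t: "t \<in> transitions N" using abstract by (simp add: transitions_def)
    let ?p = "Abs_multiset (pre N t)"
    let ?c = "Node (Abs_multiset (post N t)) (Abs_multiset (start N t)) {#}"
    have "step R (Node e (?p + (m - ?p)) cs) (label N t) (Some (Node e (m - ?p) (add_mset ?c cs)))"
      using rule_of_Ab abstract by (blast intro: step_Ab)
    moreover have "rep s' v (Node e (m - ?p) (add_mset ?c cs))"
      by (rule rep_new[OF rt abstract(2) that[unfolded T] _ _ _ w abstract(1)])
        (use abstract pre_split(2)[OF t, of m] count_post[of t] count_start[of t] m in auto)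
    ultimately show ?thesis using pre_split(1)[OF t, of m] abstract m T by auto
  qed
  moreover have "rooted_tree (verts s') (edges s') r"
    using rooted_tree_new[OF rt abstract(2) w] abstract(1) by simp
  moreover have "local_change s s' v" unfolding abstract(1) by (rule local_change_new[OF rt w])
  ultimately show ?thesis
    using abstract fin by (intro disjI2 exI[of _ v]) auto
next
  case cut_root
  then show ?thesis by blast
next
  case (cut_child u)
  have s': "s' = prune s u v" using cut_child(1) by (simp add: prune_def)
  have u: "u \<in> verts s" using cut_child rt by (auto simp: rooted_tree_def)
  have "\<exists>T'. step R T (label N t) (Some T') \<and> rep s' u T'" if sT: "rep s u T" for T
  proof -
    obtain e m cs where T: "T = Node e m cs" by (cases T)
    obtain g where g: "count m = mark s u" "finite (children s u)" "cs = image_mset g (mset_set (children s u))"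
      "\<And>w. w \<in> children s u \<Longrightarrow> rep s w (g w) \<and> count (elab (g w)) = elabel s (u, w)"
      using rep_below[OF sT[unfolded T]] by blast
    have v: "rep s v (g v)" using g(4) cut_child by simp
    obtain e' m' cs' where gv: "g v = Node e' m' cs'" by (cases "g v")
    have m': "count m' = mark s v" using v unfolding gv by cases
    have t: "t \<in> transitions N" using cut_child by (simp add: transitions_def)
    have "step R (g v) (label N t) None"
      unfolding gv using step_Ct[OF rule_of_Ct[OF cut_child(4)], of e' "m' - Abs_multiset (pre N t)" cs']
        pre_split(1)[OF t, of m'] cut_child(5) m' by simp
    from step_return[OF this, of e m "image_mset g (mset_set (children s u - {v}))"]
    have "step R T (label N t) (Some (Node e (m + elab (g v)) (image_mset g (mset_set (children s u - {v})))))"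
      unfolding T g(3) using g(2) cut_child(3) by (simp add: mset_set.remove)
    moreover have "rep s' u (Node e (m + elab (g v)) (image_mset g (mset_set (children s u - {v}))))"
      unfolding s' using rep_prune[OF rt cut_child(3) g(1,2,4)] .
    ultimately show ?thesis by blast
  qed
  then show ?thesis
    using u local_change_prune[OF rt cut_child(3)] rooted_tree_prune[OF rt cut_child(3)] fin
    unfolding s' by (intro disjI2 exI[of _ u]) (auto simp: prune_def)
qed

lemma step_lift:
  assumes rt: "rooted_tree (verts s) (edges s) r" and loc: "local_change s s' a"
    and a: "\<forall>T. rep s a T \<longrightarrow> (\<exists>T'. step R T l (Some T') \<and> rep s' a T')"
    and "(x, a) \<in> (edges s)\<^sup>*" "x \<in> verts s" "rep s x T"
  shows "\<exists>T'. step R T l (Some T') \<and> rep s' x T'"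
  using assms(4-6)
proof (induction arbitrary: T rule: converse_rtrancl_induct)
  case base
  with a show ?case by blast
next
  case (step x x\<^sub>1)
  obtain e m cs where T: "T = Node e m cs" by (cases T)
  obtain g where g: "count m = mark s x" "finite (children s x)" "cs = image_mset g (mset_set (children s x))"
    "\<And>w. w \<in> children s x \<Longrightarrow> rep s w (g w) \<and> count (elab (g w)) = elabel s (x, w)"
    using rep_below[OF step.prems(2)[unfolded T]] by blast
  have "x\<^sub>1 \<in> verts s" using rt step(1) by (auto simp: rooted_tree_def)
  then obtain c where c: "step R (g x\<^sub>1) l (Some c)" "rep s' x\<^sub>1 c"
    using step.IH[of "g x\<^sub>1"] g(4) step(1) by auto
  have "rep s' x (Node e m (add_mset c (image_mset g (mset_set (children s x - {x\<^sub>1})))))"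
    using rep_lift[OF rt step.prems(1) step(1,2) loc g(1,2,4) c(2) step_elab[OF c(1)]] .
  moreover have "step R T l (Some (Node e m (add_mset c (image_mset g (mset_set (children s x - {x\<^sub>1}))))))"
    using step_kid[OF c(1)] g(2) step(1) unfolding T g(3) by (simp add: mset_set.remove)
  ultimately show ?case by blast
qed

lemma fire_step:
  assumes "represents s X" "fire N U s (v, t) s'" "verts s \<subseteq> U"
  shows "\<exists>T X'. X = Some T \<and> step R T (label N t) X' \<and> represents s' X'"
proof (cases X)
  case None
  with assms(1) have "verts s = {}" by (simp add: represents_def)
  with assms(2) show ?thesis by cases (auto simp: is_root_def)
next
  case (Some T)
  then obtain r where r: "rooted_tree (verts s) (edges s) r" "rep s r T" "finite (verts s)"
    using assms(1) by (auto simp: represents_def)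
  from fire_local[OF assms(2) r(1) assms(3) r(3)] show ?thesis
  proof
    assume *: "is_root s v \<and> t \<in> cut_trans N \<and> pre N t \<le> mark s v \<and> s' = empty_state"
    then have "v = r" using r(1) by (auto simp: is_root_def rooted_tree_def)
    obtain e m cs where T: "T = Node e m cs" by (cases T)
    have m: "count m = mark s r" using r(2) unfolding T by cases
    have "t \<in> transitions N" using * by (simp add: transitions_def)
    then have "step R T (label N t) None"
      unfolding T using step_Ct[OF rule_of_Ct, of t e "m - Abs_multiset (pre N t)" cs]
        pre_split(1)[of t m] * m \<open>v = r\<close> by simp
    moreover have "represents s' None" using * by (simp add: represents_def empty_state_def)
    ultimately show ?thesis using Some by blast
  next
    assume "\<exists>a. a \<in> verts s \<and> local_change s s' a \<and> rooted_tree (verts s') (edges s') r \<and> finite (verts s') \<and>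
      (\<forall>T. rep s a T \<longrightarrow> (\<exists>T'. step R T (label N t) (Some T') \<and> rep s' a T'))"
    then obtain a where a: "a \<in> verts s" "local_change s s' a" "rooted_tree (verts s') (edges s') r"
      "finite (verts s')" "\<forall>T. rep s a T \<longrightarrow> (\<exists>T'. step R T (label N t) (Some T') \<and> rep s' a T')" by blast
    have "(r, a) \<in> (edges s)\<^sup>*" "r \<in> verts s" using r(1) a(1) by (auto simp: rooted_tree_def)
    from step_lift[OF r(1) a(2,5) this r(2)] obtain T'
      where T': "step R T (label N t) (Some T')" "rep s' r T'" by blast
    then have "represents s' (Some T')" using a by (auto simp: represents_def)
    with T' Some show ?thesis by blast
  qed
qed

text \<open>For a cut of \<open>x\<close> only the enabled transition is recorded, because the
  resulting state depends on whether \<open>x\<close> is the root or has a parent; the caller picks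
  the firing rule. As \<open>U\<close> is finite, a fresh vertex is available for a new
  child.\<close>

lemma step_fire_local:
  assumes "step R T l X" "rep s x T" "x \<in> verts s" and rt: "rooted_tree (verts s) (edges s) r"
    and U: "verts s \<subseteq> U" "finite U" "infinite (UNIV :: 'v set)"
  shows "case X of None \<Rightarrow> \<exists>t \<in> cut_trans N. label N t = l \<and> pre N t \<le> mark s (x :: 'v)
    | Some T' \<Rightarrow> \<exists>v t s' a. fire N U s (v, t) s' \<and> label N t = l \<and> rep s' x T' \<and>
        local_change s s' a \<and> (x, a) \<in> (edges s)\<^sup>* \<and>
        rooted_tree (verts s') (edges s') r \<and> finite (verts s')"
proof -
  have fin: "finite (verts s)" using U by (auto intro: finite_subset)
  show ?thesis
    using assms(1-3)
  proof (induction arbitrary: x)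
    case (step_El p q l e r' cs)
    obtain t where t: "t \<in> elem_trans N" "count p = pre N t" "count q = post N t" "label N t = l"
      using El_ruleD[OF step_El(1)] .
    have m: "count (p + r') = mark s x" using step_El(2) by cases
    then have le: "pre N t \<le> mark s x" using t(2) by (auto simp: le_fun_def simp flip: m)
    have "count (r' + q) = (\<lambda>p. mark s x p - pre N t p + post N t p)"
      unfolding m[symmetric] using t by (auto simp: fun_eq_iff)
    note rep = rep_mark[OF rt step_El(2) this refl]
    show ?case
      unfolding option.case
      by (intro exI conjI, rule fire.elementary[OF step_El(3) t(1) le], rule t(4), rule rep,
          rule local_change_mark, rule rtrancl_refl) (use rt fin in simp_all)
  next
    case (step_Ab p q b l e r' cs)
    obtain t where t: "t \<in> abs_trans N" "count p = pre N t" "count q = post N t" "count b = start N t"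
      "label N t = l"
      using Ab_ruleD[OF step_Ab(1)] .
    have m: "count (p + r') = mark s x" using step_Ab(2) by cases
    then have le: "pre N t \<le> mark s x" using t(2) by (auto simp: le_fun_def simp flip: m)
    obtain w where w: "w \<notin> U" using U(2,3) ex_new_if_finite by blast
    then have w': "w \<notin> verts s" using U(1) by blast
    have "count r' = (\<lambda>p. mark s x p - pre N t p)"
      unfolding m[symmetric] using t by (auto simp: fun_eq_iff)
    note rep = rep_new[OF rt step_Ab(3,2) this t(3,4) w' refl]
    show ?case
      unfolding option.case
      by (intro exI conjI, rule fire.abstract[OF step_Ab(3) t(1) le w], rule t(5), rule rep,
          rule local_change_new[OF rt w'], rule rtrancl_refl)
        (use rooted_tree_new[OF rt step_Ab(3) w'] fin in simp_all)
  next
    case (step_Ct p l e r' cs)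
    obtain t where t: "t \<in> cut_trans N" "count p = pre N t" "label N t = l"
      using Ct_ruleD[OF step_Ct(1)] .
    have m: "count (p + r') = mark s x" using step_Ct(2) by cases
    then have "pre N t \<le> mark s x" using t(2) by (auto simp: le_fun_def simp flip: m)
    then show ?case using t by auto
  next
    case (step_kid c l c' e m cs)
    obtain g where g: "count m = mark s x" "finite (children s x)" "add_mset c cs = image_mset g (mset_set (children s x))"
      "\<And>w. w \<in> children s x \<Longrightarrow> rep s w (g w) \<and> count (elab (g w)) = elabel s (x, w)"
      using rep_below[OF step_kid.prems(1)] by blast
    have "c \<in># image_mset g (mset_set (children s x))" unfolding g(3)[symmetric] by simp
    then obtain x\<^sub>1 where x1: "(x, x\<^sub>1) \<in> edges s" "c = g x\<^sub>1" using g(2) by auto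
    have cs: "cs = image_mset g (mset_set (children s x - {x\<^sub>1}))"
      using g(2,3) x1 by (simp add: mset_set.remove)
    have "x\<^sub>1 \<in> verts s" using rt x1(1) by (auto simp: rooted_tree_def)
    moreover have "rep s x\<^sub>1 c" using g(4) x1 by simp
    ultimately obtain v t s' a where *: "fire N U s (v, t) s'" "label N t = l" "rep s' x\<^sub>1 c'"
      "local_change s s' a" "(x\<^sub>1, a) \<in> (edges s)\<^sup>*"
      "rooted_tree (verts s') (edges s') r" "finite (verts s')"
      using step_kid.IH[of x\<^sub>1] by auto
    have "rep s' x (Node e m (add_mset c' (image_mset g (mset_set (children s x - {x\<^sub>1})))))"
      using rep_lift[OF rt step_kid.prems(2) x1(1) *(5,4) g(1,2,4) *(3)] step_elab[OF step_kid(1)] x1(2) by simp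
    moreover have "(x, a) \<in> (edges s)\<^sup>*" using x1(1) *(5) by (rule converse_rtrancl_into_rtrancl)
    ultimately show ?case unfolding option.case cs using * by blast
  next
    case (step_return c l e m cs)
    obtain g where g: "count m = mark s x" "finite (children s x)" "add_mset c cs = image_mset g (mset_set (children s x))"
      "\<And>w. w \<in> children s x \<Longrightarrow> rep s w (g w) \<and> count (elab (g w)) = elabel s (x, w)"
      using rep_below[OF step_return.prems(1)] by blast
    have "c \<in># image_mset g (mset_set (children s x))" unfolding g(3)[symmetric] by simp
    then obtain x\<^sub>1 where x1: "(x, x\<^sub>1) \<in> edges s" "c = g x\<^sub>1" using g(2) by auto
    have cs: "cs = image_mset g (mset_set (children s x - {x\<^sub>1}))"
      using g(2,3) x1 by (simp add: mset_set.remove)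
    have v1: "x\<^sub>1 \<in> verts s" using rt x1(1) by (auto simp: rooted_tree_def)
    moreover have "rep s x\<^sub>1 c" using g(4) x1 by simp
    ultimately obtain t where t: "t \<in> cut_trans N" "label N t = l" "pre N t \<le> mark s x\<^sub>1"
      using step_return.IH[of x\<^sub>1] by auto
    have f: "fire N U s (x\<^sub>1, t) (prune s x x\<^sub>1)"
      using fire.cut_child[OF v1 x1(1) t(1,3)] by (simp add: prune_def)
    have rep: "rep (prune s x x\<^sub>1) x (Node e (m + elab c) cs)"
      using rep_prune[OF rt x1(1) g(1,2,4)] cs x1(2) by simp
    show ?case
      unfolding option.case
      by (intro exI conjI, rule f, rule t(2), rule rep, rule local_change_prune[OF rt x1(1)], rule rtrancl_refl,
          rule rooted_tree_prune[OF rt x1(1)]) (use fin in \<open>simp add: prune_def\<close>)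
  qed
qed

lemma step_fire:
  assumes "represents s (Some T)" "step R T l X" "verts s \<subseteq> U" "finite U" "infinite (UNIV :: 'v set)"
  shows "\<exists>v t s'. fire N U (s :: ('v, 'p) state) (v, t) s' \<and> label N t = l \<and> represents s' X"
proof -
  obtain r where r: "rooted_tree (verts s) (edges s) r" "rep s r T" "finite (verts s)"
    using assms(1) by (auto simp: represents_def)
  have rv: "r \<in> verts s" "is_root s r" using r(1) by (auto simp: rooted_tree_def is_root_def)
  note * = step_fire_local[OF assms(2) r(2) rv(1) r(1) assms(3-5)]
  show ?thesis
  proof (cases X)
    case None
    with * obtain t where "t \<in> cut_trans N" "label N t = l" "pre N t \<le> mark s r" by auto
    with fire.cut_root[OF rv(2), of t N U] None show ?thesis
      by (intro exI[of _ r] exI[of _ t] exI[of _ empty_state]) (simp add: represents_def empty_state_def)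
  next
    case (Some T')
    with * obtain v t s' where "fire N U s (v, t) s'" "label N t = l" "rep s' r T'"
      "rooted_tree (verts s') (edges s') r" "finite (verts s')" by auto
    then show ?thesis using Some by (auto simp: represents_def)
  qed
qed

end

section \<open>Runs of nets as runs of trees\<close>

lemma word_of_append: "word_of N (\<sigma> @ \<tau>) = word_of N \<sigma> @ word_of N \<tau>"
  by (simp add: word_of_def List.map_filter_def)

lemma word_of_Cons: "word_of N ((v, t) # \<sigma>) = lab (label N t) @ word_of N \<sigma>"
  by (cases "label N t") (simp_all add: word_of_def List.map_filter_def)

lemma word_of_Nil: "word_of N [] = []"
  by (simp add: word_of_def List.map_filter_def)

context net
begin

lemma run_runs:
  assumes "run N s\<^sub>0 \<sigma> U s" "represents s\<^sub>0 X\<^sub>0"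
  shows "finite U \<and> verts s \<subseteq> U \<and> (\<exists>X. runs R X\<^sub>0 (word_of N \<sigma>) X \<and> represents s X)"
  using assms
proof induction
  case run_Nil
  then show ?case using runs_refl[of R X\<^sub>0] by (auto simp: represents_def word_of_Nil)
next
  case (run_snoc \<sigma> U s vt s')
  obtain v t where vt: "vt = (v, t)" by (cases vt)
  obtain X where X: "runs R X\<^sub>0 (word_of N \<sigma>) X" "represents s X" and U: "finite U" "verts s \<subseteq> U"
    using run_snoc.IH[OF run_snoc.prems] by blast
  obtain T X' where T: "X = Some T" "step R T (label N t) X'" "represents s' X'"
    using fire_step[OF X(2) run_snoc(2)[unfolded vt] U(2)] by blast
  have "runs R X\<^sub>0 (word_of N (\<sigma> @ [vt])) X'"
    using runs_trans[OF X(1)] runs_single[OF T(2)] T(1)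
    by (simp add: vt word_of_append word_of_Cons word_of_Nil)
  moreover have "finite (verts s')" using T(3) by (simp add: represents_def)
  ultimately show ?case using U T(3) by auto
qed

text \<open>Runs of nets grow at the end and runs of trees at the front; the arbitrary prefix
  \<open>\<sigma>\<close> reconciles them in the induction.\<close>

lemma runs_run:
  assumes "runs R X w Y" "run N s\<^sub>0 \<sigma> U s" "represents (s :: ('v, 'p) state) X"
    "finite U" "verts s \<subseteq> U" "infinite (UNIV :: 'v set)"
  shows "\<exists>\<tau> U' s'. run N s\<^sub>0 (\<sigma> @ \<tau>) U' s' \<and> word_of N \<tau> = w \<and> represents s' Y"
  using assms(1-5)
proof (induction arbitrary: \<sigma> U s rule: runs.induct)
  case (runs_refl X)
  then have "run N s\<^sub>0 (\<sigma> @ []) U s \<and> word_of N [] = [] \<and> represents s X" by (simp add: word_of_Nil)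
  then show ?case by blast
next
  case (runs_step T l X w Y)
  obtain v t s' where f: "fire N U s (v, t) s'" "label N t = l" "represents s' X"
    using step_fire[OF runs_step.prems(2) runs_step(1) runs_step.prems(4,3) assms(6)] by blast
  have "run N s\<^sub>0 (\<sigma> @ [(v, t)]) (U \<union> verts s') s'" using run_snoc[OF runs_step.prems(1) f(1)] .
  moreover have "finite (U \<union> verts s')" using runs_step.prems(3) f(3) by (simp add: represents_def)
  ultimately obtain \<tau> U' s'' where "run N s\<^sub>0 ((\<sigma> @ [(v, t)]) @ \<tau>) U' s''" "word_of N \<tau> = w" "represents s'' Y"
    using runs_step.IH f(3) by blast
  then have "run N s\<^sub>0 (\<sigma> @ (v, t) # \<tau>) U' s'' \<and> word_of N ((v, t) # \<tau>) = lab l @ w \<and> represents s'' Y"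
    by (simp add: word_of_Cons f(2))
  then show ?case by blast
qed

text \<open>Transfers any acceptance condition that can be read off representing trees: covering a
  final state, being empty, or being a given single vertex.\<close>

lemma run_language:
  assumes "represents (s\<^sub>0 :: ('v, 'p) state) X\<^sub>0" "infinite (UNIV :: 'v set)"
    "\<And>s X. represents s X \<Longrightarrow> A s \<longleftrightarrow> B X"
  shows "{word_of N \<sigma> | \<sigma> U s. run N s\<^sub>0 \<sigma> U s \<and> A s} = {w. \<exists>X. runs R X\<^sub>0 w X \<and> B X}"
proof (intro equalityI subsetI)
  fix w assume "w \<in> {word_of N \<sigma> | \<sigma> U s. run N s\<^sub>0 \<sigma> U s \<and> A s}"
  then obtain \<sigma> U s where *: "w = word_of N \<sigma>" "run N s\<^sub>0 \<sigma> U s" "A s" by blast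
  then obtain X where "runs R X\<^sub>0 w X" "represents s X" using run_runs[OF *(2) assms(1)] by blast
  then show "w \<in> {w. \<exists>X. runs R X\<^sub>0 w X \<and> B X}" using assms(3) *(3) by blast
next
  fix w assume "w \<in> {w. \<exists>X. runs R X\<^sub>0 w X \<and> B X}"
  then obtain X where X: "runs R X\<^sub>0 w X" "B X" by blast
  have "finite (verts s\<^sub>0)" using assms(1) by (simp add: represents_def)
  from runs_run[OF X(1) run_Nil assms(1) this subset_refl assms(2)]
  obtain \<tau> U' s' where "run N s\<^sub>0 \<tau> U' s'" "word_of N \<tau> = w" "represents s' X" by auto
  then show "w \<in> {word_of N \<sigma> | \<sigma> U s. run N s\<^sub>0 \<sigma> U s \<and> A s}" using assms(3) X(2) by blast
qed

lemma represents_exists: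
  assumes "is_state N s" "\<not> is_empty s"
  shows "\<exists>T. represents s (Some T) \<and> elab T = {#}"
proof -
  obtain r where r: "finite (verts s)" "rooted_tree (verts s) (edges s) r"
    using assms by (auto simp: is_state_def)
  have m: "\<exists>m. count m = mark s v" if "v \<in> verts s" for v
    using assms(1) that count_Abs_marking_on[OF finite_places] by (auto simp: is_state_def)
  have e: "\<exists>m. count m = elabel s x" if "x \<in> edges s" for x
  proof -
    have "elabel s x \<in> post N ` abs_trans N" using assms(1) that by (auto simp: is_state_def)
    then obtain t where "t \<in> abs_trans N" "elabel s x = post N t" by blast
    then show ?thesis using count_post[of t] by auto
  qed
  have "r \<in> verts s" using r(2) by (simp add: rooted_tree_def)
  from rep_exists[OF r(2,1) m e this, of "{#}"] obtain T where "rep s r T" "elab T = {#}" by blast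
  with r show ?thesis by (auto simp: represents_def)
qed

end

section \<open>Covering of states and of trees\<close>

text \<open>\<open>f\<close> pairs each child of a pattern vertex with a child of the image;
  injectivity makes the pairs a matching, and the children outside the range become
  \<open>rest\<close>.\<close>

lemma root_cover_if_state_le:
  assumes "rep s' y T'" "y \<in> verts s'" "edges s' \<subseteq> verts s' \<times> verts s'"
    "inj_on f (verts s')" "\<forall>v \<in> verts s'. mark s' v \<le> mark s (f v)"
    "\<forall>(v, w) \<in> edges s'. (f v, f w) \<in> edges s \<and> elabel s' (v, w) \<le> elabel s (f v, f w)"
    "rep s (f y) T"
  shows "root_cover T' T"
  using assms(1,2,7)
proof (induction arbitrary: T)
  case (repI m' v g' e')
  obtain e m cs where T: "T = Node e m cs" by (cases T)
  obtain g where g: "count m = mark s (f v)" "finite (children s (f v))" "cs = image_mset g (mset_set (children s (f v)))"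
    "\<And>w. w \<in> children s (f v) \<Longrightarrow> rep s w (g w) \<and> count (elab (g w)) = elabel s (f v, w)"
    using rep_below[OF repI.prems(2)[unfolded T]] by blast
  define Z where "Z = image_mset (\<lambda>w. (g' w, g (f w))) (mset_set (children s' v))"
  have chs: "children s' v \<subseteq> verts s'" using assms(3) by blast
  have sub: "f ` children s' v \<subseteq> children s (f v)" using assms(6) by auto
  have inj: "inj_on f (children s' v)" using assms(4) chs by (rule inj_on_subset)
  define rest where "rest = image_mset g (mset_set (children s (f v) - f ` children s' v))"
  have "mset_set (children s (f v)) = mset_set (f ` children s' v \<union> (children s (f v) - f ` children s' v))"
    using sub by (simp add: Un_absorb1)
  also have "\<dots> = mset_set (f ` children s' v) + mset_set (children s (f v) - f ` children s' v)"
    using g(2) repI(2) by (intro mset_set_Union) auto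
  also have "mset_set (f ` children s' v) = image_mset f (mset_set (children s' v))"
    using inj by (rule image_mset_mset_set[symmetric])
  finally have cs: "cs = image_mset snd Z + rest"
    unfolding g(3) Z_def rest_def by (simp add: multiset.map_comp comp_def)
  have Z: "root_cover c d \<and> elab c \<subseteq># elab d" if cd: "(c, d) \<in># Z" for c d
  proof -
    obtain w where w: "w \<in> children s' v" "c = g' w" "d = g (f w)"
      using cd repI(2) by (auto simp: Z_def)
    have fw: "f w \<in> children s (f v)" "elabel s' (v, w) \<le> elabel s (f v, f w)" using w(1) assms(6) by auto
    have "w \<in> verts s'" using w(1) chs by blast
    with repI.IH[OF w(1)] g(4)[OF fw(1)] have "root_cover c d" using w(2,3) by blast
    moreover have "elab c \<subseteq># elab d"
      using repI.IH[OF w(1)] g(4)[OF fw(1)] fw(2) w(2,3) by (simp add: subseteq_mset_def le_fun_def)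
    ultimately show ?thesis by blast
  qed
  have "m' \<subseteq># m" using repI(1) g(1) assms(5) repI.prems(1) by (simp add: subseteq_mset_def le_fun_def)
  from root_coverI[OF Z this] have "root_cover (Node e' m' (image_mset fst Z)) (Node e m (image_mset snd Z + rest))" .
  moreover have "image_mset fst Z = image_mset g' (mset_set (children s' v))"
    by (simp add: Z_def multiset.map_comp comp_def)
  ultimately show ?case using T cs by simp
qed

text \<open>Trees have forgotten the vertices, so equal subtrees are interchangeable; any matching
  \<open>Z\<close> of trees is still realised by an injection of vertices.\<close>

lemma mset_matching:
  assumes "finite K"
  shows "image_mset g (mset_set K) = image_mset fst Z \<Longrightarrow> finite K' \<Longrightarrow>
    image_mset g' (mset_set K') = image_mset snd Z + rest \<Longrightarrow>
    \<exists>h. inj_on h K \<and> h ` K \<subseteq> K' \<and> (\<forall>w \<in> K. (g w, g' (h w)) \<in># Z)"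
  using assms
proof (induction K arbitrary: Z K' rule: finite_induct)
  case empty
  then show ?case by simp
next
  case (insert w K)
  have "image_mset fst Z = add_mset (g w) (image_mset g (mset_set K))" using insert by simp
  then obtain z Z' where Z': "Z = add_mset z Z'" "fst z = g w" "image_mset fst Z' = image_mset g (mset_set K)"
    using msed_map_invR by metis
  have "snd z \<in># image_mset g' (mset_set K')" using insert.prems(3) Z'(1) by simp
  then obtain w' where w': "w' \<in> K'" "g' w' = snd z" using insert.prems(2) by auto
  have "image_mset g' (mset_set (K' - {w'})) = image_mset snd Z' + rest"
    using insert.prems(2,3) w' Z'(1) by (simp add: mset_set.remove)
  then obtain h where h: "inj_on h K" "h ` K \<subseteq> K' - {w'}" "\<forall>w \<in> K. (g w, g' (h w)) \<in># Z'"
    using insert.IH[of Z' "K' - {w'}"] Z'(3) insert.prems(2) by auto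
  have z: "z = (g w, g' w')" using Z'(2) w'(2) by (metis prod.collapse)
  have "inj_on (h(w := w')) (insert w K)"
    using h(1,2) insert(2) by (auto simp: inj_on_def)
  moreover have "h(w := w') ` insert w K \<subseteq> K'" using h(2) w'(1) insert(2) by auto
  moreover have "\<forall>x \<in> insert w K. (g x, g' ((h(w := w')) x)) \<in># Z"
    using h(3) z Z'(1) insert(2) by auto
  ultimately show ?case by (intro exI conjI)
qed

text \<open>Embeddings of the subtrees below the children are glued together, with \<open>y\<close>
  sent to \<open>x\<close>. Disjointness of sibling subtrees makes the map well defined in
  \<open>s'\<close> and injective into \<open>s\<close>.\<close>

lemma root_cover_embedding:
  assumes "root_cover T' T" "rooted_tree (verts s') (edges s') r'" "rooted_tree (verts s) (edges s) r"
    "rep s' y T'" "rep s x T"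
  shows "\<exists>f. f y = x \<and> inj_on f (subtree s' y) \<and> f ` subtree s' y \<subseteq> subtree s x \<and>
    (\<forall>v \<in> subtree s' y. mark s' v \<le> mark s (f v)) \<and>
    (\<forall>(v, w) \<in> edges s'. v \<in> subtree s' y \<longrightarrow>
      (f v, f w) \<in> edges s \<and> elabel s' (v, w) \<le> elabel s (f v, f w))"
  using assms(1,4,5)
proof (induction arbitrary: y x)
  case (root_coverI Z m' m e' e rest)
  obtain g' where g': "count m' = mark s' y" "finite (children s' y)" "image_mset fst Z = image_mset g' (mset_set (children s' y))"
    "\<And>w. w \<in> children s' y \<Longrightarrow> rep s' w (g' w) \<and> count (elab (g' w)) = elabel s' (y, w)"
    using rep_below[OF root_coverI.prems(1)] by blast
  obtain g where g: "count m = mark s x" "finite (children s x)" "image_mset snd Z + rest = image_mset g (mset_set (children s x))"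
    "\<And>w. w \<in> children s x \<Longrightarrow> rep s w (g w) \<and> count (elab (g w)) = elabel s (x, w)"
    using rep_below[OF root_coverI.prems(2)] by blast
  obtain h where h: "inj_on h (children s' y)" "h ` children s' y \<subseteq> children s x" "\<forall>w \<in> children s' y. (g' w, g (h w)) \<in># Z"
    using mset_matching[OF g'(2) g'(3)[symmetric] g(2) g(3)[symmetric]] by blast
  let ?ok = "\<lambda>w f. f w = h w \<and> inj_on f (subtree s' w) \<and> f ` subtree s' w \<subseteq> subtree s (h w) \<and>
    (\<forall>v \<in> subtree s' w. mark s' v \<le> mark s (f v)) \<and>
    (\<forall>(v, z) \<in> edges s'. v \<in> subtree s' w \<longrightarrow>
      (f v, f z) \<in> edges s \<and> elabel s' (v, z) \<le> elabel s (f v, f z))"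
  have "\<exists>f. ?ok w f" if "w \<in> children s' y" for w
  proof -
    have "(g' w, g (h w)) \<in># Z" "h w \<in> children s x" using h that by auto
    with root_coverI.IH[OF this(1)] g'(4)[OF that] g(4) show ?thesis by blast
  qed
  then have "\<forall>w \<in> children s' y. \<exists>f. ?ok w f" by (rule ballI)
  from bchoice[OF this] obtain F where "\<forall>w \<in> children s' y. ?ok w (F w)" by (rule exE)
  note F = bspec[OF this]
  \<comment> \<open>The child of \<open>y\<close> above \<open>z\<close>, unique since sibling
    subtrees are disjoint.\<close>
  define k where "k z = (THE w. w \<in> children s' y \<and> z \<in> subtree s' w)" for z
  define f where "f z = (if z = y then x else F (k z) z)" for z
  have k: "k z = w" if "w \<in> children s' y" "z \<in> subtree s' w" for z w
    unfolding k_def using that rooted_tree_siblings[OF assms(2)]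
    by (intro the_equality) (auto simp: subtree_def)
  have ny: "z \<noteq> y" if "w \<in> children s' y" "z \<in> subtree s' w" for z w
    using rooted_tree_no_back[OF assms(2), of y w z] that by (auto simp: subtree_def)
  have fF: "f z = F w z" if "w \<in> children s' y" "z \<in> subtree s' w" for z w
    using k[OF that] ny[OF that] by (simp add: f_def)
  have sub: "subtree s' y = insert y (\<Union>w \<in> children s' y. subtree s' w)"
    by (auto simp: subtree_def intro: converse_rtrancl_into_rtrancl elim: converse_rtranclE)
  have fsub: "f z \<in> subtree s (h w)" if "w \<in> children s' y" "z \<in> subtree s' w" for z w
    using F[OF that(1)] that fF[OF that] by auto
  have fx: "f z \<noteq> x" if "w \<in> children s' y" "z \<in> subtree s' w" for z w
  proof -
    have "(x, h w) \<in> edges s" using h(2) that by auto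
    with rooted_tree_no_back[OF assms(3) this] fsub[OF that] show ?thesis by (auto simp: subtree_def)
  qed
  have inj: "inj_on f (subtree s' y)"
  proof (rule inj_onI)
    fix a b assume ab: "a \<in> subtree s' y" "b \<in> subtree s' y" "f a = f b"
    have fy: "f y = x" by (simp add: f_def)
    consider "a = y" "b = y" | w where "a = y" "w \<in> children s' y" "b \<in> subtree s' w"
      | w where "b = y" "w \<in> children s' y" "a \<in> subtree s' w"
      | w w' where "w \<in> children s' y" "a \<in> subtree s' w" "w' \<in> children s' y" "b \<in> subtree s' w'"
      using ab(1,2) unfolding sub by blast
    then show "a = b"
    proof cases
      case 1
      then show ?thesis by simp
    next
      case 2
      then show ?thesis using fx[OF 2(2,3)] fy ab(3) by simp
    next
      case 3
      then show ?thesis using fx[OF 3(2,3)] fy ab(3) by simp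
    next
      case 4
      have "(h w, f a) \<in> (edges s)\<^sup>*" "(h w', f a) \<in> (edges s)\<^sup>*"
        using fsub[OF 4(1,2)] fsub[OF 4(3,4)] ab(3) by (simp_all add: subtree_def)
      moreover have "(x, h w) \<in> edges s" "(x, h w') \<in> edges s" using h(2) 4(1,3) by auto
      ultimately have "h w = h w'" using rooted_tree_siblings[OF assms(3)] by blast
      then have "w = w'" using h(1) 4(1,3) by (simp add: inj_on_def)
      then show ?thesis using F[OF 4(1)] 4 ab(3) fF[OF 4(1,2)] fF[OF 4(3,4)] by (simp add: inj_on_def)
    qed
  qed
  have img: "f ` subtree s' y \<subseteq> subtree s x"
  proof
    fix b assume "b \<in> f ` subtree s' y"
    then consider "b = x" | w z where "w \<in> children s' y" "z \<in> subtree s' w" "b = f z"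
      unfolding sub by (auto simp: f_def split: if_splits)
    then show "b \<in> subtree s x"
    proof cases
      case 1
      then show ?thesis by (simp add: subtree_def)
    next
      case 2
      have "(x, h w) \<in> edges s" using h(2) 2(1) by auto
      with fsub[OF 2(1,2)] 2(3) show ?thesis by (auto simp: subtree_def intro: converse_rtrancl_into_rtrancl)
    qed
  qed
  have mk: "mark s' v \<le> mark s (f v)" if "v \<in> subtree s' y" for v
  proof (cases "v = y")
    case True
    then show ?thesis using root_coverI(2) g(1) g'(1) by (simp add: f_def le_fun_def subseteq_mset_def)
  next
    case False
    then obtain w where w: "w \<in> children s' y" "v \<in> subtree s' w" using \<open>v \<in> subtree s' y\<close> sub by blast
    then show ?thesis using F[OF w(1)] fF[OF w] by simp
  qed
  have ed: "(f v, f z) \<in> edges s \<and> elabel s' (v, z) \<le> elabel s (f v, f z)"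
    if vz: "(v, z) \<in> edges s'" "v \<in> subtree s' y" for v z
  proof (cases "v = y")
    case True
    then have z: "z \<in> children s' y" "z \<in> subtree s' z" using vz(1) by (auto simp: subtree_def)
    have fz: "f z = h z" using fF[OF z] F[OF z(1)] by simp
    have "(g' z, g (h z)) \<in># Z" "h z \<in> children s x" using h z(1) by auto
    then show ?thesis
      using root_coverI.IH[of "g' z" "g (h z)"] g'(4)[OF z(1)] g(4)[of "h z"] fz True
      by (simp add: f_def le_fun_def subseteq_mset_def)
  next
    case False
    then obtain w where w: "w \<in> children s' y" "v \<in> subtree s' w" using vz(2) sub by blast
    moreover from this vz(1) have "z \<in> subtree s' w" by (auto simp: subtree_def intro: rtrancl_into_rtrancl)
    ultimately show ?thesis using F[OF w(1)] fF[OF w(1)] vz(1) by auto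
  qed
  have "f y = x" by (simp add: f_def)
  then show ?case using inj img mk ed by (intro exI[of _ f]) auto
qed

lemma cover_rep:
  "cover z T \<Longrightarrow> rep s x T \<Longrightarrow> \<exists>x' T'. (x, x') \<in> (edges s)\<^sup>* \<and> rep s x' T' \<and> root_cover z T'"
proof (induction arbitrary: x rule: cover.induct)
  case (cover_root T)
  then show ?case by blast
next
  case (cover_kid c cs e m)
  obtain g where g: "count m = mark s x" "finite (children s x)" "cs = image_mset g (mset_set (children s x))"
    "\<And>w. w \<in> children s x \<Longrightarrow> rep s w (g w) \<and> count (elab (g w)) = elabel s (x, w)"
    using rep_below[OF cover_kid.prems] by blast
  then obtain w where w: "w \<in> children s x" "c = g w" using cover_kid(2) by auto
  then obtain x' T' where "(w, x') \<in> (edges s)\<^sup>*" "rep s x' T'" "root_cover z T'"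
    using cover_kid.IH g(4) by blast
  with w(1) show ?case by (meson converse_rtrancl_into_rtrancl mem_Collect_eq)
qed

lemma rep_descend:
  assumes "(x, y) \<in> (edges s)\<^sup>*" "rep s x T"
  shows "\<exists>T'. rep s y T' \<and> (\<forall>z. cover z T' \<longrightarrow> cover z T)"
  using assms
proof (induction arbitrary: T rule: converse_rtrancl_induct)
  case base
  then show ?case by blast
next
  case (step x x')
  obtain e m cs where T: "T = Node e m cs" by (cases T)
  obtain g where g: "count m = mark s x" "finite (children s x)" "cs = image_mset g (mset_set (children s x))"
    "\<And>w. w \<in> children s x \<Longrightarrow> rep s w (g w) \<and> count (elab (g w)) = elabel s (x, w)"
    using rep_below[OF step.prems[unfolded T]] by blast
  have x': "rep s x' (g x')" "g x' \<in># cs" using g step(1) by auto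
  from step.IH[OF x'(1)] obtain T' where "rep s y T'" "\<forall>z. cover z T' \<longrightarrow> cover z (g x')" by blast
  with x'(2) show ?case using T cover_kid by blast
qed

lemma state_le_iff_cover:
  assumes "represents s' (Some T')" "represents s X"
  shows "s' \<preceq> s \<longleftrightarrow> (\<exists>T. X = Some T \<and> cover T' T)"
proof -
  obtain r' where r': "rooted_tree (verts s') (edges s') r'" "rep s' r' T'"
    using assms(1) by (auto simp: represents_def)
  have V': "edges s' \<subseteq> verts s' \<times> verts s'" "r' \<in> verts s'" using r'(1) by (auto simp: rooted_tree_def)
  show ?thesis
  proof
    assume "s' \<preceq> s"
    then obtain f where f: "inj_on f (verts s')" "f ` verts s' \<subseteq> verts s"
      "\<forall>v \<in> verts s'. mark s' v \<le> mark s (f v)"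
      "\<forall>(v, w) \<in> edges s'. (f v, f w) \<in> edges s \<and> elabel s' (v, w) \<le> elabel s (f v, f w)"
      using V'(2) by (auto simp: state_le_def is_empty_def)
    have "verts s \<noteq> {}" using f(2) V'(2) by auto
    then obtain T r where T: "X = Some T" "rooted_tree (verts s) (edges s) r" "rep s r T"
      using assms(2) by (auto simp: represents_def split: option.splits)
    have "(r, f r') \<in> (edges s)\<^sup>*" using T(2) f(2) V'(2) by (auto simp: rooted_tree_def)
    from rep_descend[OF this T(3)] obtain T'' where "rep s (f r') T''" "\<forall>z. cover z T'' \<longrightarrow> cover z T" by blast
    with root_cover_if_state_le[OF r'(2) V'(2,1) f(1,3,4)] T(1) show "\<exists>T. X = Some T \<and> cover T' T"
      using cover_root by blast
  next
    assume "\<exists>T. X = Some T \<and> cover T' T"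
    then obtain T r where T: "X = Some T" "cover T' T" "rooted_tree (verts s) (edges s) r" "rep s r T"
      using assms(2) by (auto simp: represents_def)
    obtain x T'' where x: "(r, x) \<in> (edges s)\<^sup>*" "rep s x T''" "root_cover T' T''"
      using cover_rep[OF T(2,4)] by blast
    obtain f where f: "inj_on f (subtree s' r')" "f ` subtree s' r' \<subseteq> subtree s x"
      "\<forall>v \<in> subtree s' r'. mark s' v \<le> mark s (f v)"
      "\<forall>(v, w) \<in> edges s'. v \<in> subtree s' r' \<longrightarrow>
        (f v, f w) \<in> edges s \<and> elabel s' (v, w) \<le> elabel s (f v, f w)"
      using root_cover_embedding[OF x(3) r'(1) T(3) r'(2) x(2)] by blast
    have S: "subtree s' r' = verts s'"
      using rooted_tree_verts[OF r'(1) V'(2)] r'(1) by (auto simp: subtree_def rooted_tree_def)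
    have "subtree s x \<subseteq> verts s"
    proof
      fix z assume "z \<in> subtree s x"
      with x(1) have "(r, z) \<in> (edges s)\<^sup>*" by (simp add: subtree_def)
      moreover have "r \<in> verts s" using T(3) by (simp add: rooted_tree_def)
      ultimately show "z \<in> verts s" using rooted_tree_verts[OF T(3)] by blast
    qed
    then have "f ` verts s' \<subseteq> verts s" using f(2) S by blast
    then show "s' \<preceq> s" unfolding state_le_def using f V'(1) S by (intro disjI2 exI[of _ f]) auto
  qed
qed

context net
begin

lemma coverability_language_is_covering_language:
  assumes "is_state N (s\<^sub>0 :: ('v, 'p) state)" "\<not> is_empty s\<^sub>0" "finite S\<^sub>f" "\<forall>s \<in> S\<^sub>f. is_state N s"
    "infinite (UNIV :: 'v set)"
  shows "\<exists>T flag F. finite F \<and> (\<forall>x \<in> F. elab x = {#}) \<and>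
    coverability_language N s\<^sub>0 S\<^sub>f = covering_language R T flag F"
proof -
  obtain T\<^sub>0 where T0: "represents s\<^sub>0 (Some T\<^sub>0)" using represents_exists[OF assms(1,2)] by blast
  let ?S = "{s \<in> S\<^sub>f. \<not> is_empty s}"
  have "\<forall>s \<in> ?S. \<exists>T. represents s (Some T) \<and> elab T = {#}" using represents_exists assms(4) by blast
  from bchoice[OF this] obtain t where t: "\<forall>s \<in> ?S. represents s (Some (t s)) \<and> elab (t s) = {#}" by blast
  define flag where "flag \<longleftrightarrow> (\<exists>s \<in> S\<^sub>f. is_empty s)"
  \<comment> \<open>The bare pattern is covered by every tree: it stands for the empty final state
    on nonempty trees, while \<open>flag\<close> handles the empty tree.\<close>
  define F where "F = t ` ?S \<union> (if flag then {Node {#} {#} {#}} else {})"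
  have accepting: "(\<exists>s\<^sub>f \<in> S\<^sub>f. s\<^sub>f \<preceq> s) \<longleftrightarrow> accepting flag F X" if sX: "represents s X" for s :: "('v, 'p) state" and X
  proof -
    have le: "s' \<preceq> s \<longleftrightarrow> (\<exists>T. X = Some T \<and> cover (t s') T)" if "s' \<in> ?S" for s'
      using state_le_iff_cover[OF _ sX] t that by blast
    have emp: "s' \<preceq> s" if "is_empty s'" for s' :: "('v, 'p) state"
      using that by (simp add: state_le_def)
    show ?thesis
    proof (cases flag)
      case True
      have "cover (Node {#} {#} {#}) T" for T :: "'p tree"
        using root_coverI[of "{#}" "{#}" "tok T" "{#}" "elab T" "kids T"] by (intro cover_root) simp
      moreover have "Node {#} {#} {#} \<in> F" using True by (simp add: F_def)
      ultimately have "accepting flag F X" using True by (auto simp: accepting_def split: option.splits)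
      moreover have "\<exists>s\<^sub>f \<in> S\<^sub>f. s\<^sub>f \<preceq> s" using True emp by (auto simp: flag_def)
      ultimately show ?thesis by simp
    next
      case False
      then have "?S = S\<^sub>f" "F = t ` S\<^sub>f" by (auto simp: flag_def F_def)
      then show ?thesis using le False by (auto simp: accepting_def split: option.splits)
    qed
  qed
  have "coverability_language N s\<^sub>0 S\<^sub>f = covering_language R T\<^sub>0 flag F"
    unfolding coverability_language_def covering_language_def
    by (rule run_language[OF T0 assms(5) accepting])
  moreover have "finite F" using assms(3) by (simp add: F_def)
  moreover have "\<forall>x \<in> F. elab x = {#}" using t by (auto simp: F_def)
  ultimately show ?thesis by blast
qed

lemma empty_initial_run:
  assumes "is_empty s\<^sub>0" "run N s\<^sub>0 \<sigma> U s"
  shows "\<sigma> = [] \<and> s = s\<^sub>0"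
  using assms(2)
proof induction
  case (run_snoc \<sigma> U s vt s')
  then have "fire N U s\<^sub>0 vt s'" by simp
  then show ?case using assms(1) by cases (auto simp: is_empty_def is_root_def)
qed simp

lemma state_iso_empty: "is_empty s\<^sub>f \<Longrightarrow> edges s = {} \<Longrightarrow> s \<cong> s\<^sub>f \<longleftrightarrow> is_empty s"
  by (auto simp: state_iso_def is_empty_def bij_betw_def)

text \<open>The empty tree cannot fire, and on it covering and equality up to renaming coincide.
  This case is separate because an emptying language starts from a thread.\<close>

lemma empty_initial_languages:
  assumes "is_empty s\<^sub>0" "\<forall>s \<in> S\<^sub>f. is_state N s" "is_state N s\<^sub>0"
  shows "coverability_language N s\<^sub>0 S\<^sub>f = reachability_language N s\<^sub>0 S\<^sub>f"
    "coverability_language N s\<^sub>0 S\<^sub>f \<subseteq> {[]}"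
proof -
  have "edges s\<^sub>0 = {}" using assms(1,3) by (simp add: is_state_def)
  then have "s\<^sub>f \<preceq> s\<^sub>0 \<longleftrightarrow> s\<^sub>0 \<cong> s\<^sub>f" for s\<^sub>f :: "('b, 'p) state"
  proof (intro iffI)
    assume "s\<^sub>f \<preceq> s\<^sub>0"
    then have "is_empty s\<^sub>f" using assms(1) by (auto simp: state_le_def is_empty_def)
    then show "s\<^sub>0 \<cong> s\<^sub>f" using assms(1) state_iso_empty \<open>edges s\<^sub>0 = {}\<close> by blast
  next
    assume "s\<^sub>0 \<cong> s\<^sub>f"
    then show "s\<^sub>f \<preceq> s\<^sub>0" using assms(1) by (auto simp: state_iso_def state_le_def is_empty_def bij_betw_def)
  qed
  then have "run N s\<^sub>0 \<sigma> U s \<and> (\<exists>s\<^sub>f \<in> S\<^sub>f. s\<^sub>f \<preceq> s) \<longleftrightarrow> run N s\<^sub>0 \<sigma> U s \<and> (\<exists>s\<^sub>f \<in> S\<^sub>f. s \<cong> s\<^sub>f)" for \<sigma> U s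
    using empty_initial_run[OF assms(1), of \<sigma> U s] by auto
  then show "coverability_language N s\<^sub>0 S\<^sub>f = reachability_language N s\<^sub>0 S\<^sub>f"
    unfolding coverability_language_def reachability_language_def by simp
  show "coverability_language N s\<^sub>0 S\<^sub>f \<subseteq> {[]}"
    unfolding coverability_language_def
    using empty_initial_run[OF assms(1)] word_of_Nil[of N] by fastforce
qed

end

section \<open>Renaming places\<close>

text \<open>Injectivity pulls a decomposition of a renamed marking back, which makes renamed steps
  reversible.\<close>

lemma image_mset_split:
  assumes "inj f" "image_mset f p + r = image_mset f m"
  obtains r' where "m = p + r'" "r = image_mset f r'"
proof -
  obtain p' r' where *: "m = p' + r'" "image_mset f p = image_mset f p'" "r = image_mset f r'"
    using image_mset_eq_plusD[OF assms(2)[symmetric]] by auto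
  have "p = p'" using *(2) multiset.inj_map[OF assms(1)] by (simp add: inj_def)
  with * that show ?thesis by blast
qed

primrec rename_rule :: "('p \<Rightarrow> 'q) \<Rightarrow> ('p, 'a) rule \<Rightarrow> ('q, 'a) rule" where
  "rename_rule f (El p q l) = El (image_mset f p) (image_mset f q) l"
| "rename_rule f (Ab p q b l) = Ab (image_mset f p) (image_mset f q) (image_mset f b) l"
| "rename_rule f (Ct p l) = Ct (image_mset f p) l"

lemma step_rename:
  "step R T l X \<Longrightarrow> step (rename_rule f ` R) (map_tree f T) l (map_option (map_tree f) X)"
proof (induction rule: step.induct)
  case (step_El p q l e r cs)
  have "El (image_mset f p) (image_mset f q) l \<in> rename_rule f ` R"
    using imageI[OF step_El, of "rename_rule f"] by simp
  from step.step_El[OF this] show ?case by simp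
next
  case (step_Ab p q b l e r cs)
  have "Ab (image_mset f p) (image_mset f q) (image_mset f b) l \<in> rename_rule f ` R"
    using imageI[OF step_Ab, of "rename_rule f"] by simp
  from step.step_Ab[OF this] show ?case by simp
next
  case (step_Ct p l e r cs)
  have "Ct (image_mset f p) l \<in> rename_rule f ` R"
    using imageI[OF step_Ct, of "rename_rule f"] by simp
  from step.step_Ct[OF this] show ?case by simp
next
  case (step_kid c l c' e m cs)
  then show ?case by (auto intro: step.step_kid)
next
  case (step_return c l e m cs)
  have "elab (map_tree f c) = image_mset f (elab c)" by (cases c) simp
  with step.step_return[OF step_return.IH[simplified], of "image_mset f e" "image_mset f m" "image_mset (map_tree f) cs"]
  show ?case by simp
qed

lemma step_rename_rev:
  assumes "inj f" "step (rename_rule f ` R) T' l X'" "T' = map_tree f T"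
  shows "\<exists>X. step R T l X \<and> X' = map_option (map_tree f) X"
  using assms(2,3)
proof (induction arbitrary: T rule: step.induct)
  case (step_El p' q' l e' r' cs')
  obtain x where "x \<in> R" "El p' q' l = rename_rule f x" using step_El(1) by blast
  then obtain p q where p: "El p q l \<in> R" "p' = image_mset f p" "q' = image_mset f q"
    by (cases x) auto
  obtain e m cs where T: "T = Node e m cs" by (cases T)
  obtain r where r: "m = p + r" "r' = image_mset f r"
    using image_mset_split[OF assms(1), of p r' m] step_El(2) T p(2) by auto
  have "step R T l (Some (Node e (r + q) cs))" unfolding T r(1) by (rule step.step_El[OF p(1)])
  then show ?case using step_El(2) T r p by (intro exI[of _ "Some (Node e (r + q) cs)"]) simp
next
  case (step_Ab p' q' b' l e' r' cs')
  obtain x where "x \<in> R" "Ab p' q' b' l = rename_rule f x" using step_Ab(1) by blast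
  then obtain p q b where p: "Ab p q b l \<in> R" "p' = image_mset f p" "q' = image_mset f q" "b' = image_mset f b"
    by (cases x) auto
  obtain e m cs where T: "T = Node e m cs" by (cases T)
  obtain r where r: "m = p + r" "r' = image_mset f r"
    using image_mset_split[OF assms(1), of p r' m] step_Ab(2) T p(2) by auto
  have "step R T l (Some (Node e r (add_mset (Node q b {#}) cs)))"
    unfolding T r(1) by (rule step.step_Ab[OF p(1)])
  then show ?case using step_Ab(2) T r p by (intro exI[of _ "Some (Node e r (add_mset (Node q b {#}) cs))"]) simp
next
  case (step_Ct p' l e' r' cs')
  obtain x where "x \<in> R" "Ct p' l = rename_rule f x" using step_Ct(1) by blast
  then obtain p where p: "Ct p l \<in> R" "p' = image_mset f p"
    by (cases x) auto
  obtain e m cs where T: "T = Node e m cs" by (cases T)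
  obtain r where r: "m = p + r" "r' = image_mset f r"
    using image_mset_split[OF assms(1), of p r' m] step_Ct(2) T p(2) by auto
  have "step R T l None" unfolding T r(1) by (rule step.step_Ct[OF p(1)])
  then show ?case by (intro exI[of _ None]) simp
next
  case (step_kid c\<^sub>1 l c\<^sub>1' e' m' cs')
  obtain e m cs where T: "T = Node e m cs" by (cases T)
  have "image_mset (map_tree f) cs = add_mset c\<^sub>1 cs'" using step_kid(3) T by simp
  then obtain c cs\<^sub>2 where c: "cs = add_mset c cs\<^sub>2" "map_tree f c = c\<^sub>1" "image_mset (map_tree f) cs\<^sub>2 = cs'"
    using msed_map_invR by metis
  obtain X where "step R c l X" "Some c\<^sub>1' = map_option (map_tree f) X"
    using step_kid.IH[OF c(2)[symmetric]] by blast
  then obtain c' where c': "step R c l (Some c')" "c\<^sub>1' = map_tree f c'" by (cases X) auto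
  have "step R T l (Some (Node e m (add_mset c' cs\<^sub>2)))" unfolding T c(1) by (rule step.step_kid[OF c'(1)])
  then show ?case using step_kid(3) T c(2,3) c'(2) by (intro exI[of _ "Some (Node e m (add_mset c' cs\<^sub>2))"]) simp
next
  case (step_return c\<^sub>1 l e' m' cs')
  obtain e m cs where T: "T = Node e m cs" by (cases T)
  have "image_mset (map_tree f) cs = add_mset c\<^sub>1 cs'" using step_return(3) T by simp
  then obtain c cs\<^sub>2 where c: "cs = add_mset c cs\<^sub>2" "map_tree f c = c\<^sub>1" "image_mset (map_tree f) cs\<^sub>2 = cs'"
    using msed_map_invR by metis
  obtain X where "step R c l X" "None = map_option (map_tree f) X"
    using step_return.IH[OF c(2)[symmetric]] by blast
  then have "step R c l None" by simp
  from step.step_return[OF this] have "step R T l (Some (Node e (m + elab c) cs\<^sub>2))" unfolding T c(1) .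
  moreover have "elab c\<^sub>1 = image_mset f (elab c)" using c(2) by (cases c) auto
  ultimately show ?case using step_return(3) T c(3) by (intro exI[of _ "Some (Node e (m + elab c) cs\<^sub>2)"]) simp
qed

lemma runs_rename:
  assumes "inj f"
  shows "runs (rename_rule f ` R) (map_option (map_tree f) X) w None \<longleftrightarrow> runs R X w None"
proof
  assume "runs (rename_rule f ` R) (map_option (map_tree f) X) w None"
  then show "runs R X w None"
  proof (induction "map_option (map_tree f) X" w "None :: 'b tree option" arbitrary: X rule: runs.induct)
    case runs_refl
    then show ?case by (simp add: runs.runs_refl)
  next
    case (runs_step T' l X' w)
    then obtain T where T: "X = Some T" "T' = map_tree f T" by (cases X) auto
    obtain X'' where "step R T l X''" "X' = map_option (map_tree f) X''"
      using step_rename_rev[OF assms runs_step(1) T(2)] by blast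
    with runs_step T(1) show ?case by (auto intro: runs.runs_step)
  qed
next
  assume "runs R X w None"
  then show "runs (rename_rule f ` R) (map_option (map_tree f) X) w None"
    by (induction X w "None :: 'a tree option" rule: runs.induct)
      (auto intro: runs.intros step_rename)
qed

lemma emptying_language_rename:
  "inj f \<Longrightarrow> emptying_language (rename_rule f ` R) (image_mset f m) = emptying_language R m"
  using runs_rename[of f R "Some (Node {#} m {#})"] by (simp add: emptying_language_def)

instance multiset :: (countable) countable
proof (rule countable_classI)
  fix M M' :: "'a multiset"
  assume "to_nat (SOME xs. mset xs = M) = to_nat (SOME xs. mset xs = M')"
  then have "(SOME xs. mset xs = M) = (SOME xs. mset xs = M')" by simp
  then show "M = M'" by (metis (mono_tags) ex_mset someI_ex)
qed

text \<open>Countability is what allows the places of the guessing net to be renamed to numbers. A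
  code keeps only the multiset of the codes of the children; injectivity on the children, given by
  induction, recovers them.\<close>

primrec tree_code :: "'p :: countable tree \<Rightarrow> nat" where
  "tree_code (Node e m cs) = to_nat (e, m, image_mset tree_code cs)"

instance tree :: (countable) countable
proof (rule countable_classI[of tree_code])
  show "tree_code T = tree_code T' \<Longrightarrow> T = T'" for T T' :: "'a tree"
  proof (induction T arbitrary: T')
    case (Node e m cs)
    obtain e' m' cs' where T': "T' = Node e' m' cs'" by (cases T')
    have eq: "e = e'" "m = m'" "image_mset tree_code cs = image_mset tree_code cs'"
      using Node.prems T' by auto
    have "cs = cs'"
      using Node.IH eq(3) by (intro multiset.inj_map_strong[of cs cs' tree_code tree_code]) auto
    with eq T' show ?case by simp
  qed
qed

instance duty :: (countable) countable
  by countable_datatype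

instance place :: (countable) countable
  by countable_datatype

section \<open>Nets from rules\<close>

text \<open>Transitions are indices in an enumeration of the rules. \<open>Q\<close> adds places
  that the rules may not mention, so that initial and final markings are markings of the
  net.\<close>

lemma rpn_of_rules:
  fixes R :: "(nat, 'a) rule set"
  assumes "finite R" "finite Q"
  shows "\<exists>N :: (nat, nat, 'a) labelled_rpn. is_labelled_rpn N \<and> rules_of N = R \<and> Q \<subseteq> places N"
proof -
  obtain n and g :: "nat \<Rightarrow> (nat, 'a) rule" where g: "R = g ` {i. i < n}"
    using finite_imp_nat_seg_image_inj_on[OF assms(1)] by blast
  define N :: "(nat, nat, 'a) labelled_rpn" where
    "N = \<lparr>places = Q \<union> (\<Union>x \<in> R. rule_places x),
      elem_trans = {i. i < n \<and> is_El (g i)}, abs_trans = {i. i < n \<and> is_Ab (g i)},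
      cut_trans = {i. i < n \<and> is_Ct (g i)},
      pre = (\<lambda>i. count (rpre (g i))), post = (\<lambda>i. count (rpost (g i))),
      start = (\<lambda>i. count (rstart (g i))),
      alphabet = (\<Union>x \<in> R. set_option (rlab x)), label = (\<lambda>i. rlab (g i))\<rparr>"
  have tr: "transitions N = {i. i < n}"
    using rule.exhaust_disc[of "g _"] by (auto simp: N_def transitions_def)
  have mo: "marking_on (places N) (count m)" if "set_mset m \<subseteq> rule_places x" "x \<in> R" for m x
    using that by (auto simp: marking_on_def N_def) (meson count_eq_zero_iff subsetD)
  have pre: "set_mset (rpre x) \<subseteq> rule_places x" for x :: "(nat, 'a) rule" by (cases x) auto
  have post: "set_mset (rpost x) \<subseteq> rule_places x" if "is_El x \<or> is_Ab x" for x :: "(nat, 'a) rule"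
    using that by (cases x) auto
  have start: "set_mset (rstart x) \<subseteq> rule_places x" if "is_Ab x" for x :: "(nat, 'a) rule"
    using that by (cases x) auto
  have in_R: "g i \<in> R" if "i < n" for i using that g by blast
  have "is_rpn N"
    unfolding is_rpn_def
  proof (intro conjI ballI)
    show "finite (places N)" using assms by (simp add: N_def finite_rule_places)
    show "finite (transitions N)" by (simp add: tr)
    show "elem_trans N \<inter> abs_trans N = {}" "elem_trans N \<inter> cut_trans N = {}" "abs_trans N \<inter> cut_trans N = {}"
      by (auto simp: N_def is_El_def is_Ab_def is_Ct_def)
    fix t
    show "marking_on (places N) (pre N t)" if "t \<in> transitions N"
      using mo[OF pre in_R, of t] that tr by (simp add: N_def)
    show "marking_on (places N) (post N t)" if "t \<in> elem_trans N \<union> abs_trans N"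
      using mo[OF post in_R, of t] that by (auto simp: N_def)
    show "marking_on (places N) (start N t)" if "t \<in> abs_trans N"
      using mo[OF start in_R, of t] that by (auto simp: N_def)
  qed
  then have "is_labelled_rpn N"
    using assms(1) in_R by (auto simp: is_labelled_rpn_def tr) (auto simp: N_def)
  moreover have "rules_of N = R"
  proof -
    have "rule_of N i = g i" if "i < n" for i
      using that by (cases "g i") (simp_all add: rule_of_def N_def count_inverse)
    then show ?thesis unfolding rules_of_def tr g by (intro image_cong) auto
  qed
  moreover have "Q \<subseteq> places N" by (simp add: N_def)
  ultimately show ?thesis by blast
qed

definition single :: "nat multiset \<Rightarrow> (nat, nat) state" where
  "single m = \<lparr>verts = {0}, edges = {}, mark = (\<lambda>_. count m), elabel = (\<lambda>_ _. 0)\<rparr>"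

lemma is_state_single: "set_mset m \<subseteq> places N \<Longrightarrow> is_state N (single m)"
  by (auto simp: is_state_def single_def is_empty_def rooted_tree_def marking_on_def)
    (meson count_eq_zero_iff subsetD)

lemma represents_single: "represents (single m) (Some (Node {#} m {#}))"
proof -
  have "rep (single m) 0 (Node {#} m (image_mset (\<lambda>_. undefined) (mset_set (children (single m) 0))))"
    by (rule repI) (auto simp: single_def)
  then show ?thesis by (auto simp: represents_def single_def rooted_tree_def)
qed

lemma reachability_languageI:
  fixes N :: "(nat, nat, 'a) labelled_rpn" and s\<^sub>f :: "(nat, nat) state"
  assumes "is_labelled_rpn N" "set_mset m \<subseteq> places N" "is_state N s\<^sub>f"
    "\<And>s X. represents s X \<Longrightarrow> s \<cong> s\<^sub>f \<longleftrightarrow> B X"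
  shows "{w. \<exists>X. runs (rules_of N) (Some (Node {#} m {#})) w X \<and> B X} \<in> reachability_languages"
proof -
  interpret net N using assms(1) by unfold_locales
  have "reachability_language N (single m) {s\<^sub>f} = {w. \<exists>X. runs R (Some (Node {#} m {#})) w X \<and> B X}"
    unfolding reachability_language_def
    by (rule run_language[OF represents_single]) (use assms(4) in auto)
  then show ?thesis
    unfolding reachability_languages_def
    using assms(1,3) is_state_single[OF assms(2)] by (intro CollectI exI[of _ N] exI[of _ "single m"] exI[of _ "{s\<^sub>f}"]) auto
qed

lemma emptying_language_is_reachability_language:
  fixes R :: "(nat, 'a) rule set"
  assumes "finite R"
  shows "emptying_language R m \<in> reachability_languages"
proof -
  obtain N :: "(nat, nat, 'a) labelled_rpn"
    where N: "is_labelled_rpn N" "rules_of N = R" "set_mset m \<subseteq> places N"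
    using rpn_of_rules[OF assms finite_set_mset] by blast
  have *: "s \<cong> empty_state \<longleftrightarrow> X = None" if "represents s X" for s :: "(nat, nat) state" and X
    using that by (auto simp: represents_def state_iso_def empty_state_def rooted_tree_def bij_betw_def split: option.splits)
  have "is_state N (empty_state :: (nat, nat) state)"
    by (simp add: is_state_def empty_state_def is_empty_def)
  from reachability_languageI[OF N(1,3) this, of "\<lambda>X. X = None", OF *]
  show ?thesis by (simp add: N(2) emptying_language_def)
qed

section \<open>Three equal blocks are a reachability language\<close>

text \<open>
  Places 0, 1, 2 mark the current block; places 3 and 4 count the letters 0 not yet matched by a
  letter 1, and the letters 1 not yet matched by a letter 2.
\<close>

definition abc_rules :: "(nat, nat) rule set" where
  "abc_rules = {El {#0#} {#0, 3#} (Some 0), El {#0#} {#1#} None, El {#1, 3#} {#1, 4#} (Some 1),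
    El {#1#} {#2#} None, El {#2, 4#} {#2#} (Some 2)}"

definition abc_marking :: "nat \<Rightarrow> nat \<Rightarrow> nat \<Rightarrow> nat multiset" where
  "abc_marking j i k = add_mset j (replicate_mset i 3 + replicate_mset k 4)"

lemma abc_marking_add:
  assumes "add_mset j r = abc_marking j' i k" "j < 3" "j' < 3"
  shows "j' = j \<and> r = replicate_mset i 3 + replicate_mset k 4"
proof -
  have "j \<in># abc_marking j' i k" unfolding assms(1)[symmetric] by simp
  then have "j = j'" using assms(2,3) by (auto simp: abc_marking_def split: if_splits)
  with assms(1) show ?thesis by (simp add: abc_marking_def)
qed

lemma replicate_add_left:
  assumes "add_mset x r = replicate_mset i x + replicate_mset k y" "x \<noteq> y"
  obtains i' where "i = Suc i'" "r = replicate_mset i' x + replicate_mset k y"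
proof (cases i)
  case 0
  have "x \<in># replicate_mset i x + replicate_mset k y" unfolding assms(1)[symmetric] by simp
  with 0 assms(2) show ?thesis by (simp split: if_splits)
next
  case (Suc i')
  with assms(1) that show ?thesis by simp
qed

lemma step_abc:
  assumes "step abc_rules (Node e m {#}) l X"
  obtains p q r where "El p q l \<in> abc_rules" "m = p + r" "X = Some (Node e (r + q) {#})"
  using assms by cases (auto simp: abc_rules_def)

text \<open>The invariant at block \<open>j\<close> with counters \<open>i\<close> and
  \<open>k\<close>, where \<open>n\<close> letters \<open>0\<close> are still to come. The exact
  final marking forces both counters to zero; in block 2 place 3 can no longer be emptied, hence
  \<open>i = 0\<close> there.\<close>

lemma abc_runs_only:
  assumes "runs abc_rules X w Y"
  shows "X = Some (Node e (abc_marking j i k) {#}) \<Longrightarrow> j < 3 \<Longrightarrow> Y = Some (Node e' {#2#} {#}) \<Longrightarrow>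
    \<exists>n. w = replicate n 0 @ replicate (if j = 2 then 0 else n + i) 1 @
        replicate (if j = 2 then k else n + i + k) 2 \<and> (j \<noteq> 0 \<longrightarrow> n = 0) \<and> (j = 2 \<longrightarrow> i = 0)"
  using assms
proof (induction arbitrary: j i k rule: runs.induct)
  case (runs_refl X)
  then have eq: "abc_marking j i k = {#2#}" by simp
  then have "size (abc_marking j i k) = 1" by simp
  then have "i = 0" "k = 0" by (simp_all add: abc_marking_def)
  with eq show ?case by (simp add: abc_marking_def)
next
  case (runs_step T l X w Y)
  obtain p q r where r: "El p q l \<in> abc_rules" "abc_marking j i k = p + r" "X = Some (Node e (r + q) {#})"
    using runs_step(1,4) step_abc by (metis option.inject)
  from r(1) consider
    "p = {#0#}" "q = {#0, 3#}" "l = Some 0" | "p = {#0#}" "q = {#1#}" "l = None"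
    | "p = {#1, 3#}" "q = {#1, 4#}" "l = Some 1" | "p = {#1#}" "q = {#2#}" "l = None"
    | "p = {#2, 4#}" "q = {#2#}" "l = Some 2"
    by (auto simp: abc_rules_def)
  then show ?case
  proof cases
    case 1
    then have *: "j = 0" "r = replicate_mset i 3 + replicate_mset k 4"
      using abc_marking_add[of 0 r j i k] r(2) runs_step.prems(2) by auto
    have "X = Some (Node e (abc_marking 0 (Suc i) k) {#})"
      using r(3) 1 * by (simp add: abc_marking_def)
    from runs_step.IH[OF this _ runs_step.prems(3)] obtain n where
      "w = replicate n 0 @ replicate (n + Suc i) 1 @ replicate (n + Suc i + k) 2" by auto
    then show ?thesis using 1 * by (intro exI[of _ "Suc n"]) simp
  next
    case 2
    then have *: "j = 0" "r = replicate_mset i 3 + replicate_mset k 4"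
      using abc_marking_add[of 0 r j i k] r(2) runs_step.prems(2) by auto
    have "X = Some (Node e (abc_marking 1 i k) {#})"
      using r(3) 2 * by (simp add: abc_marking_def)
    from runs_step.IH[OF this _ runs_step.prems(3)] have
      "w = replicate i 1 @ replicate (i + k) 2" by auto
    then show ?thesis using 2 * by (intro exI[of _ 0]) simp
  next
    case 3
    then have *: "j = 1" "add_mset 3 r = replicate_mset i 3 + replicate_mset k 4"
      using abc_marking_add[of 1 "add_mset 3 r" j i k] r(2) runs_step.prems(2) by auto
    obtain i' where i': "i = Suc i'" "r = replicate_mset i' 3 + replicate_mset k 4"
      using replicate_add_left[OF *(2)] by auto
    have "X = Some (Node e (abc_marking 1 i' (Suc k)) {#})"
      using r(3) 3 i' by (simp add: abc_marking_def)
    from runs_step.IH[OF this _ runs_step.prems(3)] have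
      "w = replicate i' 1 @ replicate (i' + Suc k) 2" by auto
    then show ?thesis using 3 * i' by (intro exI[of _ 0]) simp
  next
    case 4
    then have *: "j = 1" "r = replicate_mset i 3 + replicate_mset k 4"
      using abc_marking_add[of 1 r j i k] r(2) runs_step.prems(2) by auto
    have "X = Some (Node e (abc_marking 2 i k) {#})"
      using r(3) 4 * by (simp add: abc_marking_def)
    from runs_step.IH[OF this _ runs_step.prems(3)] have
      "w = replicate k 2" "i = 0" by auto
    then show ?thesis using 4 * by (intro exI[of _ 0]) simp
  next
    case 5
    then have *: "j = 2" "add_mset 4 r = replicate_mset k 4 + replicate_mset i 3"
      using abc_marking_add[of 2 "add_mset 4 r" j i k] r(2) runs_step.prems(2) by auto
    obtain k' where k': "k = Suc k'" "r = replicate_mset k' 4 + replicate_mset i 3"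
      using replicate_add_left[OF *(2)] by auto
    have "X = Some (Node e (abc_marking 2 i k') {#})"
      using r(3) 5 k' by (simp add: abc_marking_def)
    from runs_step.IH[OF this _ runs_step.prems(3)] have
      "w = replicate k' 2" "i = 0" by auto
    then show ?thesis using 5 * k' by (intro exI[of _ 0]) simp
  qed
qed

lemma abc_runs_El:
  assumes "El p q l \<in> abc_rules" "m = p + r" "runs abc_rules (Some (Node e (r + q) cs)) w Y"
  shows "runs abc_rules (Some (Node e m cs)) (lab l @ w) Y"
  using runs_step[OF step_El[OF assms(1)] assms(3)] assms(2) by simp

lemma abc_runs_2:
  "runs abc_rules (Some (Node e (abc_marking 2 0 k) {#})) (replicate k 2) (Some (Node e {#2#} {#}))"
proof (induction k)
  case 0
  show ?case by (simp add: abc_marking_def runs_refl)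
next
  case (Suc k)
  have "El {#2, 4#} {#2#} (Some 2) \<in> abc_rules" by (simp add: abc_rules_def)
  from abc_runs_El[OF this, of "abc_marking 2 0 (Suc k)" "replicate_mset k 4" e "{#}" "replicate k 2"]
  show ?case using Suc by (simp add: abc_marking_def)
qed

lemma abc_runs_1:
  "runs abc_rules (Some (Node e (abc_marking 1 i k) {#})) (replicate i 1 @ replicate (i + k) 2)
    (Some (Node e {#2#} {#}))"
proof (induction i arbitrary: k)
  case 0
  have "El {#1#} {#2#} None \<in> abc_rules" by (simp add: abc_rules_def)
  from abc_runs_El[OF this, of "abc_marking 1 0 k" "replicate_mset k 4" e "{#}" "replicate k 2"]
  show ?case using abc_runs_2[of e k] by (simp add: abc_marking_def)
next
  case (Suc i)
  have "El {#1, 3#} {#1, 4#} (Some 1) \<in> abc_rules" by (simp add: abc_rules_def)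
  from abc_runs_El[OF this, of "abc_marking 1 (Suc i) k" "replicate_mset i 3 + replicate_mset k 4" e "{#}"
      "replicate i 1 @ replicate (i + Suc k) 2"]
  show ?case using Suc[of "Suc k"] by (simp add: abc_marking_def)
qed

lemma abc_runs_0:
  "runs abc_rules (Some (Node e (abc_marking 0 i 0) {#}))
    (replicate n 0 @ replicate (n + i) 1 @ replicate (n + i) 2) (Some (Node e {#2#} {#}))"
proof (induction n arbitrary: i)
  case 0
  have "El {#0#} {#1#} None \<in> abc_rules" by (simp add: abc_rules_def)
  from abc_runs_El[OF this, of "abc_marking 0 i 0" "replicate_mset i 3" e "{#}" "replicate i 1 @ replicate i 2"]
  show ?case using abc_runs_1[of e i 0] by (simp add: abc_marking_def)
next
  case (Suc n)
  have "El {#0#} {#0, 3#} (Some 0) \<in> abc_rules" by (simp add: abc_rules_def)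
  from abc_runs_El[OF this, of "abc_marking 0 i 0" "replicate_mset i 3" e "{#}"
      "replicate n 0 @ replicate (n + Suc i) 1 @ replicate (n + Suc i) 2"]
  show ?case using Suc[of "Suc i"] by (simp add: abc_marking_def)
qed

lemma abc_runs:
  "{w. \<exists>X. runs abc_rules (Some (Node {#} {#0#} {#})) w X \<and> (\<exists>e. X = Some (Node e {#2#} {#}))} = range abc"
proof (intro equalityI subsetI)
  have 0: "{#0#} = abc_marking 0 0 0" by (simp add: abc_marking_def)
  fix w
  {
    assume "w \<in> {w. \<exists>X. runs abc_rules (Some (Node {#} {#0#} {#})) w X \<and> (\<exists>e. X = Some (Node e {#2#} {#}))}"
    then obtain e where w: "runs abc_rules (Some (Node {#} {#0#} {#})) w (Some (Node e {#2#} {#}))" by blast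
    then have "elab (Node e {#2#} {#}) = {#}" using runs_elab[OF w] by simp
    then show "w \<in> range abc"
      using abc_runs_only[OF w, of "{#}" 0 0 0] 0 by (auto simp: abc_def)
  next
    assume "w \<in> range abc"
    then obtain n where "w = abc n" by blast
    then show "w \<in> {w. \<exists>X. runs abc_rules (Some (Node {#} {#0#} {#})) w X \<and> (\<exists>e. X = Some (Node e {#2#} {#}))}"
      using abc_runs_0[of "{#}" 0 n] 0 by (auto simp: abc_def)
  }
qed

text \<open>The label \<open>e\<close> is existential because a representing tree carries an
  arbitrary label at its root.\<close>

lemma state_iso_single:
  fixes s :: "(nat, nat) state"
  assumes "represents s X"
  shows "s \<cong> single m \<longleftrightarrow> (\<exists>e. X = Some (Node e m {#}))"
proof
  assume "s \<cong> single m"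
  then obtain f :: "nat \<Rightarrow> nat" where f: "bij_betw f (verts s) {0}" "\<forall>v \<in> verts s. mark s v = count m"
    "\<forall>v \<in> verts s. \<forall>w \<in> verts s. (v, w) \<notin> edges s"
    by (auto simp: state_iso_def single_def)
  have "verts s \<noteq> {}" using f(1) by (auto simp: bij_betw_def)
  then obtain T r where T: "X = Some T" "rooted_tree (verts s) (edges s) r" "rep s r T"
    using assms by (auto simp: represents_def split: option.splits)
  obtain e m' cs where N: "T = Node e m' cs" by (cases T)
  have r: "r \<in> verts s" "children s r = {}" using T(2) f(3) by (auto simp: rooted_tree_def)
  have "count m' = mark s r" "cs = {#}" using T(3) r(2) unfolding N by (auto elim!: rep.cases)
  then have "m' = m" "cs = {#}" using f(2) r(1) by (auto simp: multiset_eq_iff)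
  then show "\<exists>e. X = Some (Node e m {#})" using T(1) N by blast
next
  assume "\<exists>e. X = Some (Node e m {#})"
  then obtain e r where T: "rooted_tree (verts s) (edges s) r" "rep s r (Node e m {#})"
    using assms by (auto simp: represents_def)
  obtain g where g: "count m = mark s r" "finite (children s r)" "{#} = image_mset g (mset_set (children s r))"
    "\<And>w. w \<in> children s r \<Longrightarrow> rep s w (g w) \<and> count (elab (g w)) = elabel s (r, w)"
    using rep_below[OF T(2)] by blast
  have children: "children s r = {}" using g(2,3) by (metis image_mset_is_empty_iff mset_set_empty_iff)
  have V: "v = r" if "v \<in> verts s" for v
  proof -
    have "(r, v) \<in> (edges s)\<^sup>*" using T(1) that by (simp add: rooted_tree_def)
    then show ?thesis by (rule converse_rtranclE) (use children in auto)
  qed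
  have rV: "r \<in> verts s" using T(1) by (simp add: rooted_tree_def)
  then have verts: "verts s = {r}" using V by blast
  then have "edges s \<subseteq> {r} \<times> {r}" using T(1) by (simp add: rooted_tree_def)
  then have "edges s = {}" using children by auto
  then show "s \<cong> single m"
    using verts g(1) by (auto simp: state_iso_def single_def bij_betw_def)
qed

lemma abc_reachability: "range abc \<in> reachability_languages"
proof -
  have "finite abc_rules" by (simp add: abc_rules_def)
  then obtain N :: "(nat, nat, nat) labelled_rpn"
    where N: "is_labelled_rpn N" "rules_of N = abc_rules" "{0, 2} \<subseteq> places N"
    using rpn_of_rules[of abc_rules "{0, 2}"] by auto
  have "set_mset {#0#} \<subseteq> places N" "is_state N (single {#2#})"
    using N(3) is_state_single[of "{#2#}" N] by auto
  from reachability_languageI[OF N(1) this, of "\<lambda>X. \<exists>e. X = Some (Node e {#2#} {#})", OF state_iso_single]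
  show ?thesis unfolding N(2) abc_runs .
qed

section \<open>The inclusion and its strictness\<close>

lemma coverability_language_cases:
  assumes "L \<in> (coverability_languages :: 'a list set set)"
  shows "L \<in> reachability_languages \<and> L \<subseteq> {[]} \<or>
    (\<exists>(G :: (nat place, 'a) rule set) m. finite G \<and> L = emptying_language G m)"
proof -
  obtain N :: "(nat, nat, 'a) labelled_rpn" and s\<^sub>0 :: "(nat, nat) state" and S\<^sub>f where
    L: "L = coverability_language N s\<^sub>0 S\<^sub>f" "is_labelled_rpn N" "is_state N s\<^sub>0" "finite S\<^sub>f"
      "\<forall>s \<in> S\<^sub>f. is_state N s"
    using assms unfolding coverability_languages_def by blast
  interpret net N using L(2) by unfold_locales
  show ?thesis
  proof (cases "is_empty s\<^sub>0")
    case True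
    note e = empty_initial_languages[OF True L(5,3)]
    have "L \<in> reachability_languages"
      unfolding reachability_languages_def using L e(1) by blast
    then show ?thesis using e(2) L(1) by blast
  next
    case False
    then obtain T flag F where "finite F" "\<forall>x \<in> F. elab x = {#}" "L = covering_language R T flag F"
      using coverability_language_is_covering_language[OF L(3) _ L(4,5)] L(1) by auto
    then show ?thesis
      using covering_language_is_emptying_language[OF finite_R] by metis
  qed
qed

theorem theorem4:
  "(coverability_languages :: nat list set set) \<subset> reachability_languages"
proof
  show "(coverability_languages :: nat list set set) \<subseteq> reachability_languages"
  proof
    fix L :: "nat list set" assume "L \<in> coverability_languages"
    from coverability_language_cases[OF this] show "L \<in> reachability_languages"
    proof
      assume "\<exists>(G :: (nat place, nat) rule set) m. finite G \<and> L = emptying_language G m"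
      then obtain G :: "(nat place, nat) rule set" and m where G: "finite G" "L = emptying_language G m" by blast
      \<comment> \<open>The places of the guessing net involve duties and trees; they are renamed to
        natural numbers, as nets in the two families require.\<close>
      have "L = emptying_language (rename_rule to_nat ` G) (image_mset to_nat m)"
        using emptying_language_rename[OF inj_to_nat] G(2) by metis
      then show ?thesis using emptying_language_is_reachability_language[OF finite_imageI[OF G(1)]] by simp
    qed blast
  qed
  have "range abc \<notin> coverability_languages"
  proof
    assume "range abc \<in> coverability_languages"
    from coverability_language_cases[OF this] show False
    proof
      assume "range abc \<in> reachability_languages \<and> range abc \<subseteq> {[]}"
      then have "abc 1 = []" by blast
      then show False by (simp add: abc_def)
    next
      assume "\<exists>(G :: (nat place, nat) rule set) m. finite G \<and> range abc = emptying_language G m"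
      then show False using emptying_language_not_abc by metis
    qed
  qed
  then show "(coverability_languages :: nat list set set) \<noteq> reachability_languages"
    using abc_reachability by blast
qed

end
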